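(* Let $k$ be a commutative ring containing $\mathbb{Q}$. Then: (i) There exists an injective natural transformation $\eta\colon \mathrm{red}\circ \mathrm{MC} \Rightarrow \mathrm{MC}\circ\mathrm{red}$ of functors from coisotropic DGLAs over $k$ to sets, i.e. a natural transformation all of whose components $\eta_{\mathfrak g}\colon \mathrm{MC}(\mathfrak g)_{\mathrm{red}} \to \mathrm{MC}(\mathfrak g_{\mathrm{red}})$ are injective. (ii) There exists a natural isomorphism $\eta\colon \mathrm{red}\circ G \Rightarrow G\circ \mathrm{red}$ of functors from coisotropic DGLAs over $k$ to groups, with components $\eta_{\mathfrak g}\colon G(\mathfrak g)_{\mathrm{red}} \to G(\mathfrak g_{\mathrm{red}})$ (in particular $\eta$ is injective). (iii) There exists an injective natural transformation $\eta\colon \mathrm{red}\circ \mathrm{Def} \Rightarrow \mathrm{Def}\circ\mathrm{red}$ of functors from coisotropic DGLAs over $k$ to sets, i.e. a natural transformation all of whose components $\eta_{\mathfrak g}\colon \mathrm{Def}(\mathfrak g)_{\mathrm{red}} \to \mathrm{Def}(\mathfrak g_{\mathrm{red}})$ are injective.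
   Context: Conventions: $k$ is a commutative unital ring with $\mathbb{Q}\subseteq k$. Coisotropic DGLA: a coisotropic DGLA $\mathfrak g$ over $k$ consists of two ($\mathbb Z$-graded) differential graded Lie algebras $(\mathfrak g_{\mathrm{tot}}^\bullet,[\cdot,\cdot]_{\mathrm{tot}},d_{\mathrm{tot}})$ and $(\mathfrak g_N^\bullet,[\cdot,\cdot]_N,d_N)$ over $k$, a degree $0$ DGLA morphism $\iota_{\mathfrak g}\colon \mathfrak g_N\to\mathfrak g_{\mathrm{tot}}$, and a graded Lie ideal $\mathfrak g_0^\bullet\subseteq \mathfrak g_N^\bullet$ with $d_N(\mathfrak g_0^\bullet)\subseteq \mathfrak g_0^{\bullet+1}$. A morphism $\Phi\colon\mathfrak g\to\mathfrak h$ is a pair of DGLA morphisms $\Phi_{\mathrm{tot}}\colon\mathfrak g_{\mathrm{tot}}\to\mathfrak h_{\mathrm{tot}}$, $\Phi_N\colon\mathfrak g_N\to\mathfrak h_N$ with $\Phi_{\mathrm{tot}}\circ\iota_{\mathfrak g}=\iota_{\mathfrak h}\circ\Phi_N$ and $\Phi_N(\mathfrak g_0)\subseteq\mathfrak h_0$. Reduction: $\mathfrak g_{\mathrm{red}}=\mathfrak g_N/\mathfrak g_0$, an ordinary DGLA, functorial in $\mathfrak g$ via $\Phi_N$. Coisotropic set: a pair of sets $M_{\mathrm{tot}},M_N$ with a map $\iota_M\colon M_N\to M_{\mathrm{tot}}$ and an equivalence relation $\sim$ on $M_N$; morphisms are pairs of maps compatible with $\iota$ whose $N$-part preserves $\sim$.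 Reduction: $M_{\mathrm{red}}=M_N/{\sim}$. Coisotropic group: groups $G_{\mathrm{tot}},G_N$, a homomorphism $\iota_G\colon G_N\to G_{\mathrm{tot}}$, and a normal subgroup $G_0\subseteq G_N$; morphisms are pairs of homomorphisms compatible with $\iota$ whose $N$-part maps the $0$-component into the $0$-component. Reduction: $G_{\mathrm{red}}=G_N/G_0$. Maurer-Cartan elements: for an ordinary DGLA $\mathfrak h$, $\mathrm{MC}(\mathfrak h)=\{\xi\in\mathfrak h^1 : d\xi+\tfrac12[\xi,\xi]=0\}$. For a coisotropic DGLA, $\mathrm{MC}(\mathfrak g)$ is the coisotropic set $(\mathrm{MC}(\mathfrak g_{\mathrm{tot}}),\mathrm{MC}(\mathfrak g_N),\sim_{\mathrm{MC}})$ with map induced by $\iota_{\mathfrak g}$ and $\xi_1\sim_{\mathrm{MC}}\xi_2 :\Leftrightarrow \xi_1-\xi_2\in\mathfrak g_0^1$. Formal power series: for a coisotropic DGLA $\mathfrak g$, $\mathfrak g[[\lambda]]$ is the coisotropic DGLA with components $\mathfrak g_{\mathrm{tot}}[[\lambda]],\mathfrak g_N[[\lambda]],\mathfrak g_0[[\lambda]]$ with $\lambda$-linearly extended structure maps; $\lambda\mathfrak g[[\lambda]]$ is the sub-object of series without constant term. Gauge group: for an ordinary DGLA $\mathfrak h$, $G(\mathfrak h)=\lambda\mathfrak h^0[[\lambda]]$ with multiplication given by the Baker-Campbell-Hausdorff series. For a coisotropic DGLA, $G(\mathfrak g)=(\lambda\mathfrak g^0_{\mathrm{tot}}[[\lambda]],\lambda\mathfrak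 g^0_N[[\lambda]],\lambda\mathfrak g^0_0[[\lambda]])$, a coisotropic group with BCH multiplication. The gauge group $G(\mathfrak h)$ acts on $\mathrm{MC}(\lambda\mathfrak h[[\lambda]])$ by $$\lambda g\triangleright\xi = e^{\lambda\,\mathrm{ad}(g)}(\xi)-\lambda\sum_{j\ge0}\frac{(\lambda\,\mathrm{ad}(g))^j}{(1+j)!}(dg).$$ Deformation functor: for an ordinary DGLA $\mathfrak h$, $\mathrm{Def}(\mathfrak h)=\mathrm{MC}(\lambda\mathfrak h[[\lambda]])/G(\mathfrak h)$. For a coisotropic DGLA, $\mathrm{Def}(\mathfrak g)$ is given by $\mathrm{Def}(\mathfrak g)_{\mathrm{tot}}=\mathrm{MC}(\lambda\mathfrak g_{\mathrm{tot}}[[\lambda]])/G(\mathfrak g)_{\mathrm{tot}}$ and $\mathrm{Def}(\mathfrak g)_N=\mathrm{MC}(\lambda\mathfrak g_N[[\lambda]])/G(\mathfrak g)_N$, with map induced by $\iota_{\mathfrak g}$, and the equivalence relation on $\mathrm{Def}(\mathfrak g)_N$ defined by $[\xi_1]\sim[\xi_2] :\Leftrightarrow \xi_1\sim_{\mathrm{MC}}\xi_2$ (where $\sim_{\mathrm{MC}}$ is the relation of the coisotropic set $\mathrm{MC}(\lambda\mathfrak g[[\lambda]])$). All of $\mathrm{MC}$, $G$, $\mathrm{Def}$ act on morphisms by ($\lambda$-linear extension of) the components of $\Phi$. *)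

theory Defs
  imports Complex_Main "HOL-Algebra.Group_Action" "HOL-Algebra.QuotRing" "HOL-Algebra.Module"
begin

section \<open>Categories, functors and natural transformations\<close>

record ('o, 'm) category =
  objects :: "'o set"
  arrows :: "'o \<Rightarrow> 'o \<Rightarrow> 'm set"
  identity :: "'o \<Rightarrow> 'm"
  compose_arrows :: "'m \<Rightarrow> 'm \<Rightarrow> 'm" \<comment> \<open>\<open>compose_arrows C g f\<close> is \<open>g\<close> after \<open>f\<close>\<close>

record ('o, 'm, 'p, 'n) functor_data =
  ob :: "'o \<Rightarrow> 'p"
  mor :: "'o \<Rightarrow> 'o \<Rightarrow> 'm \<Rightarrow> 'n"

definition compose_functor (infixr \<open>\<circ>\<^sub>F\<close> 55) where
  "compose_functor G F =
     \<lparr>ob = (\<lambda>A. ob G (ob F A)), mor = (\<lambda>A B f. mor G (ob F A) (ob F B) (mor F A B f))\<rparr>"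

text \<open>
  A map is represented by a total HOL function of which only the values on the source carrier
  matter. Accordingly, the laws below are stated pointwise on carriers.
\<close>

definition functor_to_sets ::
  "('o, 'm) category \<Rightarrow> ('o, 'm, 'x set, 'x \<Rightarrow> 'x) functor_data \<Rightarrow> bool" where
  "functor_to_sets C F \<longleftrightarrow>
     (\<forall>A\<in>objects C. \<forall>B\<in>objects C. \<forall>f\<in>arrows C A B. mor F A B f \<in> ob F A \<rightarrow> ob F B) \<and>
     (\<forall>A\<in>objects C. \<forall>x\<in>ob F A. mor F A A (identity C A) x = x) \<and>
     (\<forall>A\<in>objects C. \<forall>B\<in>objects C. \<forall>D\<in>objects C. \<forall>f\<in>arrows C A B. \<forall>g\<in>arrows C B D.
        \<forall>x\<in>ob F A. mor F A D (compose_arrows C g f) x = mor F B D g (mor F A B f x))"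

definition functor_to_groups ::
  "('o, 'm) category \<Rightarrow> ('o, 'm, 'x monoid, 'x \<Rightarrow> 'x) functor_data \<Rightarrow> bool" where
  "functor_to_groups C F \<longleftrightarrow>
     (\<forall>A\<in>objects C. group (ob F A)) \<and>
     (\<forall>A\<in>objects C. \<forall>B\<in>objects C. \<forall>f\<in>arrows C A B. mor F A B f \<in> hom (ob F A) (ob F B)) \<and>
     (\<forall>A\<in>objects C. \<forall>x\<in>carrier (ob F A). mor F A A (identity C A) x = x) \<and>
     (\<forall>A\<in>objects C. \<forall>B\<in>objects C. \<forall>D\<in>objects C. \<forall>f\<in>arrows C A B. \<forall>g\<in>arrows C B D.
        \<forall>x\<in>carrier (ob F A). mor F A D (compose_arrows C g f) x = mor F B D g (mor F A B f x))"

definition set_natural_transformation ::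
  "('o, 'm) category \<Rightarrow> ('o, 'm, 'x set, 'x \<Rightarrow> 'x) functor_data \<Rightarrow>
   ('o, 'm, 'y set, 'y \<Rightarrow> 'y) functor_data \<Rightarrow> ('o \<Rightarrow> 'x \<Rightarrow> 'y) \<Rightarrow> bool" where
  "set_natural_transformation C F G \<eta> \<longleftrightarrow>
     functor_to_sets C F \<and> functor_to_sets C G \<and>
     (\<forall>A\<in>objects C. \<eta> A \<in> ob F A \<rightarrow> ob G A) \<and>
     (\<forall>A\<in>objects C. \<forall>B\<in>objects C. \<forall>f\<in>arrows C A B. \<forall>x\<in>ob F A.
        \<eta> B (mor F A B f x) = mor G A B f (\<eta> A x))"

definition group_natural_transformation ::
  "('o, 'm) category \<Rightarrow> ('o, 'm, 'x monoid, 'x \<Rightarrow> 'x) functor_data \<Rightarrow>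
   ('o, 'm, 'y monoid, 'y \<Rightarrow> 'y) functor_data \<Rightarrow> ('o \<Rightarrow> 'x \<Rightarrow> 'y) \<Rightarrow> bool" where
  "group_natural_transformation C F G \<eta> \<longleftrightarrow>
     functor_to_groups C F \<and> functor_to_groups C G \<and>
     (\<forall>A\<in>objects C. \<eta> A \<in> hom (ob F A) (ob G A)) \<and>
     (\<forall>A\<in>objects C. \<forall>B\<in>objects C. \<forall>f\<in>arrows C A B. \<forall>x\<in>carrier (ob F A).
        \<eta> B (mor F A B f x) = mor G A B f (\<eta> A x))"


section \<open>Differential graded Lie algebras\<close>

definition rat_ring :: "rat ring" where
  "rat_ring = \<lparr>carrier = UNIV, mult = (*), one = 1, zero = 0, add = (+)\<rparr>"

text \<open>
  All homogeneous components live in one HOL type \<open>'a\<close>; \<open>bracket h i j\<close> is the bracket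
  \<open>h\<^sup>i \<times> h\<^sup>j \<rightarrow> h\<^sup>i\<^sup>+\<^sup>j\<close> and \<open>differential h i\<close> the differential \<open>h\<^sup>i \<rightarrow> h\<^sup>i\<^sup>+\<^sup>1\<close>.
\<close>

record ('r, 'a) dgla =
  component :: "int \<Rightarrow> ('r, 'a) module"
  bracket :: "int \<Rightarrow> int \<Rightarrow> 'a \<Rightarrow> 'a \<Rightarrow> 'a"
  differential :: "int \<Rightarrow> 'a \<Rightarrow> 'a"

definition signed :: "('r, 'a) module \<Rightarrow> int \<Rightarrow> 'a \<Rightarrow> 'a" where \<comment> \<open>\<open>(-1)\<^sup>i x\<close>\<close>
  "signed M i x = (if even i then x else \<ominus>\<^bsub>M\<^esub> x)"

definition module_map ::
  "('r, 'm) ring_scheme \<Rightarrow> ('r, 'a) module \<Rightarrow> ('r, 'b) module \<Rightarrow> ('a \<Rightarrow> 'b) \<Rightarrow> bool" where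
  "module_map k M M' f \<longleftrightarrow>
     f \<in> carrier M \<rightarrow> carrier M' \<and>
     (\<forall>x\<in>carrier M. \<forall>y\<in>carrier M. f (x \<oplus>\<^bsub>M\<^esub> y) = f x \<oplus>\<^bsub>M'\<^esub> f y) \<and>
     (\<forall>c\<in>carrier k. \<forall>x\<in>carrier M. f (c \<odot>\<^bsub>M\<^esub> x) = c \<odot>\<^bsub>M'\<^esub> f x)"

locale dgla =
  fixes k :: "('r, 'm) ring_scheme" and h :: "('r, 'a) dgla"
  assumes component_module: "module k (component h i)"
    and bracket_linear_right:
      "x \<in> carrier (component h i) \<Longrightarrow>
       module_map k (component h j) (component h (i + j)) (bracket h i j x)"
    and bracket_linear_left:
      "y \<in> carrier (component h j) \<Longrightarrow>
       module_map k (component h i) (component h (i + j)) (\<lambda>x. bracket h i j x y)"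
    and bracket_antisymmetric:
      "\<lbrakk>x \<in> carrier (component h i); y \<in> carrier (component h j)\<rbrakk> \<Longrightarrow>
       bracket h i j x y = signed (component h (i + j)) (i * j + 1) (bracket h j i y x)"
    and bracket_jacobi:
      "\<lbrakk>x \<in> carrier (component h i); y \<in> carrier (component h j); z \<in> carrier (component h l)\<rbrakk> \<Longrightarrow>
       bracket h i (j + l) x (bracket h j l y z) =
         bracket h (i + j) l (bracket h i j x y) z
         \<oplus>\<^bsub>component h (i + j + l)\<^esub>
         signed (component h (i + j + l)) (i * j) (bracket h j (i + l) y (bracket h i l x z))"
    and differential_linear:
      "module_map k (component h i) (component h (i + 1)) (differential h i)"
    and differential_square:
      "x \<in> carrier (component h i) \<Longrightarrow>
       differential h (i + 1) (differential h i x) = \<zero>\<^bsub>component h (i + 2)\<^esub>"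
    and differential_bracket:
      "\<lbrakk>x \<in> carrier (component h i); y \<in> carrier (component h j)\<rbrakk> \<Longrightarrow>
       differential h (i + j) (bracket h i j x y) =
         bracket h (i + 1) j (differential h i x) y
         \<oplus>\<^bsub>component h (i + j + 1)\<^esub>
         signed (component h (i + j + 1)) i (bracket h i (j + 1) x (differential h j y))"

definition dgla_morphism ::
  "('r, 'm) ring_scheme \<Rightarrow> ('r, 'a) dgla \<Rightarrow> ('r, 'b) dgla \<Rightarrow> (int \<Rightarrow> 'a \<Rightarrow> 'b) \<Rightarrow> bool" where
  "dgla_morphism k h h' \<phi> \<longleftrightarrow>
     (\<forall>i. module_map k (component h i) (component h' i) (\<phi> i)) \<and>
     (\<forall>i j. \<forall>x\<in>carrier (component h i). \<forall>y\<in>carrier (component h j).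
        \<phi> (i + j) (bracket h i j x y) = bracket h' i j (\<phi> i x) (\<phi> j y)) \<and>
     (\<forall>i. \<forall>x\<in>carrier (component h i).
        \<phi> (i + 1) (differential h i x) = differential h' i (\<phi> i x))"


section \<open>Coisotropic DGLAs, sets and groups, and their reduction\<close>

record ('r, 'a, 'b) cois_dgla =
  dgla_tot :: "('r, 'a) dgla"
  dgla_N :: "('r, 'b) dgla"
  dgla_iota :: "int \<Rightarrow> 'b \<Rightarrow> 'a"
  dgla_0 :: "int \<Rightarrow> 'b set"

locale cois_dgla =
  fixes k :: "('r, 'm) ring_scheme" and g :: "('r, 'a, 'b) cois_dgla"
  assumes tot: "dgla k (dgla_tot g)"
    and N: "dgla k (dgla_N g)"
    and iota: "dgla_morphism k (dgla_N g) (dgla_tot g) (dgla_iota g)"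
    and null_submodule: "submodule (dgla_0 g i) k (component (dgla_N g) i)"
    and null_ideal:
      "\<lbrakk>x \<in> carrier (component (dgla_N g) i); y \<in> dgla_0 g j\<rbrakk> \<Longrightarrow>
       bracket (dgla_N g) i j x y \<in> dgla_0 g (i + j)"
    and null_differential: "x \<in> dgla_0 g i \<Longrightarrow> differential (dgla_N g) i x \<in> dgla_0 g (i + 1)"

type_synonym ('a, 'b) cois_dgla_map = "(int \<Rightarrow> 'a \<Rightarrow> 'a) \<times> (int \<Rightarrow> 'b \<Rightarrow> 'b)"

definition cois_dgla_morphism ::
  "('r, 'm) ring_scheme \<Rightarrow> ('r, 'a, 'b) cois_dgla \<Rightarrow> ('r, 'a, 'b) cois_dgla \<Rightarrow>
   ('a, 'b) cois_dgla_map \<Rightarrow> bool" where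
  "cois_dgla_morphism k g h \<Phi> \<longleftrightarrow>
     dgla_morphism k (dgla_tot g) (dgla_tot h) (fst \<Phi>) \<and>
     dgla_morphism k (dgla_N g) (dgla_N h) (snd \<Phi>) \<and>
     (\<forall>i. \<forall>x\<in>carrier (component (dgla_N g) i).
        fst \<Phi> i (dgla_iota g i x) = dgla_iota h i (snd \<Phi> i x)) \<and>
     (\<forall>i. snd \<Phi> i ` dgla_0 g i \<subseteq> dgla_0 h i)"

definition cois_dgla_category ::
  "('r, 'm) ring_scheme \<Rightarrow> (('r, 'a, 'b) cois_dgla, ('a, 'b) cois_dgla_map) category" where
  "cois_dgla_category k =
     \<lparr>objects = {g. cois_dgla k g},
      arrows = (\<lambda>g h. {\<Phi>. cois_dgla_morphism k g h \<Phi>}),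
      identity = (\<lambda>g. (\<lambda>i x. x, \<lambda>i x. x)),
      compose_arrows = (\<lambda>\<Psi> \<Phi>. (\<lambda>i. fst \<Psi> i \<circ> fst \<Phi> i, \<lambda>i. snd \<Psi> i \<circ> snd \<Phi> i))\<rparr>"

text \<open>
  The library's \<open>module\<close> record extends \<open>ring\<close>; its fields \<open>mult\<close> and \<open>one\<close> play no role for
  modules.
\<close>

definition quotient_module :: "('r, 'a) module \<Rightarrow> 'a set \<Rightarrow> ('r, 'a set) module" where
  "quotient_module M U =
     \<lparr>carrier = a_rcosets\<^bsub>M\<^esub> U, mult = undefined, one = undefined, zero = U, add = set_add M,
      smult = (\<lambda>c X. \<Union>x\<in>X. U +>\<^bsub>M\<^esub> (c \<odot>\<^bsub>M\<^esub> x))\<rparr>"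

definition red_dgla :: "('r, 'a, 'b) cois_dgla \<Rightarrow> ('r, 'b set) dgla" where
  "red_dgla g =
     \<lparr>component = (\<lambda>i. quotient_module (component (dgla_N g) i) (dgla_0 g i)),
      bracket = (\<lambda>i j X Y. \<Union>x\<in>X. \<Union>y\<in>Y.
        dgla_0 g (i + j) +>\<^bsub>component (dgla_N g) (i + j)\<^esub> bracket (dgla_N g) i j x y),
      differential = (\<lambda>i X. \<Union>x\<in>X.
        dgla_0 g (i + 1) +>\<^bsub>component (dgla_N g) (i + 1)\<^esub> differential (dgla_N g) i x)\<rparr>"

definition red_dgla_map ::
  "('r, 'a, 'b) cois_dgla \<Rightarrow> ('a, 'b) cois_dgla_map \<Rightarrow> int \<Rightarrow> 'b set \<Rightarrow> 'b set" where
  "red_dgla_map h \<Phi> i X = (\<Union>x\<in>X. dgla_0 h i +>\<^bsub>component (dgla_N h) i\<^esub> snd \<Phi> i x)"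

definition Red_dgla ::
  "(('r, 'a, 'b) cois_dgla, ('a, 'b) cois_dgla_map, ('r, 'b set) dgla, int \<Rightarrow> 'b set \<Rightarrow> 'b set)
   functor_data" where
  "Red_dgla = \<lparr>ob = red_dgla, mor = (\<lambda>g h. red_dgla_map h)\<rparr>"

record ('x, 'y) cois_set =
  set_tot :: "'x set"
  set_N :: "'y set"
  set_iota :: "'y \<Rightarrow> 'x"
  set_rel :: "('y \<times> 'y) set"

definition Red_set ::
  "(('x, 'y) cois_set, ('x \<Rightarrow> 'x) \<times> ('y \<Rightarrow> 'y), 'y set set, 'y set \<Rightarrow> 'y set) functor_data" where
  "Red_set = \<lparr>ob = (\<lambda>M. set_N M // set_rel M),
              mor = (\<lambda>M M' f X. \<Union>x\<in>X. set_rel M' `` {snd f x})\<rparr>"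

record ('x, 'y) cois_group =
  group_tot :: "'x monoid"
  group_N :: "'y monoid"
  group_iota :: "'y \<Rightarrow> 'x"
  group_0 :: "'y set"

definition Red_group ::
  "(('x, 'y) cois_group, ('x \<Rightarrow> 'x) \<times> ('y \<Rightarrow> 'y), 'y set monoid, 'y set \<Rightarrow> 'y set)
   functor_data" where
  "Red_group = \<lparr>ob = (\<lambda>G. group_N G Mod group_0 G),
                mor = (\<lambda>G H f X. \<Union>x\<in>X. group_0 H #>\<^bsub>group_N H\<^esub> snd f x)\<rparr>"


section \<open>Formal power series\<close>

text \<open>The series \<open>\<Sum>\<^sub>n \<lambda>\<^sup>n f\<^sub>n\<close> is represented by its coefficient sequence \<open>f\<close>.\<close>

definition series_module :: "('r, 'a) module \<Rightarrow> ('r, nat \<Rightarrow> 'a) module" where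
  "series_module M =
     \<lparr>carrier = {f. \<forall>n. f n \<in> carrier M}, mult = undefined, one = undefined,
      zero = (\<lambda>n. \<zero>\<^bsub>M\<^esub>), add = (\<lambda>f f' n. f n \<oplus>\<^bsub>M\<^esub> f' n), smult = (\<lambda>c f n. c \<odot>\<^bsub>M\<^esub> f n)\<rparr>"

definition series_map :: "(int \<Rightarrow> 'a \<Rightarrow> 'b) \<Rightarrow> int \<Rightarrow> (nat \<Rightarrow> 'a) \<Rightarrow> nat \<Rightarrow> 'b" where
  "series_map \<phi> i f = (\<lambda>n. \<phi> i (f n))"

definition series_dgla :: "('r, 'a) dgla \<Rightarrow> ('r, nat \<Rightarrow> 'a) dgla" where
  "series_dgla h =
     \<lparr>component = (\<lambda>i. series_module (component h i)),
      bracket = (\<lambda>i j f f' n. \<Oplus>\<^bsub>component h (i + j)\<^esub>p\<in>{..n}. bracket h i j (f p) (f' (n - p))),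
      differential = series_map (differential h)\<rparr>"

definition series_cois_dgla ::
  "('r, 'a, 'b) cois_dgla \<Rightarrow> ('r, nat \<Rightarrow> 'a, nat \<Rightarrow> 'b) cois_dgla" where
  "series_cois_dgla g =
     \<lparr>dgla_tot = series_dgla (dgla_tot g), dgla_N = series_dgla (dgla_N g),
      dgla_iota = series_map (dgla_iota g), dgla_0 = (\<lambda>i. {f. \<forall>n. f n \<in> dgla_0 g i})\<rparr>"

text \<open>The sub-objects \<open>\<lambda>h[[\<lambda>]]\<close> and \<open>\<lambda>g[[\<lambda>]]\<close> of series without constant term.\<close>

definition lambda_dgla :: "('r, 'a) dgla \<Rightarrow> ('r, nat \<Rightarrow> 'a) dgla" where
  "lambda_dgla h =
     (series_dgla h)\<lparr>component := (\<lambda>i. (component (series_dgla h) i)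
        \<lparr>carrier := {f \<in> carrier (component (series_dgla h) i). f 0 = \<zero>\<^bsub>component h i\<^esub>}\<rparr>)\<rparr>"

definition lambda_cois_dgla ::
  "('r, 'a, 'b) cois_dgla \<Rightarrow> ('r, nat \<Rightarrow> 'a, nat \<Rightarrow> 'b) cois_dgla" where
  "lambda_cois_dgla g =
     (series_cois_dgla g)\<lparr>dgla_tot := lambda_dgla (dgla_tot g), dgla_N := lambda_dgla (dgla_N g),
        dgla_0 := (\<lambda>i. {f \<in> dgla_0 (series_cois_dgla g) i. f 0 = \<zero>\<^bsub>component (dgla_N g) i\<^esub>})\<rparr>"

text \<open>
  \<open>\<lambda>\<close>-adic sum of a family of series over \<open>M\<close> in which, for each \<open>n\<close>, only finitely many members
  have a non-zero coefficient of \<open>\<lambda>\<^sup>n\<close>. Only such families occur below, since series in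
  \<open>\<lambda>h[[\<lambda>]]\<close> start in order one.
\<close>

definition series_sum :: "('r, 'a) module \<Rightarrow> 'i set \<Rightarrow> ('i \<Rightarrow> nat \<Rightarrow> 'a) \<Rightarrow> nat \<Rightarrow> 'a" where
  "series_sum M I a = (\<lambda>n. \<Oplus>\<^bsub>M\<^esub>i\<in>{i \<in> I. a i n \<noteq> \<zero>\<^bsub>M\<^esub>}. a i n)"


section \<open>Maurer-Cartan elements\<close>

text \<open>
  From here on the parameter \<open>\<rho>\<close> is the inclusion of the rationals into the ground ring; it
  turns rational coefficients into scalars.
\<close>

definition maurer_cartan :: "(rat \<Rightarrow> 'r) \<Rightarrow> ('r, 'a) dgla \<Rightarrow> 'a set" where
  "maurer_cartan \<rho> h =
     {\<xi> \<in> carrier (component h 1).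
        differential h 1 \<xi> \<oplus>\<^bsub>component h 2\<^esub> (\<rho> (1/2) \<odot>\<^bsub>component h 2\<^esub> bracket h 1 1 \<xi> \<xi>)
        = \<zero>\<^bsub>component h 2\<^esub>}"

definition MC :: "(rat \<Rightarrow> 'r) \<Rightarrow>
  (('r, 'a) dgla, int \<Rightarrow> 'a \<Rightarrow> 'a, 'a set, 'a \<Rightarrow> 'a) functor_data" where
  "MC \<rho> = \<lparr>ob = maurer_cartan \<rho>, mor = (\<lambda>h h' \<phi>. \<phi> 1)\<rparr>"

definition cois_maurer_cartan ::
  "(rat \<Rightarrow> 'r) \<Rightarrow> ('r, 'a, 'b) cois_dgla \<Rightarrow> ('a, 'b) cois_set" where
  "cois_maurer_cartan \<rho> g =
     \<lparr>set_tot = maurer_cartan \<rho> (dgla_tot g), set_N = maurer_cartan \<rho> (dgla_N g),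
      set_iota = dgla_iota g 1,
      set_rel = {(\<xi>\<^sub>1, \<xi>\<^sub>2). \<xi>\<^sub>1 \<in> maurer_cartan \<rho> (dgla_N g) \<and> \<xi>\<^sub>2 \<in> maurer_cartan \<rho> (dgla_N g) \<and>
                   \<xi>\<^sub>1 \<ominus>\<^bsub>component (dgla_N g) 1\<^esub> \<xi>\<^sub>2 \<in> dgla_0 g 1}\<rparr>"

definition cois_MC :: "(rat \<Rightarrow> 'r) \<Rightarrow>
  (('r, 'a, 'b) cois_dgla, ('a, 'b) cois_dgla_map, ('a, 'b) cois_set, ('a \<Rightarrow> 'a) \<times> ('b \<Rightarrow> 'b))
  functor_data" where
  "cois_MC \<rho> = \<lparr>ob = cois_maurer_cartan \<rho>, mor = (\<lambda>g h \<Phi>. (fst \<Phi> 1, snd \<Phi> 1))\<rparr>"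


section \<open>Gauge group\<close>

text \<open>
  The Baker-Campbell-Hausdorff series in Dynkin's form: the sum over all \<open>n \<ge> 1\<close> and all
  \<open>(r\<^sub>1, s\<^sub>1), \<dots>, (r\<^sub>n, s\<^sub>n)\<close> with \<open>r\<^sub>i + s\<^sub>i > 0\<close> of the right-nested brackets
  \<open>[X\<^sup>r\<^sup>1 Y\<^sup>s\<^sup>1 \<dots> X\<^sup>r\<^sup>n Y\<^sup>s\<^sup>n] = [X, [X, \<dots> [Y, \<dots>]]]\<close> with coefficient
  \<open>(-1)\<^sup>n\<^sup>-\<^sup>1 / (n \<cdot> \<Sum>\<^sub>i (r\<^sub>i + s\<^sub>i) \<cdot> \<Prod>\<^sub>i r\<^sub>i! s\<^sub>i!)\<close>.
\<close>

definition bch_index :: "(nat \<times> nat) list set" where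
  "bch_index = {p. p \<noteq> [] \<and> (\<forall>(r, s)\<in>set p. r + s > 0)}"

definition bch_coeff :: "(nat \<times> nat) list \<Rightarrow> rat" where
  "bch_coeff p = (-1) ^ (length p - 1) /
     (of_nat (length p) * of_nat (\<Sum>(r, s)\<leftarrow>p. r + s) * of_nat (\<Prod>(r, s)\<leftarrow>p. fact r * fact s))"

definition bch_word :: "(nat \<times> nat) list \<Rightarrow> 'a \<Rightarrow> 'a \<Rightarrow> 'a list" where
  "bch_word p X Y = concat (map (\<lambda>(r, s). replicate r X @ replicate s Y) p)"

definition nested_bracket :: "('a \<Rightarrow> 'a \<Rightarrow> 'a) \<Rightarrow> 'a list \<Rightarrow> 'a" where
  "nested_bracket b w = foldr b (butlast w) (last w)"

definition bch :: "(rat \<Rightarrow> 'r) \<Rightarrow> ('r, 'a) dgla \<Rightarrow> (nat \<Rightarrow> 'a) \<Rightarrow> (nat \<Rightarrow> 'a) \<Rightarrow> nat \<Rightarrow> 'a" where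
  "bch \<rho> h X Y = series_sum (component h 0) bch_index
     (\<lambda>p. \<rho> (bch_coeff p) \<odot>\<^bsub>component (lambda_dgla h) 0\<^esub>
            nested_bracket (bracket (lambda_dgla h) 0 0) (bch_word p X Y))"

definition gauge_group :: "(rat \<Rightarrow> 'r) \<Rightarrow> ('r, 'a) dgla \<Rightarrow> (nat \<Rightarrow> 'a) monoid" where
  "gauge_group \<rho> h =
     \<lparr>carrier = carrier (component (lambda_dgla h) 0), mult = bch \<rho> h,
      one = \<zero>\<^bsub>component (lambda_dgla h) 0\<^esub>\<rparr>"

definition Gauge :: "(rat \<Rightarrow> 'r) \<Rightarrow>
  (('r, 'a) dgla, int \<Rightarrow> 'a \<Rightarrow> 'a, (nat \<Rightarrow> 'a) monoid, (nat \<Rightarrow> 'a) \<Rightarrow> (nat \<Rightarrow> 'a)) functor_data" where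
  "Gauge \<rho> = \<lparr>ob = gauge_group \<rho>, mor = (\<lambda>h h' \<phi>. series_map \<phi> 0)\<rparr>"

definition cois_gauge_group ::
  "(rat \<Rightarrow> 'r) \<Rightarrow> ('r, 'a, 'b) cois_dgla \<Rightarrow> (nat \<Rightarrow> 'a, nat \<Rightarrow> 'b) cois_group" where
  "cois_gauge_group \<rho> g =
     \<lparr>group_tot = gauge_group \<rho> (dgla_tot g), group_N = gauge_group \<rho> (dgla_N g),
      group_iota = series_map (dgla_iota g) 0, group_0 = dgla_0 (lambda_cois_dgla g) 0\<rparr>"

definition cois_Gauge :: "(rat \<Rightarrow> 'r) \<Rightarrow>
  (('r, 'a, 'b) cois_dgla, ('a, 'b) cois_dgla_map, (nat \<Rightarrow> 'a, nat \<Rightarrow> 'b) cois_group,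
   ((nat \<Rightarrow> 'a) \<Rightarrow> (nat \<Rightarrow> 'a)) \<times> ((nat \<Rightarrow> 'b) \<Rightarrow> (nat \<Rightarrow> 'b))) functor_data" where
  "cois_Gauge \<rho> = \<lparr>ob = cois_gauge_group \<rho>,
     mor = (\<lambda>g h \<Phi>. (series_map (fst \<Phi>) 0, series_map (snd \<Phi>) 0))\<rparr>"


section \<open>Deformation functor\<close>

text \<open>
  \<open>\<gamma> \<in> \<lambda>h\<^sup>0[[\<lambda>]]\<close> is the whole group element, written \<open>\<lambda>g\<close> in
  \<open>\<lambda>g \<triangleright> \<xi> = exp(\<lambda> ad(g))(\<xi>) - \<lambda> \<Sum>\<^sub>j (\<lambda> ad(g))\<^sup>j/(1+j)! (dg)\<close>; the two factors \<open>\<lambda>\<close> are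
  absorbed into \<open>ad \<gamma>\<close> and \<open>d\<gamma>\<close>.
\<close>

definition gauge_action ::
  "(rat \<Rightarrow> 'r) \<Rightarrow> ('r, 'a) dgla \<Rightarrow> (nat \<Rightarrow> 'a) \<Rightarrow> (nat \<Rightarrow> 'a) \<Rightarrow> nat \<Rightarrow> 'a" where
  "gauge_action \<rho> h \<gamma> \<xi> =
     (let L = lambda_dgla h; M = component L 1; ad = bracket L 0 1 \<gamma> in
        series_sum (component h 1) UNIV (\<lambda>j. \<rho> (1 / fact j) \<odot>\<^bsub>M\<^esub> (ad ^^ j) \<xi>)
        \<ominus>\<^bsub>M\<^esub>
        series_sum (component h 1) UNIV
          (\<lambda>j. \<rho> (1 / fact (1 + j)) \<odot>\<^bsub>M\<^esub> (ad ^^ j) (differential L 0 \<gamma>)))"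

definition deformations :: "(rat \<Rightarrow> 'r) \<Rightarrow> ('r, 'a) dgla \<Rightarrow> (nat \<Rightarrow> 'a) set set" where
  "deformations \<rho> h =
     orbits (gauge_group \<rho> h) (maurer_cartan \<rho> (lambda_dgla h)) (gauge_action \<rho> h)"

definition deformation_map ::
  "(rat \<Rightarrow> 'r) \<Rightarrow> ('r, 'b) dgla \<Rightarrow> (int \<Rightarrow> 'a \<Rightarrow> 'b) \<Rightarrow> (nat \<Rightarrow> 'a) set \<Rightarrow> (nat \<Rightarrow> 'b) set" where
  "deformation_map \<rho> h' \<phi> X =
     (\<Union>\<xi>\<in>X. orbit (gauge_group \<rho> h') (gauge_action \<rho> h') (series_map \<phi> 1 \<xi>))"

definition Def :: "(rat \<Rightarrow> 'r) \<Rightarrow>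
  (('r, 'a) dgla, int \<Rightarrow> 'a \<Rightarrow> 'a, (nat \<Rightarrow> 'a) set set, (nat \<Rightarrow> 'a) set \<Rightarrow> (nat \<Rightarrow> 'a) set)
  functor_data" where
  "Def \<rho> = \<lparr>ob = deformations \<rho>, mor = (\<lambda>h. deformation_map \<rho>)\<rparr>"

text \<open>
  In the relation on \<open>Def(g)\<^sub>N\<close>, the condition \<open>\<xi>\<^sub>1 \<sim> \<xi>\<^sub>2\<close> is required of some representatives of
  the two gauge classes.
\<close>

definition cois_deformations ::
  "(rat \<Rightarrow> 'r) \<Rightarrow> ('r, 'a, 'b) cois_dgla \<Rightarrow> ((nat \<Rightarrow> 'a) set, (nat \<Rightarrow> 'b) set) cois_set" where
  "cois_deformations \<rho> g =
     \<lparr>set_tot = deformations \<rho> (dgla_tot g), set_N = deformations \<rho> (dgla_N g),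
      set_iota = deformation_map \<rho> (dgla_tot g) (dgla_iota g),
      set_rel = {(X\<^sub>1, X\<^sub>2). X\<^sub>1 \<in> deformations \<rho> (dgla_N g) \<and> X\<^sub>2 \<in> deformations \<rho> (dgla_N g) \<and>
                   (\<exists>\<xi>\<^sub>1\<in>X\<^sub>1. \<exists>\<xi>\<^sub>2\<in>X\<^sub>2.
                      (\<xi>\<^sub>1, \<xi>\<^sub>2) \<in> set_rel (cois_maurer_cartan \<rho> (lambda_cois_dgla g)))}\<rparr>"

definition cois_Def :: "(rat \<Rightarrow> 'r) \<Rightarrow>
  (('r, 'a, 'b) cois_dgla, ('a, 'b) cois_dgla_map, ((nat \<Rightarrow> 'a) set, (nat \<Rightarrow> 'b) set) cois_set,
   ((nat \<Rightarrow> 'a) set \<Rightarrow> (nat \<Rightarrow> 'a) set) \<times> ((nat \<Rightarrow> 'b) set \<Rightarrow> (nat \<Rightarrow> 'b) set)) functor_data" where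
  "cois_Def \<rho> = \<lparr>ob = cois_deformations \<rho>,
     mor = (\<lambda>g h \<Phi>. (deformation_map \<rho> (dgla_tot h) (fst \<Phi>),
                     deformation_map \<rho> (dgla_N h) (snd \<Phi>)))\<rparr>"

end

theory Submission
  imports Defs "HOL-Computational_Algebra.Formal_Power_Series" "HOL-Library.Product_Plus"
    "HOL-Library.Poly_Mapping"
begin

text \<open>
  Reduction is implemented by the projection \<open>\<pi> : g\<^sub>N \<rightarrow> g\<^sub>r\<^sub>e\<^sub>d\<close>, a natural morphism of differential
  graded Lie algebras, and the three transformations are induced by \<open>\<pi>\<close>. The equivalence relations on
  Maurer-Cartan elements and on deformation classes are its fibres and the normal subgroup of the gauge
  group is its kernel, because gauge elements can be lifted along \<open>\<pi>\<close>.

  What needs work is that the Dynkin series defines a group that acts on Maurer-Cartan elements. In an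
  associative algebra, \<open>Z = log (e\<^sup>t\<^sup>x e\<^sup>t\<^sup>y)\<close> satisfies a differential equation in \<open>t\<close> whose solution is
  the Dynkin series. Hence \<open>exp (BCH X Y) = exp X \<circ> exp Y\<close> in every representation of a Lie algebra.
  A derivation \<open>\<delta>\<close> turns the adjoint action into an affine one: for the differential this is the gauge
  action, and for the Euler derivation in \<open>\<lambda>\<close> it is faithful, which yields the group laws. Since the
  ground ring contains the rationals, each homogeneous component embeds into a rational vector space
  whose carrier is a whole type, where these computations are done.
\<close>

text \<open>The obstacle is that the group laws cannot be read off Dynkin's formula and that the
  adjoint representation kills the centre. The remedy is to adjoin a derivation \<delta> as a new
  vector with [z, \<delta>] = -\<delta> z, so that a pair (v, c) stands for v + c \<delta>. If
  \<delta> multiplies the coefficient of \<lambda>^n by n, then z is recovered from its action on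
  (0, 1), because n > 0 is invertible. As such a \<delta> depends on the position of a coefficient,
  bilinear operations on series may vary with the degrees of their arguments. All convergence
  questions reduce to one condition: operators raise the order of series, so each coefficient is a
  finite sum. Two formal variables occur: t counts the letters of a word, while \<lambda> is the
  variable of the given series. Putting t = 1 is legitimate because a word of m letters has order at
  least m in \<lambda>. A single fact about exponentials of derivations, \<open>Exp_leibniz\<close>,
  yields conjugation by e^z, the derivative of e^z and the invariance of the Maurer-Cartan
  equation.\<close>

unbundle fps_syntax

section \<open>Rational vector spaces and algebras\<close>

text \<open>As a type class it passes to products, series and finitely supported functions by
  instance declarations, without any carriers to keep track of. Scalars are rational since that is
  all the ground ring guarantees.\<close>

class rat_vector = ab_group_add +
  fixes scaleQ :: "rat \<Rightarrow> 'a \<Rightarrow> 'a" (infixr \<open>*\<^sub>Q\<close> 74)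
  assumes scaleQ_add_right: "c *\<^sub>Q (x + y) = c *\<^sub>Q x + c *\<^sub>Q y"
    and scaleQ_add_left: "(c + c') *\<^sub>Q x = c *\<^sub>Q x + c' *\<^sub>Q x"
    and scaleQ_scaleQ: "c *\<^sub>Q c' *\<^sub>Q x = (c * c') *\<^sub>Q x"
    and scaleQ_one [simp]: "1 *\<^sub>Q x = x"

text \<open>The class \<open>ring_1\<close> demands \<open>0 \<noteq> 1\<close>, which fails for the
  endomorphisms of the zero space. A product with second factor \<open>rat\<close> is never trivial,
  and the affine operators below act on such products.\<close>

class nontrivial_rat_vector = rat_vector +
  assumes ex_nonzero: "\<exists>x. x \<noteq> 0"

global_interpretation ratv: vector_space "scaleQ :: rat \<Rightarrow> 'a \<Rightarrow> 'a :: rat_vector"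
  by unfold_locales (simp_all add: scaleQ_add_right scaleQ_add_left scaleQ_scaleQ)

global_interpretation ratvp: vector_space_pair "scaleQ :: rat \<Rightarrow> 'a \<Rightarrow> 'a :: rat_vector"
  "scaleQ :: rat \<Rightarrow> 'b \<Rightarrow> 'b :: rat_vector" ..

declare ratv.scale_scale [simp del]

abbreviation linQ :: "('a::rat_vector \<Rightarrow> 'b::rat_vector) \<Rightarrow> bool" where
  "linQ \<equiv> Vector_Spaces.linear scaleQ scaleQ"

lemma linQI:
  assumes "\<And>x y. f (x + y) = f x + f y" "\<And>c x. f (c *\<^sub>Q x) = c *\<^sub>Q f x"
  shows "linQ f"
  using assms by unfold_locales

lemma linQ_add: "linQ f \<Longrightarrow> f (x + y) = f x + f y"
  and linQ_scale: "linQ f \<Longrightarrow> f (c *\<^sub>Q x) = c *\<^sub>Q f x"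
  and linQ_0: "linQ f \<Longrightarrow> f 0 = 0"
  and linQ_diff: "linQ f \<Longrightarrow> f (x - y) = f x - f y"
  and linQ_neg: "linQ f \<Longrightarrow> f (- x) = - f x"
  and linQ_sum: "linQ f \<Longrightarrow> f (sum h A) = (\<Sum>i\<in>A. f (h i))"
  by (auto simp: ratvp.linear_add ratvp.linear_scale ratvp.linear_0 ratvp.linear_diff ratvp.linear_neg
      ratvp.linear_sum)

definition bilQ :: "('a::rat_vector \<Rightarrow> 'b::rat_vector \<Rightarrow> 'c::rat_vector) \<Rightarrow> bool" where
  "bilQ b \<longleftrightarrow> (\<forall>x. linQ (b x)) \<and> (\<forall>y. linQ (\<lambda>x. b x y))"

lemma bilQD: assumes "bilQ b" shows "linQ (b x)" "linQ (\<lambda>x. b x y)"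
  using assms by (auto simp: bilQ_def)

lemma bilQI:
  assumes "\<And>x y z. b (x + y) z = b x z + b y z" "\<And>x y z. b x (y + z) = b x y + b x z"
    "\<And>c x y. b (c *\<^sub>Q x) y = c *\<^sub>Q b x y" "\<And>c x y. b x (c *\<^sub>Q y) = c *\<^sub>Q b x y"
  shows "bilQ b"
  unfolding bilQ_def by (auto intro!: linQI simp: assms)

lemma bilQ_simps:
  assumes "bilQ b"
  shows "b (x + x') y = b x y + b x' y" "b x (y + y') = b x y + b x y'"
    "b (c *\<^sub>Q x) y = c *\<^sub>Q b x y" "b x (c *\<^sub>Q y) = c *\<^sub>Q b x y" "b 0 y = 0" "b x 0 = 0"
    "b (x - x') y = b x y - b x' y" "b x (y - y') = b x y - b x y'" "b (- x) y = - b x y" "b x (- y) = - b x y"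
  using bilQD(1)[OF assms] linQ_add[OF bilQD(2)[OF assms]] linQ_scale[OF bilQD(2)[OF assms]]
    linQ_0[OF bilQD(2)[OF assms]] linQ_diff[OF bilQD(2)[OF assms]] linQ_neg[OF bilQD(2)[OF assms]]
  by (auto simp: linQ_add linQ_scale linQ_0 linQ_diff linQ_neg)

lemma bilQ_sum:
  assumes "bilQ b"
  shows "b (sum f A) y = (\<Sum>i\<in>A. b (f i) y)" "b x (sum h A) = (\<Sum>i\<in>A. b x (h i))"
  using linQ_sum[OF bilQD(2)[OF assms]] linQ_sum[OF bilQD(1)[OF assms]] by auto

instantiation rat :: rat_vector
begin
definition scaleQ_rat :: "rat \<Rightarrow> rat \<Rightarrow> rat" where "scaleQ_rat c x = c * x"
instance by standard (simp_all add: scaleQ_rat_def algebra_simps)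
end

instance rat :: nontrivial_rat_vector
  by standard (auto intro: exI[of _ 1])

instantiation prod :: (rat_vector, rat_vector) rat_vector
begin
definition scaleQ_prod :: "rat \<Rightarrow> 'a \<times> 'b \<Rightarrow> 'a \<times> 'b" where
  "scaleQ_prod c x = (c *\<^sub>Q fst x, c *\<^sub>Q snd x)"
instance by standard (simp_all add: scaleQ_prod_def prod_eq_iff scaleQ_add_right scaleQ_add_left scaleQ_scaleQ)
end

instance prod :: (rat_vector, nontrivial_rat_vector) nontrivial_rat_vector
proof
  obtain x :: 'b where "x \<noteq> 0" using ex_nonzero by blast
  then show "\<exists>x :: 'a \<times> 'b. x \<noteq> 0" by (intro exI[of _ "(0, x)"]) (simp add: prod_eq_iff)
qed

lemma fst_scaleQ [simp]: "fst (c *\<^sub>Q x) = c *\<^sub>Q fst x" and snd_scaleQ [simp]: "snd (c *\<^sub>Q x) = c *\<^sub>Q snd x"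
  by (simp_all add: scaleQ_prod_def)

instantiation fps :: (rat_vector) rat_vector
begin
definition scaleQ_fps :: "rat \<Rightarrow> 'a fps \<Rightarrow> 'a fps" where
  "scaleQ_fps c f = Abs_fps (\<lambda>n. c *\<^sub>Q f $ n)"
instance by standard
    (simp_all add: scaleQ_fps_def fps_eq_iff scaleQ_add_right scaleQ_add_left scaleQ_scaleQ)
end

instance fps :: (nontrivial_rat_vector) nontrivial_rat_vector
proof
  obtain x :: 'a where "x \<noteq> 0" using ex_nonzero by blast
  then show "\<exists>x :: 'a fps. x \<noteq> 0" by (intro exI[of _ "Abs_fps (\<lambda>n. x)"]) (simp add: fps_eq_iff)
qed

lemma fps_nth_scaleQ [simp]: "(c *\<^sub>Q f) $ n = c *\<^sub>Q (f $ n)"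
  by (simp add: scaleQ_fps_def)

text \<open>With values in \<open>rat\<close> this is the free rational vector space on a type; it
  will receive the embedded modules.\<close>

instantiation poly_mapping :: (type, rat_vector) rat_vector
begin
definition scaleQ_poly_mapping :: "rat \<Rightarrow> ('a \<Rightarrow>\<^sub>0 'b) \<Rightarrow> 'a \<Rightarrow>\<^sub>0 'b" where
  "scaleQ_poly_mapping c f = Poly_Mapping.map (scaleQ c) f"
instance
proof
  have *: "poly_mapping.lookup (c *\<^sub>Q f) i = c *\<^sub>Q poly_mapping.lookup f i" for c and f :: "'a \<Rightarrow>\<^sub>0 'b" and i
    unfolding scaleQ_poly_mapping_def by transfer (simp add: when_def)
  show "c *\<^sub>Q (x + y) = c *\<^sub>Q x + c *\<^sub>Q y" "(c + c') *\<^sub>Q x = c *\<^sub>Q x + c' *\<^sub>Q x"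
    "c *\<^sub>Q c' *\<^sub>Q x = (c * c') *\<^sub>Q x" "1 *\<^sub>Q x = x" for c c' :: rat and x y :: "'a \<Rightarrow>\<^sub>0 'b"
    by (intro poly_mapping_eqI,
        simp add: * lookup_add scaleQ_add_right scaleQ_add_left scaleQ_scaleQ)+
qed
end

lemma lookup_scaleQ [simp]: "poly_mapping.lookup (c *\<^sub>Q f) i = c *\<^sub>Q poly_mapping.lookup f i"
  unfolding scaleQ_poly_mapping_def by transfer (simp add: when_def)

class rat_algebra_1 = ring_1 + rat_vector +
  assumes scaleQ_mult_left: "(c *\<^sub>Q x) * y = c *\<^sub>Q (x * y)"
    and scaleQ_mult_right: "x * (c *\<^sub>Q y) = c *\<^sub>Q (x * y)"

instance fps :: (rat_algebra_1) rat_algebra_1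
  by standard (simp_all add: fps_eq_iff fps_mult_nth ratv.scale_sum_right scaleQ_mult_left scaleQ_mult_right)

lemma bilQ_times: "bilQ ((*) :: 'a \<Rightarrow> 'a \<Rightarrow> 'a::rat_algebra_1)"
  by (rule bilQI) (simp_all add: algebra_simps scaleQ_mult_left scaleQ_mult_right)

section \<open>Endomorphisms of a rational vector space as an associative algebra\<close>

typedef (overloaded) 'v endo = "{f :: 'v::rat_vector \<Rightarrow> 'v. linQ f}"
  morphisms app Endo
  by (intro exI[of _ "\<lambda>x. 0"]) (auto intro!: linQI)

lemma linQ_app: "linQ (app x)"
  using app by auto

lemma endo_eqI: "(\<And>v. app x v = app y v) \<Longrightarrow> x = y"
  by (simp add: app_inject[symmetric] fun_eq_iff)

lemma app_Endo: "linQ f \<Longrightarrow> app (Endo f) = f"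
  by (simp add: Endo_inverse)

lemmas app_simps = linQ_add[OF linQ_app] linQ_scale[OF linQ_app] linQ_0[OF linQ_app] linQ_diff[OF linQ_app]

instantiation endo :: (nontrivial_rat_vector) ring_1
begin
definition "0 = Endo (\<lambda>v. 0)"
definition "1 = Endo (\<lambda>v. v)"
definition "x + y = Endo (\<lambda>v. app x v + app y v)"
definition "x - y = Endo (\<lambda>v. app x v - app y v)"
definition "- x = Endo (\<lambda>v. - app x v)"
definition "x * y = Endo (\<lambda>v. app x (app y v))"

lemma app_ring_op:
  "app 0 v = 0" "app 1 v = v" "app (x + y) v = app x v + app y v"
  "app (x - y) v = app x v - app y v" "app (- x) v = - app x v" "app (x * y) v = app x (app y v)"
  unfolding zero_endo_def one_endo_def plus_endo_def minus_endo_def uminus_endo_def times_endo_def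
  by (subst app_Endo; auto intro!: linQI simp: app_simps scaleQ_add_right ratv.scale_right_diff_distrib)+

instance
proof
  fix a b c :: "'a endo"
  show "a + b + c = a + (b + c)" "a + b = b + a" "0 + a = a" "- a + a = 0" "a - b = a + - b"
    "a * b * c = a * (b * c)" "1 * a = a" "a * 1 = a" "(a + b) * c = a * c + b * c"
    "a * (b + c) = a * b + a * c"
    by (rule endo_eqI; simp add: app_ring_op app_simps)+
  obtain v :: 'a where "v \<noteq> 0" using ex_nonzero by blast
  then have "app 0 v \<noteq> app 1 v" by (simp add: app_ring_op)
  then show "(0 :: 'a endo) \<noteq> 1" by metis
qed
end

instantiation endo :: (nontrivial_rat_vector) rat_algebra_1
begin
definition "c *\<^sub>Q x = Endo (\<lambda>v. c *\<^sub>Q app x v)"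

lemma app_scaleQ: "app (c *\<^sub>Q x) v = c *\<^sub>Q app x v"
  unfolding scaleQ_endo_def
  by (subst app_Endo) (auto intro!: linQI simp: app_simps scaleQ_add_right scaleQ_scaleQ mult.commute)

instance
  by standard (auto intro!: endo_eqI
      simp: app_scaleQ app_ring_op app_simps scaleQ_add_right scaleQ_add_left scaleQ_scaleQ)
end

lemmas app_op = app_ring_op app_scaleQ

lemma app_sum: "app (sum h A) v = (\<Sum>i\<in>A. app (h i) v)"
  by (induction A rule: infinite_finite_induct) (simp_all add: app_op)

section \<open>Functional calculus for operators that raise the order\<close>

text \<open>The coefficient of order n of \<open>S f\<close> depends only on the coefficients of
  \<open>f\<close> up to order n. Linear maps of this kind may be applied to an order-convergent sum
  term by term.\<close>

definition causal :: "('a::rat_vector fps \<Rightarrow> 'b::rat_vector fps) \<Rightarrow> bool" where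
  "causal S \<longleftrightarrow> linQ S \<and> (\<forall>f n. (\<forall>m\<le>n. f $ m = 0) \<longrightarrow> S f $ n = 0)"

definition raising :: "('a::rat_vector fps \<Rightarrow> 'b::rat_vector fps) \<Rightarrow> bool" where
  "raising T \<longleftrightarrow> linQ T \<and> (\<forall>f n. (\<forall>m<n. f $ m = 0) \<longrightarrow> T f $ n = 0)"

text \<open>The value a(T) of a scalar power series at an operator. For raising \<open>T\<close> the
  cut at j = n is exact: the terms with j > n have no coefficient of order n.\<close>

definition opsum :: "rat fps \<Rightarrow> ('a::rat_vector fps \<Rightarrow> 'a fps) \<Rightarrow> 'a fps \<Rightarrow> 'a fps" where
  "opsum a T f = Abs_fps (\<lambda>n. \<Sum>j\<le>n. a $ j *\<^sub>Q (T ^^ j) f $ n)"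

abbreviation Exp :: "('a::rat_vector fps \<Rightarrow> 'a fps) \<Rightarrow> 'a fps \<Rightarrow> 'a fps" where
  "Exp \<equiv> opsum (fps_exp 1)"

lemma causal_linQ: "causal S \<Longrightarrow> linQ S" and raising_linQ: "raising T \<Longrightarrow> linQ T"
  by (simp_all add: causal_def raising_def)

lemma raising_causal: "raising T \<Longrightarrow> causal T"
  by (auto simp: causal_def raising_def)

lemma causalD: "causal S \<Longrightarrow> (\<And>m. m \<le> n \<Longrightarrow> f $ m = 0) \<Longrightarrow> S f $ n = 0"
  by (auto simp: causal_def)

lemma causal_cong:
  assumes "causal S" "\<And>m. m \<le> n \<Longrightarrow> f $ m = g $ m"
  shows "S f $ n = S g $ n"
  using causalD[OF assms(1), of n "f - g"] linQ_diff[OF causal_linQ[OF assms(1)], of f g] assms(2)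
  by simp

lemma linQ_funpow: "linQ T \<Longrightarrow> linQ (T ^^ j)" for T :: "'a::rat_vector \<Rightarrow> 'a"
  by (induction j) (auto intro!: linQI simp: linQ_add linQ_scale)

lemma causal_funpow: "causal T \<Longrightarrow> causal (T ^^ j)" for T :: "'a::rat_vector fps \<Rightarrow> 'a fps"
proof (induction j)
  case (Suc j)
  then have IH: "causal (T ^^ j)" by simp
  show ?case
    unfolding causal_def
  proof (intro conjI allI impI)
    show "linQ (T ^^ Suc j)" using Suc causal_linQ linQ_funpow by blast
    fix f :: "'a fps" and n assume "\<forall>m\<le>n. f $ m = 0"
    then show "(T ^^ Suc j) f $ n = 0" using IH Suc(2) by (auto intro!: causalD[of T] causalD[of "T ^^ j"])
  qed
qed (auto simp: causal_def intro!: linQI)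

lemma raising_funpow_nth:
  fixes T :: "'a::rat_vector fps \<Rightarrow> 'a fps"
  assumes "raising T" "\<And>m. m < n \<Longrightarrow> f $ m = 0" "m < n + j"
  shows "(T ^^ j) f $ m = 0"
  using assms(3)
proof (induction j arbitrary: m)
  case (Suc j)
  then show ?case using assms(1) unfolding raising_def by auto
qed (use assms in auto)

lemma raising_funpow_0: "raising T \<Longrightarrow> m < j \<Longrightarrow> (T ^^ j) f $ m = 0"
  for T :: "'a::rat_vector fps \<Rightarrow> 'a fps"
  using raising_funpow_nth[of T 0 f m j] by simp

text \<open>Any larger cut-off gives the same coefficient, so one bound can serve all inner sums
  when sums are interchanged.\<close>

lemma opsum_nth:
  assumes "raising T" "n \<le> N"
  shows "opsum a T f $ n = (\<Sum>j\<le>N. a $ j *\<^sub>Q (T ^^ j) f $ n)"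
  unfolding opsum_def fps_nth_Abs_fps using assms
  by (intro sum.mono_neutral_left) (auto simp: raising_funpow_0)

lemma opsum_eq_sum_upto:
  assumes "raising T" "n \<le> N"
  shows "opsum a T f $ n = (\<Sum>j\<le>N. a $ j *\<^sub>Q (T ^^ j) f) $ n"
  using opsum_nth[OF assms] by (simp add: fps_sum_nth)

lemma causal_opsum_nth:
  assumes "causal S" "raising T" "n \<le> N"
  shows "S (opsum a T f) $ n = (\<Sum>j\<le>N. a $ j *\<^sub>Q S ((T ^^ j) f) $ n)"
proof -
  have "S (opsum a T f) $ n = S (\<Sum>j\<le>N. a $ j *\<^sub>Q (T ^^ j) f) $ n"
    by (rule causal_cong[OF assms(1)], rule opsum_eq_sum_upto[OF assms(2)]) (use assms(3) in simp)
  then show ?thesis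
    unfolding linQ_sum[OF causal_linQ[OF assms(1)]] linQ_scale[OF causal_linQ[OF assms(1)]]
    by (simp add: fps_sum_nth)
qed

lemma causal_opsum:
  assumes "raising T" shows "causal (opsum a T)"
  unfolding causal_def
proof (intro conjI allI impI linQI)
  note lin = linQ_funpow[OF raising_linQ[OF assms]]
  show "opsum a T (f + g) = opsum a T f + opsum a T g" for f g
    by (simp add: opsum_def fps_eq_iff linQ_add[OF lin] scaleQ_add_right sum.distrib)
  show "opsum a T (c *\<^sub>Q f) = c *\<^sub>Q opsum a T f" for c f
    by (simp add: opsum_def fps_eq_iff linQ_scale[OF lin] scaleQ_scaleQ ratv.scale_sum_right mult.commute)
  show "opsum a T f $ n = 0" if "\<forall>m\<le>n. f $ m = 0" for f n
    using that raising_funpow_nth[OF assms, of "Suc n" f n] by (simp add: opsum_def)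
qed

lemma sum_triangle:
  fixes g :: "nat \<Rightarrow> nat \<Rightarrow> 'a::comm_monoid_add"
  assumes "\<And>i j. i + j > N \<Longrightarrow> g i j = 0"
  shows "(\<Sum>n\<le>N. \<Sum>k\<le>n. g k (n - k)) = (\<Sum>i\<le>N. \<Sum>j\<le>N. g i j)"
proof -
  have "(\<Sum>n\<le>N. \<Sum>k\<le>n. g k (n - k)) = (\<Sum>(i, j)\<in>{(i, j). i + j \<le> N}. g i j)"
    by (rule sum.triangle_reindex_eq[symmetric])
  also have "\<dots> = (\<Sum>(i, j)\<in>{..N} \<times> {..N}. g i j)"
    by (intro sum.mono_neutral_left) (use assms in \<open>force simp: not_le\<close>)+
  finally show ?thesis by (simp add: sum.cartesian_product)
qed

lemma sum_triangle_swap: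
  fixes g :: "nat \<Rightarrow> nat \<Rightarrow> 'a::comm_monoid_add"
  shows "(\<Sum>p\<le>n. \<Sum>q\<le>n - p. g p q) = (\<Sum>q\<le>n. \<Sum>p\<le>n - q. g p q)"
  by (simp add: sum.Sigma, rule sum.reindex_bij_witness[of _ prod.swap prod.swap]) auto

text \<open>On the square of pairs (i, j) the terms with i + j > n vanish because T^(i+j) raises the
  order by i + j; the remaining triangle is the Cauchy product of the coefficients.\<close>

lemma opsum_mult:
  assumes "raising T"
  shows "opsum (a * b) T f = opsum a T (opsum b T f)"
proof (rule fps_ext)
  fix n
  have "opsum a T (opsum b T f) $ n = (\<Sum>i\<le>n. a $ i *\<^sub>Q (\<Sum>j\<le>n. b $ j *\<^sub>Q (T ^^ i) ((T ^^ j) f) $ n))"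
    using assms
    by (simp add: opsum_def[of a] causal_opsum_nth[OF causal_funpow[OF raising_causal] _ order.refl])
  also have "\<dots> = (\<Sum>i\<le>n. \<Sum>j\<le>n. (a $ i * b $ j) *\<^sub>Q (T ^^ (i + j)) f $ n)"
    by (simp add: ratv.scale_sum_right scaleQ_scaleQ funpow_add)
  also have "\<dots> = (\<Sum>m\<le>n. \<Sum>k\<le>m. (a $ k * b $ (m - k)) *\<^sub>Q (T ^^ (k + (m - k))) f $ n)"
    using assms
    by (intro sum_triangle[symmetric, where g = "\<lambda>i j. (a $ i * b $ j) *\<^sub>Q (T ^^ (i + j)) f $ n"])
      (simp add: raising_funpow_0)
  also have "\<dots> = opsum (a * b) T f $ n"
    by (simp add: opsum_def fps_mult_nth atLeast0AtMost ratv.scale_sum_left)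
  finally show "opsum (a * b) T f $ n = opsum a T (opsum b T f) $ n" ..
qed

lemma opsum_add: "opsum (a + b) T f = opsum a T f + opsum b T f"
  and opsum_diff: "opsum (a - b) T f = opsum a T f - opsum b T f"
  by (simp_all add: opsum_def fps_eq_iff scaleQ_add_left ratv.scale_left_diff_distrib sum.distrib sum_subtractf)

lemma opsum_1 [simp]: "opsum 1 T f = f"
proof (rule fps_ext)
  fix n
  have "opsum 1 T f $ n = (\<Sum>j\<in>{0}. (1 :: rat fps) $ j *\<^sub>Q (T ^^ j) f $ n)"
    unfolding opsum_def fps_nth_Abs_fps by (intro sum.mono_neutral_right) auto
  then show "opsum 1 T f $ n = f $ n" by simp
qed

lemma opsum_X:
  assumes "raising T" shows "opsum fps_X T f = T f"
proof (rule fps_ext)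
  fix n
  have "opsum fps_X T f $ n = (\<Sum>j\<in>{1}. (fps_X :: rat fps) $ j *\<^sub>Q (T ^^ j) f $ n)"
    unfolding opsum_nth[OF assms le_SucI[OF order.refl]] by (intro sum.mono_neutral_right) auto
  then show "opsum fps_X T f $ n = T f $ n" by simp
qed

lemma opsum_const: "opsum (fps_const c) T f = c *\<^sub>Q f"
proof (rule fps_ext)
  fix n
  have "opsum (fps_const c) T f $ n = (\<Sum>j\<in>{0}. fps_const c $ j *\<^sub>Q (T ^^ j) f $ n)"
    unfolding opsum_def fps_nth_Abs_fps by (intro sum.mono_neutral_right) auto
  then show "opsum (fps_const c) T f $ n = (c *\<^sub>Q f) $ n" by simp
qed

lemma opsum_power:
  assumes "raising T" shows "opsum (b ^ j) T f = (opsum b T ^^ j) f"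
  by (induction j arbitrary: f) (simp_all add: opsum_mult[OF assms] funpow_swap1)

text \<open>As \<open>b\<close> has no constant term, \<open>b ^ j\<close> starts in order j, so
  both sums may be cut at n. This turns composition identities between scalar power series into
  identities between operators.\<close>

lemma opsum_compose:
  assumes "raising T" "b $ 0 = 0"
  shows "opsum a (opsum b T) f = opsum (a oo b) T f"
proof (rule fps_ext)
  fix n
  have *: "(b ^ j) $ k = 0" if "k < j" for j k
    using startsby_zero_power_prefix[OF assms(2)] that by auto
  have "opsum a (opsum b T) f $ n = (\<Sum>j\<le>n. a $ j *\<^sub>Q (\<Sum>k\<le>n. (b ^ j) $ k *\<^sub>Q (T ^^ k) f $ n))"
    by (simp add: opsum_def[of a] opsum_power[OF assms(1), symmetric] opsum_nth[OF assms(1) order.refl])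
  also have "\<dots> = (\<Sum>k\<le>n. (\<Sum>j\<le>n. a $ j * (b ^ j) $ k) *\<^sub>Q (T ^^ k) f $ n)"
    unfolding ratv.scale_sum_right ratv.scale_sum_left scaleQ_scaleQ by (rule sum.swap)
  also have "\<dots> = opsum (a oo b) T f $ n"
  proof -
    have "(\<Sum>j\<le>n. a $ j * (b ^ j) $ k) = (a oo b) $ k" if "k \<le> n" for k
      unfolding fps_compose_nth atLeast0AtMost using that *
      by (intro sum.mono_neutral_right) (auto simp: not_le)
    then show ?thesis by (simp add: opsum_def)
  qed
  finally show "opsum a (opsum b T) f $ n = opsum (a oo b) T f $ n" .
qed

lemma opsum_commute:
  assumes "causal S" "raising T" "raising T'" "\<And>f. S (T f) = T' (S f)"
  shows "S (opsum a T f) = opsum a T' (S f)"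
proof (rule fps_ext)
  fix n
  have "S ((T ^^ j) f) = (T' ^^ j) (S f)" for j by (induction j) (simp_all add: assms)
  then show "S (opsum a T f) $ n = opsum a T' (S f) $ n"
    unfolding causal_opsum_nth[OF assms(1,2) order.refl] opsum_def[of _ T'] by simp
qed

lemma Exp_uminus:
  assumes "raising T"
  shows "Exp (\<lambda>f. - T f) (Exp T f) = f"
proof -
  have *: "opsum (- fps_X) T = (\<lambda>f. - T f)"
    using opsum_diff[of 0 fps_X T] by (simp add: opsum_X[OF assms] fun_eq_iff opsum_const[of 0, simplified])
  have "Exp (\<lambda>f. - T f) = opsum (fps_exp 1 oo (- fps_X)) T"
    unfolding *[symmetric] using opsum_compose[OF assms, of "- fps_X" "fps_exp 1"] by (simp add: fun_eq_iff)
  also have "fps_exp 1 oo (- fps_X) = (fps_exp (-1) :: rat fps)"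
    using fps_exp_compose_linear[of 1 "-1 :: rat"] by (simp flip: fps_const_neg)
  finally show ?thesis
    by (simp add: opsum_mult[OF assms, symmetric] fps_exp_add_mult[symmetric])
qed

text \<open>The scalar identity ln(1 + (e^z - 1)) = z, evaluated at \<open>T\<close>: an operator
  can be read off from its exponential.\<close>

lemma opsum_ln_Exp:
  assumes "raising T"
  shows "opsum (fps_ln 1) (\<lambda>f. Exp T f - f) f = T f"
proof -
  have "(\<lambda>f. Exp T f - f) = opsum (fps_exp 1 - 1) T"
    by (simp add: fun_eq_iff opsum_diff)
  then have "opsum (fps_ln 1) (\<lambda>f. Exp T f - f) f = opsum (fps_ln 1 oo (fps_exp 1 - 1)) T f"
    by (simp add: opsum_compose[OF assms])
  also have "fps_ln 1 oo (fps_exp 1 - 1 :: rat fps) = fps_X"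
    by (simp add: fps_ln_fps_exp_inv fps_inv)
  finally show ?thesis by (simp add: opsum_X[OF assms])
qed

lemma Exp_inj:
  assumes "raising T" "raising T'" "\<And>f. Exp T f = Exp T' f"
  shows "T = T'"
proof
  fix f
  have "T f = opsum (fps_ln 1) (\<lambda>f. Exp T f - f) f" by (rule opsum_ln_Exp[OF assms(1), symmetric])
  also have "(\<lambda>f. Exp T f - f) = (\<lambda>f. Exp T' f - f)" using assms(3) by simp
  also have "opsum (fps_ln 1) (\<lambda>f. Exp T' f - f) f = T' f" by (rule opsum_ln_Exp[OF assms(2)])
  finally show "T f = T' f" .
qed

section \<open>Leibniz rule for exponentials\<close>

text \<open>The family \<open>g i j\<close> stands for the i-fold derivative of one factor combined
  with the j-fold derivative of another, so that different operators may act on the two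
  factors.\<close>

lemma funpow_leibniz:
  fixes D :: "'c::rat_vector \<Rightarrow> 'c"
  assumes "linQ D" "\<And>i j. D (g i j) = g (Suc i) j + g i (Suc j)"
  shows "(D ^^ n) (g i j) = (\<Sum>k\<le>n. of_nat (n choose k) *\<^sub>Q g (i + k) (j + (n - k)))"
proof (induction n arbitrary: i j)
  case (Suc n)
  have "(D ^^ Suc n) (g i j) = (D ^^ n) (g (Suc i) j) + (D ^^ n) (g i (Suc j))"
    by (simp add: funpow_swap1 assms(2) linQ_add[OF linQ_funpow[OF assms(1)]])
  also have "\<dots> = (\<Sum>k\<le>n. of_nat (n choose k) *\<^sub>Q g (i + Suc k) (j + (n - k)))
      + (\<Sum>k\<le>n. of_nat (n choose k) *\<^sub>Q g (i + k) (j + (Suc n - k)))"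
    unfolding Suc by (intro arg_cong2[of _ _ _ _ "(+)"] sum.cong) (auto simp: Suc_diff_le)
  also have "(\<Sum>k\<le>n. of_nat (n choose k) *\<^sub>Q g (i + k) (j + (Suc n - k)))
      = (\<Sum>k\<le>Suc n. of_nat (n choose k) *\<^sub>Q g (i + k) (j + (Suc n - k)))"
    by simp
  also have "\<dots> = g i (j + Suc n) + (\<Sum>k\<le>n. of_nat (n choose Suc k) *\<^sub>Q g (i + Suc k) (j + (n - k)))"
    by (subst sum.atMost_Suc_shift) simp
  also have "(\<Sum>k\<le>n. of_nat (n choose k) *\<^sub>Q g (i + Suc k) (j + (n - k))) +
      (g i (j + Suc n) + (\<Sum>k\<le>n. of_nat (n choose Suc k) *\<^sub>Q g (i + Suc k) (j + (n - k))))
      = (\<Sum>k\<le>Suc n. of_nat (Suc n choose k) *\<^sub>Q g (i + k) (j + (Suc n - k)))"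
    by (subst sum.atMost_Suc_shift) (simp add: scaleQ_add_left sum.distrib)
  finally show ?case .
qed simp

text \<open>A Cauchy product in which the bilinear map sees the two degrees. Constant families give
  the usual products; the Euler derivation needs the general form.\<close>

definition fps_bilin ::
  "(nat \<Rightarrow> nat \<Rightarrow> 'a::rat_vector \<Rightarrow> 'b::rat_vector \<Rightarrow> 'c::rat_vector) \<Rightarrow> 'a fps \<Rightarrow> 'b fps \<Rightarrow> 'c fps" where
  "fps_bilin b f g = Abs_fps (\<lambda>n. \<Sum>p\<le>n. b p (n - p) (f $ p) (g $ (n - p)))"

lemma fps_bilin_nth: "fps_bilin b f g $ n = (\<Sum>p\<le>n. b p (n - p) (f $ p) (g $ (n - p)))"
  by (simp add: fps_bilin_def)

lemma bilQ_fps_bilin: "(\<And>p q. bilQ (b p q)) \<Longrightarrow> bilQ (fps_bilin b)"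
  by (rule bilQI)
    (simp_all add: fps_eq_iff fps_bilin_nth bilQ_simps[of "b _ _"] sum.distrib ratv.scale_sum_right)

lemma fps_bilin_order:
  assumes "\<And>p q. bilQ (b p q)" "\<And>m. m < i \<Longrightarrow> f $ m = 0" "\<And>m. m < j \<Longrightarrow> g $ m = 0" "n < i + j"
  shows "fps_bilin b f g $ n = 0"
  unfolding fps_bilin_nth
proof (intro sum.neutral ballI)
  fix p assume "p \<in> {..n}"
  then have "p < i \<or> n - p < j" using assms(4) by auto
  then show "b p (n - p) (f $ p) (g $ (n - p)) = 0" using assms(2,3) by (auto simp: bilQ_simps[OF assms(1)])
qed

lemma causal_fps_bilin:
  assumes "\<And>p q. bilQ (b p q)"
  shows "causal (fps_bilin b f)" "causal (\<lambda>f. fps_bilin b f g)"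
  unfolding causal_def
proof (safe)
  show "linQ (fps_bilin b f)" "linQ (\<lambda>f. fps_bilin b f g)"
    using bilQD[OF bilQ_fps_bilin[of b, OF assms]] by auto
  show "fps_bilin b f h $ n = 0" if "\<forall>m\<le>n. h $ m = 0" for h n
    using that by (intro fps_bilin_order[of b 0 f "Suc n", OF assms]) auto
  show "fps_bilin b h g $ n = 0" if "\<forall>m\<le>n. h $ m = 0" for h n
    using that by (intro fps_bilin_order[of b "Suc n" h 0 g, OF assms]) auto
qed

lemma raising_fps_bilin:
  assumes "\<And>p q. bilQ (b p q)" "f $ 0 = 0"
  shows "raising (fps_bilin b f)"
  unfolding raising_def
proof (intro conjI allI impI)
  show "linQ (fps_bilin b f)" using bilQD(1)[OF bilQ_fps_bilin[of b, OF assms(1)]] .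
  show "fps_bilin b f g $ n = 0" if "\<forall>m<n. g $ m = 0" for g n
    using that assms(2) by (intro fps_bilin_order[of b "Suc 0" f n g, OF assms(1)]) auto
qed

text \<open>Both sides are sums over the triples p + q + r = n, so a Leibniz rule for coefficients
  suffices. The indices record degrees: \<open>a1 p q\<close> has a result of degree p + q, which is
  the first index of the outer \<open>b\<close>.\<close>

lemma fps_bilin_leibniz:
  assumes bil: "\<And>p q. bilQ (a p q)" "\<And>p q. bilQ (b' p q)" "\<And>p q. bilQ (b p q)"
    and leib: "\<And>p q r z u w. a p (q + r) z (b q r u w) =
      b (p + q) r (a1 p q z u) w + b' q (p + r) u (a2 p r z w)"
  shows "fps_bilin a Z (fps_bilin b U W) =
    fps_bilin b (fps_bilin a1 Z U) W + fps_bilin b' U (fps_bilin a2 Z W)"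
proof (rule fps_ext)
  fix n
  have "fps_bilin a Z (fps_bilin b U W) $ n = (\<Sum>p\<le>n. \<Sum>q\<le>n - p.
      b (p + q) (n - p - q) (a1 p q (Z $ p) (U $ q)) (W $ (n - p - q))
      + b' q (p + (n - p - q)) (U $ q) (a2 p (n - p - q) (Z $ p) (W $ (n - p - q))))"
    unfolding fps_bilin_nth bilQ_sum[OF bil(1)]
  proof (intro sum.cong refl)
    fix p q assume "p \<in> {..n}" "q \<in> {..n - p}"
    then show "a p (n - p) (Z $ p) (b q (n - p - q) (U $ q) (W $ (n - p - q))) =
        b (p + q) (n - p - q) (a1 p q (Z $ p) (U $ q)) (W $ (n - p - q))
        + b' q (p + (n - p - q)) (U $ q) (a2 p (n - p - q) (Z $ p) (W $ (n - p - q)))"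
      using leib[of p q "n - p - q"] by simp
  qed
  also have "\<dots> = (\<Sum>p\<le>n. \<Sum>q\<le>n - p. b (p + q) (n - p - q) (a1 p q (Z $ p) (U $ q)) (W $ (n - p - q)))
      + (\<Sum>p\<le>n. \<Sum>q\<le>n - p. b' q (p + (n - p - q)) (U $ q) (a2 p (n - p - q) (Z $ p) (W $ (n - p - q))))"
    by (simp add: sum.distrib)
  also have "(\<Sum>p\<le>n. \<Sum>q\<le>n - p. b (p + q) (n - p - q) (a1 p q (Z $ p) (U $ q)) (W $ (n - p - q)))
      = fps_bilin b (fps_bilin a1 Z U) W $ n"
    using fps_mult_assoc_lemma[where k = n and f = "\<lambda>p q r. b (p + q) r (a1 p q (Z $ p) (U $ q)) (W $ r)"]
    by (simp add: fps_bilin_nth bilQ_sum[OF bil(3)] atLeast0AtMost)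
  also have "(\<Sum>p\<le>n. \<Sum>q\<le>n - p. b' q (p + (n - p - q)) (U $ q) (a2 p (n - p - q) (Z $ p) (W $ (n - p - q))))
      = (\<Sum>q\<le>n. \<Sum>p\<le>n - q. b' q (p + (n - p - q)) (U $ q) (a2 p (n - p - q) (Z $ p) (W $ (n - p - q))))"
    by (rule sum_triangle_swap)
  also have "\<dots> = fps_bilin b' U (fps_bilin a2 Z W) $ n"
    unfolding fps_bilin_nth bilQ_sum[OF bil(2)]
    by (intro sum.cong refl) (auto simp: algebra_simps)
  finally show "fps_bilin a Z (fps_bilin b U W) $ n =
      (fps_bilin b (fps_bilin a1 Z U) W + fps_bilin b' U (fps_bilin a2 Z W)) $ n" by simp
qed

text \<open>A derivation exponentiates to a multiplicative map: dividing the n-th Leibniz expansion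
  by n! leaves the product of 1/i! and 1/j!. The two factors and the result may lie in three
  different spaces, each with its own operator.\<close>

lemma Exp_leibniz:
  assumes bil: "\<And>p q. bilQ (b p q)" and D: "raising D" "raising D1" "raising D2"
    and leib: "\<And>u w. D (fps_bilin b u w) = fps_bilin b (D1 u) w + fps_bilin b u (D2 w)"
  shows "Exp D (fps_bilin b u w) = fps_bilin b (Exp D1 u) (Exp D2 w)"
proof (rule fps_ext)
  fix N
  let ?q = "fps_bilin b"
  define g where "g i j = (1 / (fact i * fact j)) *\<^sub>Q ?q ((D1 ^^ i) u) ((D2 ^^ j) w) $ N" for i j
  note C1 = causal_fps_bilin(1)[of b, OF bil] and C2 = causal_fps_bilin(2)[of b, OF bil]
  have pow: "(D ^^ n) (?q u w) = (\<Sum>k\<le>n. of_nat (n choose k) *\<^sub>Q ?q ((D1 ^^ k) u) ((D2 ^^ (n - k)) w))" for n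
    using funpow_leibniz[of D "\<lambda>i j. ?q ((D1 ^^ i) u) ((D2 ^^ j) w)" n 0 0] leib raising_linQ[OF D(1)]
    by simp
  have "Exp D (?q u w) $ N = (\<Sum>n\<le>N. \<Sum>k\<le>n. g k (n - k))"
    unfolding opsum_def fps_nth_Abs_fps pow
    by (intro sum.cong refl)
      (simp add: fps_sum_nth ratv.scale_sum_right scaleQ_scaleQ g_def binomial_fact field_simps)
  also have "\<dots> = (\<Sum>i\<le>N. \<Sum>j\<le>N. g i j)"
  proof (rule sum_triangle)
    fix i j :: nat assume "i + j > N"
    then show "g i j = 0"
      unfolding g_def
      by (subst fps_bilin_order[of b i _ j]) (simp_all add: bil raising_funpow_0[OF D(2)] raising_funpow_0[OF D(3)])
  qed
  also have "\<dots> = (\<Sum>i\<le>N. (1 / fact i) *\<^sub>Q (\<Sum>j\<le>N. (1 / fact j) *\<^sub>Q ?q ((D1 ^^ i) u) ((D2 ^^ j) w) $ N))"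
    by (simp add: g_def ratv.scale_sum_right scaleQ_scaleQ)
  also have "\<dots> = (\<Sum>i\<le>N. (1 / fact i) *\<^sub>Q ?q ((D1 ^^ i) u) (Exp D2 w) $ N)"
    using causal_opsum_nth[OF C1 D(3) order.refl, where a = "fps_exp 1" and f = w] by simp
  also have "\<dots> = ?q (Exp D1 u) (Exp D2 w) $ N"
    using causal_opsum_nth[OF C2 D(2) order.refl, where a = "fps_exp 1" and f = u] by simp
  finally show "Exp D (?q u w) $ N = ?q (Exp D1 u) (Exp D2 w) $ N" .
qed

section \<open>Affine operators\<close>

text \<open>A linear operator on pairs that restricts to the affine vector field v \<mapsto> a z v -
  \<delta> z on the hyperplane of scalar 1. Its own scalar component is 0, so its exponential
  preserves this hyperplane.\<close>

definition affine ::
  "(nat \<Rightarrow> nat \<Rightarrow> 'l \<Rightarrow> 'v \<Rightarrow> 'v) \<Rightarrow> (nat \<Rightarrow> 'l \<Rightarrow> 'v) \<Rightarrow> nat \<Rightarrow> nat \<Rightarrow> 'l \<Rightarrow> 'v::rat_vector \<times> rat \<Rightarrow> 'v \<times> rat"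
  where "affine a \<delta> p q z u = (a p q z (fst u) - snd u *\<^sub>Q \<delta> p z, 0)"

definition fps_pair :: "'v fps \<Rightarrow> rat fps \<Rightarrow> ('v \<times> rat) fps" where
  "fps_pair v c = Abs_fps (\<lambda>n. (v $ n, c $ n))"

definition fps_map :: "(nat \<Rightarrow> 'l \<Rightarrow> 'v) \<Rightarrow> 'l fps \<Rightarrow> 'v fps" where
  "fps_map \<delta> Z = Abs_fps (\<lambda>n. \<delta> n (Z $ n))"

definition phi :: "rat fps" where \<comment> \<open>\<open>(e\<^sup>z - 1) / z\<close>\<close>
  "phi = Abs_fps (\<lambda>j. 1 / fact (Suc j))"

lemma fps_pair_nth [simp]: "fps_pair v c $ n = (v $ n, c $ n)"
  by (simp add: fps_pair_def)

lemma fps_map_nth [simp]: "fps_map \<delta> Z $ n = \<delta> n (Z $ n)"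
  by (simp add: fps_map_def)

lemma phi_nth: "phi $ j = 1 / fact (Suc j)"
  by (simp add: phi_def)

lemma bilQ_affine:
  assumes "bilQ (a p q)" "linQ (\<delta> p)"
  shows "bilQ (affine a \<delta> p q)"
  by (rule bilQI)
    (simp_all add: affine_def prod_eq_iff bilQ_simps[OF assms(1)] linQ_add[OF assms(2)] linQ_scale[OF assms(2)]
      scaleQ_add_right scaleQ_add_left scaleQ_scaleQ ratv.scale_right_diff_distrib scaleQ_rat_def mult.commute)

lemma sum_unit_scaleQ:
  fixes n :: nat
  shows "(\<Sum>p\<le>n. (if n - p = 0 then 1 else 0) *\<^sub>Q F p) = F n"
  "(\<Sum>p\<le>n. (if p = 0 then 1 else 0) *\<^sub>Q F (n - p)) = F n"
proof -
  have "(\<Sum>p\<le>n. (if n - p = 0 then 1 else 0) *\<^sub>Q F p) = (\<Sum>p\<in>{n}. F p)"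
    by (intro sum.mono_neutral_cong_right) auto
  moreover have "(\<Sum>p\<le>n. (if p = 0 then 1 else 0) *\<^sub>Q F (n - p)) = (\<Sum>p\<in>{0}. F (n - p))"
    by (intro sum.mono_neutral_cong_right) auto
  ultimately show "(\<Sum>p\<le>n. (if n - p = 0 then 1 else 0) *\<^sub>Q F p) = F n"
    "(\<Sum>p\<le>n. (if p = 0 then 1 else 0) *\<^sub>Q F (n - p)) = F n" by simp_all
qed

lemma affine_bilin_const:
  assumes "\<And>p q. bilQ (a p q)" "\<And>p. linQ (\<delta> p)"
  shows "fps_bilin (affine a \<delta>) Z (fps_pair v 1) = fps_pair (fps_bilin a Z v - fps_map \<delta> Z) 0"
    and "fps_bilin (affine a \<delta>) Z (fps_pair v 0) = fps_pair (fps_bilin a Z v) 0"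
proof -
  have "(\<Sum>p\<le>n. (if n - p = 0 then 1 else 0) *\<^sub>Q \<delta> p (Z $ p)) = \<delta> n (Z $ n)" for n
    by (rule sum_unit_scaleQ(1))
  then show "fps_bilin (affine a \<delta>) Z (fps_pair v 1) = fps_pair (fps_bilin a Z v - fps_map \<delta> Z) 0"
    by (simp add: fps_eq_iff fps_bilin_nth affine_def prod_eq_iff fst_sum snd_sum sum_subtractf)
  show "fps_bilin (affine a \<delta>) Z (fps_pair v 0) = fps_pair (fps_bilin a Z v) 0"
    by (simp add: fps_eq_iff fps_bilin_nth affine_def prod_eq_iff fst_sum snd_sum)
qed

lemma Exp_affine:
  assumes a: "\<And>p q. bilQ (a p q)" and \<delta>: "\<And>p. linQ (\<delta> p)" and Z: "Z $ 0 = 0"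
  shows "Exp (fps_bilin (affine a \<delta>) Z) (fps_pair v 1) =
    fps_pair (Exp (fps_bilin a Z) v - opsum phi (fps_bilin a Z) (fps_map \<delta> Z)) 1"
proof (rule fps_ext)
  fix n
  let ?T = "fps_bilin (affine a \<delta>) Z" and ?A = "fps_bilin a Z"
  have rT: "raising ?T" by (intro raising_fps_bilin bilQ_affine a \<delta> Z)
  have rA: "raising ?A" by (intro raising_fps_bilin a Z)
  note lin = linQ_diff[OF linQ_funpow[OF raising_linQ[OF rA]]]
  \<comment> \<open>The first application uses up the scalar 1 to produce -\<delta> Z; the later
    ones act by \<open>?A\<close> alone. So \<delta> Z carries one power less than v, which puts
    1/(j + 1)!, the coefficient of \<open>phi\<close>, in front of the j-th power.\<close>
  have pow: "(?T ^^ Suc j) (fps_pair v 1) = fps_pair ((?A ^^ Suc j) v - (?A ^^ j) (fps_map \<delta> Z)) 0" for j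
  proof (induction j)
    case 0
    then show ?case by (simp add: affine_bilin_const[OF a \<delta>])
  next
    case (Suc j)
    then show ?case by (simp add: affine_bilin_const[OF a \<delta>] linQ_diff[OF raising_linQ[OF rA]])
  qed
  have "Exp ?T (fps_pair v 1) $ n =
      (v $ n, 1 $ n) + (\<Sum>j\<le>n. (1 / fact (Suc j)) *\<^sub>Q (?T ^^ Suc j) (fps_pair v 1) $ n)"
    unfolding opsum_nth[OF rT le_SucI[OF order.refl]] sum.atMost_Suc_shift
    by (simp del: fact_Suc funpow.simps)
  also have "\<dots> = (v $ n + (\<Sum>j\<le>n. (1 / fact (Suc j)) *\<^sub>Q (?A ^^ Suc j) v $ n) -
      (\<Sum>j\<le>n. (1 / fact (Suc j)) *\<^sub>Q (?A ^^ j) (fps_map \<delta> Z) $ n), 1 $ n)"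
    unfolding pow
    by (simp add: prod_eq_iff fst_sum snd_sum sum_subtractf ratv.scale_right_diff_distrib del: funpow.simps fact_Suc)
  also have "v $ n + (\<Sum>j\<le>n. (1 / fact (Suc j)) *\<^sub>Q (?A ^^ Suc j) v $ n) = Exp ?A v $ n"
    unfolding opsum_nth[OF rA le_SucI[OF order.refl]] sum.atMost_Suc_shift
    by (simp del: fact_Suc funpow.simps)
  finally show "Exp ?T (fps_pair v 1) $ n = fps_pair (Exp ?A v - opsum phi ?A (fps_map \<delta> Z)) 1 $ n"
    by (simp add: opsum_def phi_nth)
qed

section \<open>Exponentials in an associative algebra\<close>

definition comm :: "'a::ring \<Rightarrow> 'a \<Rightarrow> 'a" where "comm x y = x * y - y * x"

definition fexp :: "'a::rat_algebra_1 fps \<Rightarrow> 'a fps" where "fexp z = Exp ((*) z) 1"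

text \<open>Together with \<open>fps_map\<close> this is the derivation t d/dt. It preserves degrees
  and is injective on series without constant term.\<close>

definition euler :: "nat \<Rightarrow> 'a::rat_vector \<Rightarrow> 'a" where "euler n x = of_nat n *\<^sub>Q x"

lemma linQ_euler: "linQ (euler n)"
  by (rule linQI) (simp_all add: euler_def scaleQ_add_right scaleQ_scaleQ mult.commute)

lemma bilQ_comm: "bilQ (comm :: 'a \<Rightarrow> 'a \<Rightarrow> 'a::rat_algebra_1)"
  by (rule bilQI) (simp_all add: comm_def algebra_simps scaleQ_mult_left scaleQ_mult_right ratv.scale_right_diff_distrib)

lemma fps_bilin_times: "fps_bilin (\<lambda>_ _. (*)) z = (*) (z :: 'a::rat_algebra_1 fps)"
  by (simp add: fun_eq_iff fps_eq_iff fps_bilin_nth fps_mult_nth atLeast0AtMost)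

lemma fps_bilin_comm: "fps_bilin (\<lambda>_ _. comm) z = comm (z :: 'a::rat_algebra_1 fps)"
proof (intro ext fps_ext)
  fix u n
  have "(\<Sum>p\<le>n. u $ (n - p) * z $ p) = (\<Sum>p\<le>n. u $ p * z $ (n - p))"
    by (rule sum.reindex_bij_witness[of _ "\<lambda>p. n - p" "\<lambda>p. n - p"]) auto
  then show "fps_bilin (\<lambda>_ _. comm) z u $ n = comm z u $ n"
    by (simp add: fps_bilin_nth comm_def fps_mult_nth atLeast0AtMost sum_subtractf)
qed

lemma raising_times: "z $ 0 = 0 \<Longrightarrow> raising ((*) (z :: 'a::rat_algebra_1 fps))"
  using raising_fps_bilin[of "\<lambda>_ _. (*)" z] by (simp add: bilQ_times fps_bilin_times)

lemma raising_comm: "z $ 0 = 0 \<Longrightarrow> raising (comm (z :: 'a::rat_algebra_1 fps))"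
  using raising_fps_bilin[of "\<lambda>_ _. comm" z] by (simp add: bilQ_comm fps_bilin_comm)

lemma causal_times_right: "causal (\<lambda>u. u * (w :: 'a::rat_algebra_1 fps))"
  using causal_fps_bilin(2)[of "\<lambda>_ _. (*)" w] by (simp add: bilQ_times fps_bilin_times)

lemma opsum_times: "z $ 0 = 0 \<Longrightarrow> opsum a ((*) z) u = opsum a ((*) z) 1 * (u :: 'a::rat_algebra_1 fps)"
  using opsum_commute[OF causal_times_right raising_times raising_times, of z z u a 1]
  by (simp add: mult.assoc)

lemma fexp_times: "z $ 0 = 0 \<Longrightarrow> Exp ((*) z) u = fexp z * u"
  unfolding fexp_def by (rule opsum_times)

text \<open>This is e^z u e^(-z) = e^(ad z) u, written without inverses. Left multiplication obeys z
  (u w) = [z, u] w + u (z w), so \<open>Exp_leibniz\<close> applies with w = 1.\<close>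

lemma fexp_conj:
  assumes "z $ 0 = 0" shows "fexp z * u = Exp (comm z) u * fexp z"
proof -
  have "Exp ((*) z) (fps_bilin (\<lambda>_ _. (*)) u 1) = fps_bilin (\<lambda>_ _. (*)) (Exp (comm z) u) (Exp ((*) z) 1)"
    by (rule Exp_leibniz)
      (auto simp: bilQ_times raising_times raising_comm assms fps_bilin_times comm_def algebra_simps)
  then show ?thesis by (simp add: fps_bilin_times fexp_times[OF assms])
qed

lemma fexp_uminus: "z $ 0 = 0 \<Longrightarrow> fexp (- z) * fexp z = 1"
proof -
  assume z: "z $ 0 = 0"
  have "fexp (- z) * fexp z = Exp ((*) (- z)) (fexp z)" using z by (simp add: fexp_times)
  also have "(*) (- z) = (\<lambda>f. - (z * f))" by (simp add: fun_eq_iff)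
  finally show ?thesis unfolding fexp_def using Exp_uminus[OF raising_times[OF z], of 1] by simp
qed

text \<open>
  The pair \<open>(u, c)\<close> stands for the operator \<open>w \<mapsto> u w + c E w\<close>, where \<open>E\<close> is the Euler derivation.
  Multiplication by \<open>z\<close> satisfies a Leibniz rule for the evaluation of these operators in which
  \<open>E\<close> is sent to \<open>[z, E] = - E z\<close>.
\<close>

lemma euler_fexp:
  fixes z :: "'a::rat_algebra_1 fps"
  assumes z: "z $ 0 = 0"
  shows "fps_map euler (fexp z) = opsum phi (comm z) (fps_map euler z) * fexp z"
proof -
  define q :: "nat \<Rightarrow> nat \<Rightarrow> 'a \<times> rat \<Rightarrow> 'a \<Rightarrow> 'a"
    where "q i j u w = fst u * w + snd u *\<^sub>Q euler j w" for i j u w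
  let ?D = "fps_bilin (affine (\<lambda>_ _. comm) euler) z"
  have q: "bilQ (q i j)" for i j
    by (rule bilQI) (simp_all add: q_def linQ_add[OF linQ_euler] linQ_scale[OF linQ_euler] algebra_simps
        scaleQ_mult_left scaleQ_mult_right scaleQ_add_left scaleQ_add_right scaleQ_scaleQ scaleQ_rat_def)
  have q1: "fps_bilin q (fps_pair u 1) w = u * w + fps_map euler w" for u w
  proof (rule fps_ext)
    fix n
    have "(\<Sum>p\<le>n. (if p = 0 then 1 else 0) *\<^sub>Q euler (n - p) (w $ (n - p))) = euler n (w $ n)"
      by (rule sum_unit_scaleQ(2))
    then show "fps_bilin q (fps_pair u 1) w $ n = (u * w + fps_map euler w) $ n"
      by (simp add: fps_bilin_nth q_def sum.distrib fps_mult_nth atLeast0AtMost)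
  qed
  \<comment> \<open>The operator E, that is the pair (0, 1), is evaluated at the series 1. The left
    side vanishes since E 1 = 0; on the right, e^(ad z) has turned E into E - phi(ad z)(E z), and
    this is evaluated at e^z.\<close>
  have "Exp ((*) z) (fps_bilin q (fps_pair 0 1) 1) = fps_bilin q (Exp ?D (fps_pair 0 1)) (Exp ((*) z) 1)"
  proof (rule Exp_leibniz[OF q raising_times[OF z] _ raising_times[OF z]])
    show "raising ?D" by (intro raising_fps_bilin bilQ_affine bilQ_comm linQ_euler z)
    show "z * fps_bilin q u w = fps_bilin q (?D u) w + fps_bilin q u (z * w)" for u w
      unfolding fps_bilin_times[symmetric]
      by (rule fps_bilin_leibniz[OF bilQ_times q q])
        (simp add: q_def affine_def comm_def euler_def algebra_simps scaleQ_mult_left scaleQ_mult_right scaleQ_scaleQ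
          scaleQ_add_left)
  qed
  moreover have "fps_map euler 1 = (0 :: 'a fps)" by (simp add: fps_eq_iff euler_def)
  moreover have "Exp ((*) z) 0 = 0" using linQ_0[OF causal_linQ[OF causal_opsum[OF raising_times[OF z]]]] .
  moreover have "Exp ?D (fps_pair 0 1) = fps_pair (- opsum phi (comm z) (fps_map euler z)) 1"
    using Exp_affine[OF bilQ_comm linQ_euler z, where v = 0]
      linQ_0[OF causal_linQ[OF causal_opsum[OF raising_comm[OF z]]]]
    by (simp add: fps_bilin_comm)
  ultimately show ?thesis by (simp add: q1 fexp_def[symmetric])
qed

section \<open>The Baker-Campbell-Hausdorff formula in an associative algebra\<close>

definition flog :: "'a::rat_algebra_1 fps \<Rightarrow> 'a fps" where
  "flog w = opsum (fps_ln 1) ((*) (w - 1)) 1"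

lemma flog_0: "w $ 0 = 1 \<Longrightarrow> flog w $ 0 = 0"
  by (simp add: flog_def opsum_def)

text \<open>Multiplication by \<open>flog w\<close> is ln(1 + T), where T is multiplication by w -
  1. Functional calculus then reduces the claim to exp(ln(1 + z)) = 1 + z.\<close>

lemma fexp_flog:
  assumes "w $ 0 = 1" shows "fexp (flog w) = w"
proof -
  have r: "raising ((*) (w - 1))" by (rule raising_times) (simp add: assms)
  have "(*) (flog w) = opsum (fps_ln 1) ((*) (w - 1))"
    unfolding flog_def using assms by (intro ext opsum_times[symmetric]) simp
  then have "fexp (flog w) = opsum (fps_exp 1 oo fps_ln 1) ((*) (w - 1)) 1"
    by (simp add: fexp_def opsum_compose[OF r])
  also have "fps_exp 1 oo fps_ln 1 = 1 + (fps_X :: rat fps)"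
  proof -
    have "(fps_exp 1 - 1) oo fps_ln 1 = (fps_X :: rat fps)"
      by (simp add: fps_ln_fps_exp_inv fps_inv_right)
    then show ?thesis by (simp add: fps_compose_sub_distrib algebra_simps)
  qed
  finally show ?thesis by (simp add: opsum_add opsum_X[OF r])
qed

definition lnq :: "rat fps" where "lnq = Abs_fps (\<lambda>n. (-1) ^ n / of_nat (Suc n))" \<comment> \<open>\<open>ln (1 + z) / z\<close>\<close>

text \<open>The first factor is x / (e^x - 1), the reciprocal of \<open>phi\<close>. Both quotients
  divide by a non-unit, so the proof multiplies by X and cancels it at the end.\<close>

lemma lnq_phi: "(lnq oo (fps_exp 1 - 1)) * phi = 1"
proof -
  let ?e = "fps_exp 1 - 1 :: rat fps"
  have l: "fps_ln 1 = lnq * fps_X" by (intro fps_ext) (simp add: lnq_def fps_ln_def split: nat.splits)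
  have p: "?e = phi * fps_X"
  proof (rule fps_ext)
    fix n show "?e $ n = (phi * fps_X) $ n" by (cases n) (simp_all add: phi_nth algebra_simps)
  qed
  have "fps_X = fps_ln 1 oo ?e" by (simp add: fps_ln_fps_exp_inv fps_inv)
  also have "\<dots> = (lnq oo ?e) * ?e" by (simp add: l fps_compose_mult_distrib)
  finally have "fps_X * ((lnq oo ?e) * phi) = fps_X * 1" using p by (simp add: algebra_simps)
  then show ?thesis unfolding mult_left_cancel[OF fps_X_neq_zero] .
qed

section \<open>The logarithm of e^(tx) e^(ty) and its differential equation\<close>

definition tmul :: "'a::zero \<Rightarrow> 'a fps" where "tmul x = Abs_fps (\<lambda>n. if n = 1 then x else 0)"

lemma tmul_nth: "tmul x $ n = (if n = 1 then x else 0)" by (simp add: tmul_def)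

lemma tmul_mult_nth: "(tmul x * u) $ n = (if n = 0 then 0 else x * u $ (n - 1))"
  and mult_tmul_nth: "(u * tmul x) $ n = (if n = 0 then 0 else u $ (n - 1) * x)"
  for x :: "'a::ring_1"
proof -
  have "(\<Sum>i\<le>n. tmul x $ i * u $ (n - i)) = (\<Sum>i\<in>{1} \<inter> {..n}. tmul x $ i * u $ (n - i))"
    by (intro sum.mono_neutral_right) (auto simp: tmul_nth)
  then show "(tmul x * u) $ n = (if n = 0 then 0 else x * u $ (n - 1))"
    by (cases n) (simp_all add: fps_mult_nth atLeast0AtMost tmul_nth)
  have "(\<Sum>i\<le>n. u $ i * tmul x $ (n - i)) = (\<Sum>i\<in>{i. Suc i = n}. u $ i * tmul x $ (n - i))"
    by (intro sum.mono_neutral_right) (auto simp: tmul_nth)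
  also have "{i. Suc i = n} = (if n = 0 then {} else {n - 1})" by auto
  finally show "(u * tmul x) $ n = (if n = 0 then 0 else u $ (n - 1) * x)"
    by (cases n) (simp_all add: fps_mult_nth atLeast0AtMost tmul_nth)
qed

lemma euler_mult: "fps_map euler (u * w) = fps_map euler u * w + u * fps_map euler (w :: 'a::rat_algebra_1 fps)"
proof (rule fps_ext)
  fix n
  have "fps_map euler (u * w) $ n = (\<Sum>i\<le>n. (of_nat i + of_nat (n - i)) *\<^sub>Q (u $ i * w $ (n - i)))"
    by (simp add: fps_mult_nth atLeast0AtMost euler_def ratv.scale_sum_right of_nat_diff)
  then show "fps_map euler (u * w) $ n = (fps_map euler u * w + u * fps_map euler w) $ n"
    by (simp add: fps_mult_nth atLeast0AtMost euler_def scaleQ_add_left sum.distrib scaleQ_mult_left scaleQ_mult_right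
        ratv.scale_left_diff_distrib sum_subtractf right_diff_distrib)
qed

lemma euler_tmul: "fps_map euler (tmul x) = tmul (x :: 'a::rat_algebra_1)"
  by (simp add: fps_eq_iff euler_def tmul_nth)

context
  fixes x y :: "'a::rat_algebra_1"
begin

definition "bch_assoc = flog (fexp (tmul x) * fexp (tmul y))"

text \<open>With W = e^(tx) e^(ty) this is W u W^(-1) - u, hence e^(ad Z) - 1 for Z = log W.\<close>

definition "bch_step u = Exp (comm (tmul x)) (Exp (comm (tmul y)) u) - u"

text \<open>The logarithmic derivative (E W) W^(-1) of W = e^(tx) e^(ty).\<close>

definition "bch_start = tmul x + Exp (comm (tmul x)) (tmul y)"

lemma fexp_tmul_0: "fexp (tmul z) $ 0 = (1 :: 'a)"
  by (simp add: fexp_def opsum_def)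

lemma fexp_bch_assoc: "fexp bch_assoc = fexp (tmul x) * fexp (tmul y)"
  unfolding bch_assoc_def by (rule fexp_flog) (simp add: fexp_tmul_0)

lemma bch_assoc_0: "bch_assoc $ 0 = 0"
  unfolding bch_assoc_def by (rule flog_0) (simp add: fexp_tmul_0)

text \<open>Since tz commutes with itself, phi(ad tz) acts on tz by its constant coefficient
  1.\<close>

lemma euler_fexp_tmul: "fps_map euler (fexp (tmul z)) = tmul z * fexp (tmul (z :: 'a))"
proof -
  have z: "tmul z $ 0 = (0::'a)" by (simp add: tmul_nth)
  have 1: "comm (tmul z) (tmul z) = 0" by (simp add: comm_def)
  have 2: "(comm (tmul z) ^^ j) (tmul z) = (if j = 0 then tmul z else 0)" for j
    by (induction j) (simp_all add: 1 comm_def)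
  have "opsum phi (comm (tmul z)) (tmul z) = tmul z"
  proof (rule fps_ext)
    fix n
    have "opsum phi (comm (tmul z)) (tmul z) $ n = (\<Sum>j\<in>{0}. phi $ j *\<^sub>Q (comm (tmul z) ^^ j) (tmul z) $ n)"
      unfolding opsum_def fps_nth_Abs_fps by (intro sum.mono_neutral_right) (auto simp: 2)
    then show "opsum phi (comm (tmul z)) (tmul z) $ n = tmul z $ n" by (simp add: phi_nth)
  qed
  then show ?thesis using euler_fexp[OF z] by (simp add: euler_tmul)
qed

text \<open>Two expressions for (E W) W^(-1) are compared: \<open>bch_start\<close>, by the product
  rule, and phi(ad Z)(E Z), because W = e^Z. By \<open>lnq_phi\<close> the operator phi(ad Z) is
  inverted by lnq(e^(ad Z) - 1), and e^(ad Z) - 1 is \<open>bch_step\<close>.\<close>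

lemma euler_bch_assoc: "fps_map euler bch_assoc = opsum lnq bch_step bch_start"
proof -
  let ?Z = bch_assoc and ?W = "fexp (tmul x) * fexp (tmul y)"
  have x0: "tmul x $ 0 = (0::'a)" and y0: "tmul y $ 0 = (0::'a)" by (simp_all add: tmul_nth)
  note r = raising_comm[OF bch_assoc_0]
  have inv: "?W * fexp (- ?Z) = 1" 
    using fexp_uminus[of "- ?Z"] bch_assoc_0 by (simp add: fexp_bch_assoc)
  have cancel: "u = v" if "u * ?W = v * ?W" for u v
    using arg_cong[OF that, of "\<lambda>u. u * fexp (- ?Z)"] inv by (simp add: mult.assoc)
  have "fps_map euler ?W = bch_start * ?W"
    using fexp_conj[OF x0, of "tmul y"]
    by (simp add: euler_mult euler_fexp_tmul bch_start_def algebra_simps) (metis mult.assoc)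
  moreover have "fps_map euler ?W = opsum phi (comm ?Z) (fps_map euler ?Z) * ?W"
    using euler_fexp[OF bch_assoc_0] by (simp add: fexp_bch_assoc)
  ultimately have start: "bch_start = opsum phi (comm ?Z) (fps_map euler ?Z)"
    using cancel by simp
  have "Exp (comm ?Z) u * ?W = Exp (comm (tmul x)) (Exp (comm (tmul y)) u) * ?W" for u
    using fexp_conj[OF bch_assoc_0, of u] fexp_conj[OF x0] fexp_conj[OF y0, of u]
    by (simp add: fexp_bch_assoc) (metis mult.assoc)
  then have "Exp (comm ?Z) u = Exp (comm (tmul x)) (Exp (comm (tmul y)) u)" for u
    by (rule cancel)
  then have "bch_step = opsum (fps_exp 1 - 1) (comm ?Z)"
    by (simp add: fun_eq_iff bch_step_def opsum_diff)
  then have "opsum lnq bch_step bch_start = opsum ((lnq oo (fps_exp 1 - 1)) * phi) (comm ?Z) (fps_map euler ?Z)"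
    by (simp add: start opsum_compose[OF r] opsum_mult[OF r])
  then show ?thesis by (simp add: lnq_phi)
qed

lemma comm_tmul_nth: "comm (tmul z) u $ m = (if m = 0 then 0 else comm z (u $ (m - 1)))" for z :: 'a
  by (simp add: comm_def tmul_mult_nth mult_tmul_nth)

lemma Exp_comm_tmul_nth:
  "Exp (comm (tmul z)) u $ m = (\<Sum>r\<le>m. (1 / fact r) *\<^sub>Q (comm z ^^ r) (u $ (m - r)))" for z :: 'a
proof -
  have "(comm (tmul z) ^^ r) u $ m = (if r \<le> m then (comm z ^^ r) (u $ (m - r)) else 0)" for r
  proof (induction r arbitrary: m)
    case (Suc r)
    moreover have "comm z 0 = 0" by (simp add: comm_def)
    ultimately show ?case by (auto simp: comm_tmul_nth Suc_le_eq)
  qed simp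
  then show ?thesis by (simp add: opsum_def)
qed

text \<open>Subtracting u removes exactly the pair (0, 0). This is the origin of the condition r + s
  > 0 in Dynkin's index set.\<close>

lemma bch_step_nth:
  "bch_step u $ m = (\<Sum>(r, s)\<in>{(r, s). 0 < r + s \<and> r + s \<le> m}.
     (1 / (fact r * fact s)) *\<^sub>Q (comm x ^^ r) ((comm y ^^ s) (u $ (m - (r + s)))))"
proof -
  define g where "g = (\<lambda>(r, s). (1 / (fact r * fact s)) *\<^sub>Q (comm x ^^ r) ((comm y ^^ s) (u $ (m - (r + s)))))"
  note lin = linQ_funpow[OF bilQD(1)[OF bilQ_comm]]
  have "Exp (comm (tmul x)) (Exp (comm (tmul y)) u) $ m = (\<Sum>r\<le>m. \<Sum>s\<le>m - r. g (r, s))"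
    by (simp add: Exp_comm_tmul_nth linQ_sum[OF lin] linQ_scale[OF lin] ratv.scale_sum_right scaleQ_scaleQ g_def)
  also have "\<dots> = sum g {(r, s). r + s \<le> m}"
    by (simp add: sum.Sigma) (intro sum.cong, auto)
  also have "{(r, s). r + s \<le> m} = insert (0, 0) {(r, s). 0 < r + s \<and> r + s \<le> m}" by auto
  also have "sum g \<dots> = u $ m + sum g {(r, s). 0 < r + s \<and> r + s \<le> m}"
  proof -
    have "{(r, s). 0 < r + s \<and> r + s \<le> m} \<subseteq> {..m} \<times> {..m}" by auto
    then have "finite {(r, s). 0 < r + s \<and> r + s \<le> m}" by (rule finite_subset) simp
    then show ?thesis by (simp add: g_def)
  qed
  finally show ?thesis by (simp add: bch_step_def g_def)
qed

end

section \<open>Dynkin's index set, sorted by number of blocks and degree\<close>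

definition bch_blocks :: "nat \<Rightarrow> nat \<Rightarrow> (nat \<times> nat) list set" where
  "bch_blocks n m = {p. length p = n \<and> (\<forall>(r, s)\<in>set p. r + s > 0) \<and> (\<Sum>(r, s)\<leftarrow>p. r + s) = m}"

definition bch_weight :: "(nat \<times> nat) list \<Rightarrow> rat" where
  "bch_weight p = 1 / of_nat (\<Prod>(r, s)\<leftarrow>p. fact r * fact s)"

lemma bch_blocks_0: "bch_blocks 0 m = (if m = 0 then {[]} else {})"
  by (auto simp: bch_blocks_def)

lemma bch_blocks_Suc:
  "bch_blocks (Suc n) m = (\<lambda>(a, q). a # q) `
     (SIGMA a:{(r, s). 0 < r + s \<and> r + s \<le> m}. bch_blocks n (m - (fst a + snd a)))"
  (is "_ = ?R")
proof (intro Set.set_eqI iffI)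
  fix p assume "p \<in> bch_blocks (Suc n) m"
  then obtain r s q where "p = (r, s) # q" "0 < r + s" "r + s \<le> m" "q \<in> bch_blocks n (m - (r + s))"
    by (cases p) (auto simp: bch_blocks_def)
  then show "p \<in> ?R" by (auto simp: image_iff)
qed (auto simp: bch_blocks_def)

lemma finite_bch_pairs: "finite {(r, s). 0 < r + s \<and> r + s \<le> (m :: nat)}"
  by (rule finite_subset[of _ "{..m} \<times> {..m}"]) auto

lemma finite_bch_blocks: "finite (bch_blocks n m)"
proof (induction n arbitrary: m)
  case (Suc n)
  then show ?case unfolding bch_blocks_Suc by (intro finite_imageI finite_SigmaI finite_bch_pairs) auto
qed (simp add: bch_blocks_0)

lemma sum_bch_blocks_Suc:
  "sum f (bch_blocks (Suc n) m) =
    (\<Sum>a\<in>{(r, s). 0 < r + s \<and> r + s \<le> m}. \<Sum>q\<in>bch_blocks n (m - (fst a + snd a)). f (a # q))"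
proof -
  let ?A = "{(r, s). 0 < r + s \<and> r + s \<le> m}"
  have "(\<Sum>a\<in>?A. \<Sum>q\<in>bch_blocks n (m - (fst a + snd a)). f (a # q)) =
      (\<Sum>(a, q)\<in>(SIGMA a:?A. bch_blocks n (m - (fst a + snd a))). f (a # q))"
    by (rule sum.Sigma[OF finite_bch_pairs]) (simp add: finite_bch_blocks)
  then show ?thesis
    unfolding bch_blocks_Suc by (subst sum.reindex) (auto simp: inj_on_def split_beta)
qed

lemma bch_blocks_Suc_nonempty:
  assumes "p \<in> bch_blocks (Suc n) m" shows "bch_word p X Y \<noteq> []"
  using assms by (cases p) (auto simp: bch_blocks_def bch_word_def)

lemma bch_weight_Cons: "bch_weight ((r, s) # p) = 1 / (fact r * fact s) * bch_weight p"
  by (simp add: bch_weight_def)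

lemma bch_word_Cons: "bch_word ((r, s) # p) X Y = replicate r X @ replicate s Y @ bch_word p X Y"
  by (simp add: bch_word_def)

lemma nested_bracket_Cons: "w \<noteq> [] \<Longrightarrow> nested_bracket b (z # w) = b z (nested_bracket b w)"
  by (simp add: nested_bracket_def)

lemma nested_bracket_replicate:
  "w \<noteq> [] \<Longrightarrow> nested_bracket b (replicate r z @ w) = (b z ^^ r) (nested_bracket b w)"
  by (induction r) (simp_all add: nested_bracket_Cons)

lemma nested_bracket_replicate_self:
  fixes b :: "'a::zero \<Rightarrow> 'a \<Rightarrow> 'a"
  assumes "b z z = 0" "b z 0 = 0" "n > 0"
  shows "nested_bracket b (replicate n z) = (if n = 1 then z else 0)"
proof -
  obtain k where n: "n = Suc k" using assms(3) by (cases n) auto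
  have "(b z ^^ j) z = (if j = 0 then z else 0)" for j
    by (induction j) (simp_all add: assms)
  moreover have "replicate n z = replicate k z @ [z]"
    by (simp add: n replicate_append_same)
  ultimately show ?thesis
    using nested_bracket_replicate[of "[z]" b k z] by (simp add: n nested_bracket_def[of b "[z]"])
qed

text \<open>A block standing alone vanishes as soon as its innermost bracket is [y, y] or [x, x].
  What survives, (ad x)^r y and the single letter x, are the terms of
  \<open>bch_start\<close>.\<close>

lemma nested_bracket_comm_block:
  fixes x y :: "'a::rat_algebra_1"
  assumes "r + s > 0"
  shows "nested_bracket comm (replicate r x @ replicate s y) =
    (if s = 1 then (comm x ^^ r) y else if r = 1 \<and> s = 0 then x else 0)"
proof -
  have 0: "comm z z = 0" "comm z 0 = 0" for z :: 'a by (simp_all add: comm_def)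
  have *: "nested_bracket comm (replicate n z) = (if n = 1 then z else 0)" if "n > 0" for n and z :: 'a
    by (rule nested_bracket_replicate_self) (simp_all add: 0 that)
  show ?thesis
  proof (cases "s = 0")
    case True
    then show ?thesis using *[of r x] assms by simp
  next
    case False
    have "(comm x ^^ r) 0 = 0" by (rule linQ_0[OF linQ_funpow[OF bilQD(1)[OF bilQ_comm]]])
    then show ?thesis using False *[of s y] by (simp add: nested_bracket_replicate)
  qed
qed

text \<open>\<open>bch_start\<close> collects the words of one block, and each application of
  \<open>bch_step\<close> puts a further block in front with weight 1/(r! s!). Right-nested brackets
  match the order in which the operators are applied.\<close>

lemma bch_step_power_nth:
  fixes x y :: "'a::rat_algebra_1"
  shows "(bch_step x y ^^ n) (bch_start x y) $ m =
    (\<Sum>p\<in>bch_blocks (Suc n) m. bch_weight p *\<^sub>Q nested_bracket comm (bch_word p x y))"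
proof (induction n arbitrary: m)
  case 0
  define g where "g = (\<lambda>(r, s). (1 / (fact r * fact s)) *\<^sub>Q nested_bracket comm (replicate r x @ replicate s y))"
  have "(\<Sum>p\<in>bch_blocks (Suc 0) m. bch_weight p *\<^sub>Q nested_bracket comm (bch_word p x y)) =
      (\<Sum>a\<in>{(r, s). 0 < r + s \<and> r + s \<le> m}. if m - (fst a + snd a) = 0 then g a else 0)"
    unfolding sum_bch_blocks_Suc bch_blocks_0
    by (intro sum.cong refl) (auto simp: bch_weight_def bch_word_def g_def)
  also have "\<dots> = sum g {(r, s). 0 < r + s \<and> r + s = m}"
    by (intro sum.mono_neutral_cong_right finite_bch_pairs) auto
  also have "\<dots> = bch_start x y $ m"
  proof (cases "m = 0")
    case True
    then have "{(r, s). 0 < r + s \<and> r + s = m} = {}" by auto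
    then have "sum g {(r, s). 0 < r + s \<and> r + s = m} = 0" by (simp only: sum.empty)
    with True show ?thesis by (simp only:) (simp add: bch_start_def Exp_comm_tmul_nth tmul_nth)
  next
    case False
    have "sum g {(r, s). 0 < r + s \<and> r + s = m} = (\<Sum>r\<le>m. g (r, m - r))"
      by (rule sum.reindex_bij_witness[of _ "\<lambda>r. (r, m - r)" fst]) (use False in auto)
    also have "\<dots> = (\<Sum>r\<le>m. (1 / fact r) *\<^sub>Q (comm x ^^ r) (tmul y $ (m - r)) +
        (if r = m then tmul x $ m else 0))"
    proof (intro sum.cong refl)
      fix r assume r: "r \<in> {..m}"
      have "(comm x ^^ r) 0 = 0" by (rule linQ_0[OF linQ_funpow[OF bilQD(1)[OF bilQ_comm]]])
      then show "g (r, m - r) = (1 / fact r) *\<^sub>Q (comm x ^^ r) (tmul y $ (m - r)) +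
          (if r = m then tmul x $ m else 0)"
        using r False by (auto simp: g_def nested_bracket_comm_block tmul_nth)
    qed
    also have "\<dots> = bch_start x y $ m"
      by (simp add: bch_start_def Exp_comm_tmul_nth sum.distrib)
    finally show ?thesis .
  qed
  finally show ?case by simp
next
  case (Suc n)
  note lin = linQ_funpow[OF bilQD(1)[OF bilQ_comm]]
  have "(bch_step x y ^^ Suc n) (bch_start x y) $ m = (\<Sum>(r, s)\<in>{(r, s). 0 < r + s \<and> r + s \<le> m}.
     (1 / (fact r * fact s)) *\<^sub>Q (comm x ^^ r) ((comm y ^^ s)
       (\<Sum>p\<in>bch_blocks (Suc n) (m - (r + s)). bch_weight p *\<^sub>Q nested_bracket comm (bch_word p x y))))"
    by (simp add: bch_step_nth Suc)
  also have "\<dots> = (\<Sum>p\<in>bch_blocks (Suc (Suc n)) m. bch_weight p *\<^sub>Q nested_bracket comm (bch_word p x y))"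
    unfolding sum_bch_blocks_Suc[of _ "Suc n"]
  proof (intro sum.cong refl)
    fix a assume "a \<in> {(r, s). 0 < r + s \<and> r + s \<le> m}"
    obtain r s where a: "a = (r, s)" by (cases a)
    have "bch_weight (a # p) *\<^sub>Q nested_bracket comm (bch_word (a # p) x y) =
        (1 / (fact r * fact s)) *\<^sub>Q bch_weight p *\<^sub>Q (comm x ^^ r) ((comm y ^^ s) (nested_bracket comm (bch_word p x y)))"
      if "p \<in> bch_blocks (Suc n) k" for p k
      using bch_blocks_Suc_nonempty[OF that, of x y]
      by (simp add: a bch_weight_Cons bch_word_Cons nested_bracket_replicate scaleQ_scaleQ)
    then show "(case a of (r, s) \<Rightarrow> (1 / (fact r * fact s)) *\<^sub>Q (comm x ^^ r) ((comm y ^^ s)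
         (\<Sum>p\<in>bch_blocks (Suc n) (m - (r + s)). bch_weight p *\<^sub>Q nested_bracket comm (bch_word p x y)))) =
       (\<Sum>q\<in>bch_blocks (Suc n) (m - (fst a + snd a)).
         bch_weight (a # q) *\<^sub>Q nested_bracket comm (bch_word (a # q) x y))"
      by (simp add: a linQ_sum[OF lin] linQ_scale[OF lin] ratv.scale_sum_right)
  qed
  finally show ?case .
qed

definition bch_index_deg :: "nat \<Rightarrow> (nat \<times> nat) list set" where
  "bch_index_deg m = {p \<in> bch_index. (\<Sum>(r, s)\<leftarrow>p. r + s) = m}"

lemma length_le_degree: "\<forall>(r, s)\<in>set p. r + s > 0 \<Longrightarrow> length p \<le> (\<Sum>(r, s)\<leftarrow>p. r + s)"
  by (induction p) (auto simp: Suc_le_eq)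

text \<open>Every block has positive degree, so an index of degree m has at most m blocks. The value
  n = m contributes the empty set; it is kept so that the range is that of
  \<open>opsum\<close>.\<close>

lemma bch_index_deg_eq: "bch_index_deg m = (\<Union>n\<in>{..m}. bch_blocks (Suc n) m)"
proof (intro Set.set_eqI iffI)
  fix p assume p: "p \<in> bch_index_deg m"
  then have "length p \<le> m" using length_le_degree[of p] by (auto simp: bch_index_deg_def bch_index_def)
  moreover have "p \<noteq> []" using p by (auto simp: bch_index_deg_def bch_index_def)
  ultimately show "p \<in> (\<Union>n\<in>{..m}. bch_blocks (Suc n) m)"
    using p by (intro UN_I[of "length p - 1"]) (auto simp: bch_index_deg_def bch_index_def bch_blocks_def)
qed (auto simp: bch_index_deg_def bch_index_def bch_blocks_def)

lemma finite_bch_index_deg: "finite (bch_index_deg m)"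
  by (simp add: bch_index_deg_eq finite_bch_blocks)

text \<open>Coefficients of t^m are compared in \<open>euler_bch_assoc\<close>, where E multiplies
  the left side by m. Dividing by m puts the degree into the denominator of
  \<open>bch_coeff\<close>; the coefficient (-1)^n / (n + 1) of \<open>lnq\<close> supplies the sign
  and the number of blocks. The constant term, which E forgets, is treated apart.\<close>

lemma bch_assoc_nth:
  fixes x y :: "'a::rat_algebra_1"
  shows "bch_assoc x y $ m = (\<Sum>p\<in>bch_index_deg m. bch_coeff p *\<^sub>Q nested_bracket comm (bch_word p x y))"
proof (cases "m = 0")
  case True
  have "bch_index_deg 0 = {}" by (auto simp: bch_index_deg_eq bch_blocks_def length_Suc_conv)
  then show ?thesis by (simp add: True bch_assoc_0)
next
  case False
  have "of_nat m *\<^sub>Q bch_assoc x y $ m = fps_map euler (bch_assoc x y) $ m" by (simp add: euler_def)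
  also have "\<dots> = (\<Sum>n\<le>m. (lnq $ n) *\<^sub>Q (\<Sum>p\<in>bch_blocks (Suc n) m. bch_weight p *\<^sub>Q nested_bracket comm (bch_word p x y)))"
    by (simp add: euler_bch_assoc opsum_def bch_step_power_nth del: funpow.simps)
  also have "\<dots> = (\<Sum>n\<le>m. \<Sum>p\<in>bch_blocks (Suc n) m. (of_nat m * bch_coeff p) *\<^sub>Q nested_bracket comm (bch_word p x y))"
    unfolding ratv.scale_sum_right
    by (intro sum.cong refl)
      (use False in \<open>simp add: scaleQ_scaleQ lnq_def bch_coeff_def bch_weight_def bch_blocks_def\<close>)
  also have "\<dots> = (\<Sum>p\<in>bch_index_deg m. (of_nat m * bch_coeff p) *\<^sub>Q nested_bracket comm (bch_word p x y))"
    unfolding bch_index_deg_eq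
  proof (rule sum.UNION_disjoint[symmetric])
    show "\<forall>n\<in>{..m}. finite (bch_blocks (Suc n) m)" by (simp add: finite_bch_blocks)
    show "\<forall>n\<in>{..m}. \<forall>n'\<in>{..m}. n \<noteq> n' \<longrightarrow> bch_blocks (Suc n) m \<inter> bch_blocks (Suc n') m = {}"
      by (auto simp: bch_blocks_def)
  qed simp
  finally have "of_nat m *\<^sub>Q bch_assoc x y $ m =
      of_nat m *\<^sub>Q (\<Sum>p\<in>bch_index_deg m. bch_coeff p *\<^sub>Q nested_bracket comm (bch_word p x y))"
    by (simp add: ratv.scale_sum_right scaleQ_scaleQ)
  then show ?thesis using False by simp
qed

section \<open>Evaluation of operator-valued series\<close>

text \<open>
  A series \<open>\<Sum>\<^sub>m t\<^sup>m P\<^sub>m\<close> of operators such that \<open>P\<^sub>m\<close> raises the order by \<open>m\<close> can be evaluated at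
  \<open>t = 1\<close>.
\<close>

definition filtered :: "('v::nontrivial_rat_vector fps) endo fps \<Rightarrow> bool" where
  "filtered P \<longleftrightarrow> (\<forall>m f n i. (\<forall>j<n. f $ j = 0) \<longrightarrow> i < n + m \<longrightarrow> app (P $ m) f $ i = 0)"

definition ev1 :: "('v::nontrivial_rat_vector fps) endo fps \<Rightarrow> 'v fps \<Rightarrow> 'v fps" where
  "ev1 P f = Abs_fps (\<lambda>n. \<Sum>m\<le>n. app (P $ m) f $ n)"

lemma filteredD: "filtered P \<Longrightarrow> (\<And>j. j < n \<Longrightarrow> f $ j = 0) \<Longrightarrow> i < n + m \<Longrightarrow> app (P $ m) f $ i = 0"
  unfolding filtered_def by blast

lemma filtered_causal: "filtered P \<Longrightarrow> causal (app (P $ m))"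
proof (unfold causal_def, safe)
  assume P: "filtered P"
  show "linQ (app (P $ m))" by (rule linQ_app)
  show "app (P $ m) f $ n = 0" if "\<forall>m\<le>n. f $ m = 0" for f n
    using that by (intro filteredD[OF P, of "Suc n"]) auto
qed

lemma ev1_nth:
  assumes "filtered P" "n \<le> N" shows "ev1 P f $ n = (\<Sum>m\<le>N. app (P $ m) f $ n)"
  unfolding ev1_def fps_nth_Abs_fps using assms
  by (intro sum.mono_neutral_left) (auto intro!: filteredD[of P 0])

lemma filtered_mult:
  fixes P Q :: "('v::nontrivial_rat_vector fps) endo fps"
  assumes "filtered P" "filtered Q" shows "filtered (P * Q)"
  unfolding filtered_def
proof (intro allI impI)
  fix m n i and f :: "'v fps" assume f: "\<forall>j<n. f $ j = 0" and i: "i < n + m"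
  show "app ((P * Q) $ m) f $ i = 0"
    unfolding fps_mult_nth app_sum fps_sum_nth app_op
  proof (intro sum.neutral ballI)
    fix k assume "k \<in> {0..m}"
    then show "app (P $ k) (app (Q $ (m - k)) f) $ i = 0"
      using f i by (intro filteredD[OF assms(1), of "n + (m - k)"] filteredD[OF assms(2), of n]) auto
  qed
qed

text \<open>A composition of the m-th coefficient of \<open>P\<close> with the l-th of
  \<open>Q\<close> contributes nothing in order n once m + l > n, so the square and the triangle of
  pairs (m, l) give the same sum.\<close>

lemma ev1_mult:
  assumes "filtered P" "filtered Q" shows "ev1 (P * Q) f = ev1 P (ev1 Q f)"
proof (rule fps_ext)
  fix n
  let ?g = "\<lambda>m l. app (P $ m) (app (Q $ l) f) $ n"
  have "app (P $ m) (ev1 Q f) $ n = (\<Sum>l\<le>n. ?g m l)" for m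
  proof -
    have "app (P $ m) (ev1 Q f) $ n = app (P $ m) (\<Sum>l\<le>n. app (Q $ l) f) $ n"
      by (rule causal_cong[OF filtered_causal[OF assms(1)]]) (simp add: ev1_nth[OF assms(2)] fps_sum_nth)
    then show ?thesis by (simp add: linQ_sum[OF linQ_app] fps_sum_nth)
  qed
  then have "ev1 P (ev1 Q f) $ n = (\<Sum>m\<le>n. \<Sum>l\<le>n. ?g m l)" by (simp add: ev1_def)
  also have "\<dots> = (\<Sum>k\<le>n. \<Sum>m\<le>k. ?g m (k - m))"
    by (rule sum_triangle[symmetric])
      (auto intro!: filteredD[OF assms(1), of "_::nat"] filteredD[OF assms(2), of 0])
  also have "\<dots> = ev1 (P * Q) f $ n"
    by (simp add: ev1_def fps_mult_nth app_sum fps_sum_nth app_op atLeast0AtMost)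
  finally show "ev1 (P * Q) f $ n = ev1 P (ev1 Q f) $ n" ..
qed

lemma filtered_1: "filtered 1"
  by (auto simp: filtered_def app_op)

lemma ev1_1: "ev1 1 f = f"
proof (rule fps_ext)
  fix n
  have "ev1 1 f $ n = (\<Sum>m\<in>{0}. app (1 $ m) f $ n)"
    unfolding ev1_def fps_nth_Abs_fps by (intro sum.mono_neutral_right) (auto simp: app_op)
  then show "ev1 1 f $ n = f $ n" by (simp add: app_op)
qed

lemma filtered_power:
  assumes "filtered z"
  shows "filtered (((*) z ^^ j) 1)" "ev1 (((*) z ^^ j) 1) f = (ev1 z ^^ j) f"
  by (induction j) (simp_all add: assms filtered_1 ev1_1 filtered_mult ev1_mult)

text \<open>Evaluation at t = 1 respects each power of \<open>z\<close>, and for a fixed order only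
  finitely many powers and coefficients enter, so the two sums can be exchanged.\<close>

lemma
  assumes z: "filtered z" "z $ 0 = 0"
  shows filtered_fexp: "filtered (fexp z)" and ev1_fexp: "ev1 (fexp z) f = Exp (ev1 z) f"
proof -
  show "filtered (fexp z)"
    unfolding filtered_def fexp_def opsum_def fps_nth_Abs_fps app_sum app_op fps_sum_nth fps_nth_scaleQ
  proof (intro allI impI sum.neutral ballI)
    fix m n i j and f :: "'a fps" assume "\<forall>j<n. f $ j = 0" "i < n + m"
    then have "app (((*) z ^^ j) 1 $ m) f $ i = 0"
      by (intro filteredD[OF filtered_power(1)[OF z(1)]]) auto
    then show "fps_exp 1 $ j *\<^sub>Q app (((*) z ^^ j) 1 $ m) f $ i = 0" by simp
  qed
  show "ev1 (fexp z) f = Exp (ev1 z) f"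
  proof (rule fps_ext)
    fix n
    have "ev1 (fexp z) f $ n = (\<Sum>m\<le>n. \<Sum>j\<le>n. (1 / fact j) *\<^sub>Q app ((((*) z) ^^ j) 1 $ m) f $ n)"
      unfolding ev1_def fps_nth_Abs_fps fexp_def
      by (intro sum.cong refl) (simp add: opsum_nth[OF raising_times[OF z(2)], of _ n] app_sum app_op fps_sum_nth)
    also have "\<dots> = (\<Sum>j\<le>n. \<Sum>m\<le>n. (1 / fact j) *\<^sub>Q app ((((*) z) ^^ j) 1 $ m) f $ n)"
      by (rule sum.swap)
    also have "\<dots> = (\<Sum>j\<le>n. (1 / fact j) *\<^sub>Q ev1 ((((*) z) ^^ j) 1) f $ n)"
      by (simp add: ev1_def ratv.scale_sum_right)
    also have "\<dots> = Exp (ev1 z) f $ n" by (simp add: filtered_power(2)[OF z(1)] opsum_def)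
    finally show "ev1 (fexp z) f $ n = Exp (ev1 z) f $ n" .
  qed
qed

section \<open>The Baker-Campbell-Hausdorff series in a representation\<close>

text \<open>Stated relative to a closed set \<open>S\<close> because the brackets of a module-based
  algebra are controlled on carriers only. It serves for representations, for the embedding and for
  morphisms.\<close>

lemma nested_bracket_hom:
  assumes "w \<noteq> []" "set w \<subseteq> S"
    and "\<And>x y. x \<in> S \<Longrightarrow> y \<in> S \<Longrightarrow> b x y \<in> S \<and> h (b x y) = b' (h x) (h y)"
  shows "nested_bracket b w \<in> S \<and> h (nested_bracket b w) = nested_bracket b' (map h w)"
  using assms(1,2)
proof (induction w rule: list_nonempty_induct)
  case (single x)
  then show ?case by (simp add: nested_bracket_def)
next
  case (cons x xs)
  then show ?case by (simp add: nested_bracket_Cons assms(3))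
qed

lemma map_bch_word: "map h (bch_word p X Y) = bch_word p (h X) (h Y)"
  by (induction p) (auto simp: bch_word_def)

lemma set_bch_word: "set (bch_word p X Y) \<subseteq> {X, Y}"
  by (auto simp: bch_word_def)

lemma length_bch_word: "length (bch_word p X Y) = (\<Sum>(r, s)\<leftarrow>p. r + s)"
  by (induction p) (auto simp: bch_word_def)

lemma bch_word_nonempty: "p \<in> bch_index \<Longrightarrow> bch_word p X Y \<noteq> []"
  by (cases p) (auto simp: bch_index_def bch_word_def)

text \<open>Each letter has order at least 1, and orders add under brackets. Hence only words of at
  most n letters reach the coefficient of order n, and the Baker-Campbell-Hausdorff series is a
  finite sum there.\<close>

lemma nested_bracket_order:
  assumes "bilQ b" "w \<noteq> []" "\<And>x. x \<in> set w \<Longrightarrow> x $ 0 = 0" "i < length w"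
  shows "nested_bracket (fps_bilin (\<lambda>_ _. b)) w $ i = 0"
  using assms(2-4)
proof (induction w arbitrary: i rule: list_nonempty_induct)
  case (single x)
  then show ?case by (simp add: nested_bracket_def)
next
  case (cons x xs)
  have "fps_bilin (\<lambda>_ _. b) x (nested_bracket (fps_bilin (\<lambda>_ _. b)) xs) $ i = 0"
    by (rule fps_bilin_order[of "\<lambda>_ _. b" "Suc 0" x "length xs"]) (use cons assms(1) in auto)
  then show ?case using cons by (simp add: nested_bracket_Cons)
qed

definition bch_deg :: "('l::rat_vector \<Rightarrow> 'l \<Rightarrow> 'l) \<Rightarrow> 'l fps \<Rightarrow> 'l fps \<Rightarrow> nat \<Rightarrow> 'l fps" where
  "bch_deg b X Y m =
     (\<Sum>p\<in>bch_index_deg m. bch_coeff p *\<^sub>Q nested_bracket (fps_bilin (\<lambda>_ _. b)) (bch_word p X Y))"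

text \<open>The family \<open>bch_deg\<close>, read as a series in t, at t = 1. If X and Y have no
  constant term, the degrees m > n do not reach the coefficient of order n.\<close>

definition bch_series :: "('l::rat_vector \<Rightarrow> 'l \<Rightarrow> 'l) \<Rightarrow> 'l fps \<Rightarrow> 'l fps \<Rightarrow> 'l fps" where
  "bch_series b X Y = Abs_fps (\<lambda>n. \<Sum>m\<le>n. bch_deg b X Y m $ n)"

lemma bch_deg_order:
  assumes "bilQ b" "X $ 0 = 0" "Y $ 0 = 0" "i < m"
  shows "bch_deg b X Y m $ i = 0"
proof -
  have "nested_bracket (fps_bilin (\<lambda>_ _. b)) (bch_word p X Y) $ i = 0" if "p \<in> bch_index_deg m" for p
    using that assms set_bch_word[of p X Y]
    by (intro nested_bracket_order) (auto simp: bch_index_deg_def bch_word_nonempty length_bch_word)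
  then show ?thesis by (simp add: bch_deg_def fps_sum_nth)
qed

lemma bch_series_nth:
  assumes "bilQ b" "X $ 0 = 0" "Y $ 0 = 0" "n \<le> N"
  shows "bch_series b X Y $ n = (\<Sum>m\<le>N. bch_deg b X Y m $ n)"
  unfolding bch_series_def fps_nth_Abs_fps using assms
  by (intro sum.mono_neutral_left) (auto intro!: bch_deg_order)

lemma bch_series_0:
  assumes "bilQ b" "X $ 0 = 0" "Y $ 0 = 0" shows "bch_series b X Y $ 0 = 0"
proof -
  have "bch_index_deg 0 = {}" by (auto simp: bch_index_deg_eq bch_blocks_def length_Suc_conv)
  then show ?thesis by (simp add: bch_series_def bch_deg_def)
qed

text \<open>The indices in \<open>act_lb\<close> are the degrees at which each operator acts; with
  them \<open>fps_bilin act\<close> becomes a representation of the Lie algebra of series.\<close>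

locale lie_rep =
  fixes lb :: "'l::rat_vector \<Rightarrow> 'l \<Rightarrow> 'l"
    and act :: "nat \<Rightarrow> nat \<Rightarrow> 'l \<Rightarrow> 'v::nontrivial_rat_vector \<Rightarrow> 'v"
  assumes bil_lb: "bilQ lb" and bil_act: "bilQ (act p q)"
    and act_lb: "act (p + q) r (lb x y) v = act p (q + r) x (act q r y v) - act q (p + r) y (act p r x v)"
begin

abbreviation "T \<equiv> fps_bilin act"

definition "Op X = Endo (T X)"

lemma app_Op: "app (Op X) = T X"
  unfolding Op_def by (rule app_Endo[OF bilQD(1)[OF bilQ_fps_bilin[of act, OF bil_act]]])

lemma T_lb: "T (fps_bilin (\<lambda>_ _. lb) X Y) v = T X (T Y v) - T Y (T X v)"
proof -
  have "T X (T Y v) = T (fps_bilin (\<lambda>_ _. lb) X Y) v + T Y (T X v)"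
    by (rule fps_bilin_leibniz[OF bil_act bil_act bil_act]) (simp add: act_lb)
  then show ?thesis by simp
qed

lemma Op_lb: "Op (fps_bilin (\<lambda>_ _. lb) X Y) = comm (Op X) (Op Y)"
  by (rule endo_eqI) (simp add: app_Op comm_def app_op T_lb)

text \<open>\<open>Op\<close> takes brackets to commutators of endomorphisms, so each Dynkin bracket
  becomes the same bracket of operators, where the associative formula \<open>bch_assoc_nth\<close>
  is available.\<close>

lemma Op_bch_deg: "Op (bch_deg lb X Y m) = bch_assoc (Op X) (Op Y) $ m"
proof (rule endo_eqI)
  fix v
  note lin = bilQD(2)[OF bilQ_fps_bilin[of act, OF bil_act]]
  have "Op (nested_bracket (fps_bilin (\<lambda>_ _. lb)) (bch_word p X Y)) =
      nested_bracket comm (bch_word p (Op X) (Op Y))" if "p \<in> bch_index_deg m" for p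
    using nested_bracket_hom[of "bch_word p X Y" UNIV "fps_bilin (\<lambda>_ _. lb)" Op comm] that
    by (simp add: Op_lb bch_word_nonempty bch_index_deg_def map_bch_word)
  then have *: "T (nested_bracket (fps_bilin (\<lambda>_ _. lb)) (bch_word p X Y)) v =
      app (nested_bracket comm (bch_word p (Op X) (Op Y))) v" if "p \<in> bch_index_deg m" for p
    using that by (simp flip: app_Op)
  show "app (Op (bch_deg lb X Y m)) v = app (bch_assoc (Op X) (Op Y) $ m) v"
    unfolding app_Op bch_deg_def linQ_sum[OF lin] linQ_scale[OF lin] bch_assoc_nth app_sum app_op
    by (intro sum.cong refl) (simp add: *)
qed

text \<open>For operators, e^Z = e^(t Op X) e^(t Op Y) is an identity of series in t. At t = 1 the
  factors become the exponentials of T X and T Y, and Z becomes the operator of the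
  Baker-Campbell-Hausdorff series.\<close>

theorem Exp_bch_series:
  assumes X: "X $ 0 = 0" and Y: "Y $ 0 = 0"
  shows "Exp (T (bch_series lb X Y)) f = Exp (T X) (Exp (T Y) f)"
proof -
  let ?Z = "bch_assoc (Op X) (Op Y)"
  have filt: "filtered (tmul (Op W))" if "W $ 0 = 0" for W
    using that fps_bilin_order[of act "Suc 0" W, OF bil_act]
    by (auto simp: filtered_def tmul_nth app_Op app_op)
  have ev: "ev1 (tmul (Op W)) = T W" if W: "W $ 0 = 0" for W
  proof (intro ext fps_ext)
    fix f n
    have "ev1 (tmul (Op W)) f $ n = (\<Sum>m\<in>{1} \<inter> {..n}. app (tmul (Op W) $ m) f $ n)"
      unfolding ev1_def fps_nth_Abs_fps by (intro sum.mono_neutral_right) (auto simp: tmul_nth app_op)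
    then show "ev1 (tmul (Op W)) f $ n = T W f $ n"
      using W by (cases n) (simp_all add: tmul_nth app_Op fps_bilin_nth bilQ_simps[OF bil_act])
  qed
  \<comment> \<open>The coefficient of t^m is the operator of \<open>bch_deg lb X Y m\<close>, a
    series of order at least m, and therefore raises the order by m.\<close>
  have filtZ: "filtered ?Z"
    unfolding filtered_def Op_bch_deg[symmetric] app_Op
  proof (intro allI impI)
    fix m n i and f :: "'v fps" assume "\<forall>j<n. f $ j = 0" "i < n + m"
    then show "T (bch_deg lb X Y m) f $ i = 0"
      by (intro fps_bilin_order[of act m _ n, OF bil_act] bch_deg_order[OF bil_lb X Y]) auto
  qed
  have "ev1 ?Z = T (bch_series lb X Y)"
  proof (intro ext fps_ext)
    fix f n
    note lin = bilQD(2)[OF bilQ_fps_bilin[of act, OF bil_act], of f]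
    have "T (bch_series lb X Y) f $ n = T (\<Sum>m\<le>n. bch_deg lb X Y m) f $ n"
      by (rule causal_cong[OF causal_fps_bilin(2)[OF bil_act]])
        (simp add: bch_series_nth[OF bil_lb X Y] fps_sum_nth)
    then show "ev1 ?Z f $ n = T (bch_series lb X Y) f $ n"
      unfolding ev1_def fps_nth_Abs_fps Op_bch_deg[symmetric] app_Op linQ_sum[OF lin] fps_sum_nth by simp
  qed
  then have "Exp (T (bch_series lb X Y)) f = ev1 (fexp ?Z) f"
    by (simp add: ev1_fexp[OF filtZ bch_assoc_0])
  also have "\<dots> = ev1 (fexp (tmul (Op X))) (ev1 (fexp (tmul (Op Y))) f)"
    unfolding fexp_bch_assoc
    by (rule ev1_mult) (auto intro!: filtered_fexp filt X Y simp: tmul_nth)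
  also have "\<dots> = Exp (T X) (Exp (T Y) f)"
    by (simp add: ev1_fexp filt X Y tmul_nth ev)
  finally show ?thesis .
qed

end

section \<open>Gauge actions\<close>

definition gauge_act :: "('l::rat_vector \<Rightarrow> 'v::rat_vector \<Rightarrow> 'v) \<Rightarrow> (nat \<Rightarrow> 'l \<Rightarrow> 'v) \<Rightarrow> 'l fps \<Rightarrow> 'v fps \<Rightarrow> 'v fps"
  where "gauge_act a \<delta> X v =
    Exp (fps_bilin (\<lambda>_ _. a) X) v - opsum phi (fps_bilin (\<lambda>_ _. a) X) (fps_map \<delta> X)"

lemma fps_pair_eq_iff: "fps_pair v c = fps_pair v' c' \<longleftrightarrow> v = v' \<and> c = c'"
  by (auto simp: fps_eq_iff)

text \<open>\<open>\<delta>_lb\<close> is the 1-cocycle identity with values in the module, which is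
  what turns the affine operators into a representation. It will be used for the differential from
  degree 0 to degree 1 and for the Euler derivation.\<close>

locale lie_cocycle =
  fixes lb :: "'l::rat_vector \<Rightarrow> 'l \<Rightarrow> 'l" and a :: "'l \<Rightarrow> 'v::rat_vector \<Rightarrow> 'v" and \<delta> :: "nat \<Rightarrow> 'l \<Rightarrow> 'v"
  assumes bil_lb: "bilQ lb" and bil_a: "bilQ a" and lin_\<delta>: "linQ (\<delta> n)"
    and a_lb: "a (lb x y) v = a x (a y v) - a y (a x v)"
    and \<delta>_lb: "\<delta> (p + q) (lb x y) = a x (\<delta> q y) - a y (\<delta> p x)"
begin

lemma bil_affine: "bilQ (affine (\<lambda>_ _. a) \<delta> p q)"
  by (intro bilQ_affine bil_a lin_\<delta>)

sublocale lie_rep lb "affine (\<lambda>_ _. a) \<delta>"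
  by unfold_locales
    (simp_all add: bil_lb bil_affine affine_def a_lb \<delta>_lb bilQ_simps[OF bil_a] prod_eq_iff
      ratv.scale_right_diff_distrib)

lemma Exp_T_pair:
  "X $ 0 = 0 \<Longrightarrow> Exp (T X) (fps_pair v 1) = fps_pair (gauge_act a \<delta> X v) 1"
  unfolding gauge_act_def by (rule Exp_affine[OF bil_a lin_\<delta>])

text \<open>The exponential identity of the affine representation, applied to (v, 1), has this as
  its first component.\<close>

lemma gauge_act_bch:
  assumes "X $ 0 = 0" "Y $ 0 = 0"
  shows "gauge_act a \<delta> (bch_series lb X Y) v = gauge_act a \<delta> X (gauge_act a \<delta> Y v)"
  using Exp_bch_series[OF assms, of "fps_pair v 1"] assms
  by (simp add: Exp_T_pair bch_series_0[OF bil_lb] fps_pair_eq_iff)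

lemma T_0: "T 0 f = 0"
  by (simp add: bilQ_simps[OF bilQ_fps_bilin[OF bil_affine]])

lemma Exp_T_0: "Exp (T 0) f = f"
proof (rule fps_ext)
  fix n
  have "(T 0 ^^ j) f = 0" if "j \<noteq> 0" for j using that by (cases j) (simp_all add: T_0)
  then have "Exp (T 0) f $ n = (\<Sum>j\<in>{0}. fps_exp 1 $ j *\<^sub>Q (T 0 ^^ j) f $ n)"
    unfolding opsum_def fps_nth_Abs_fps by (intro sum.mono_neutral_right) auto
  then show "Exp (T 0) f $ n = f $ n" by simp
qed

lemma gauge_act_0: "gauge_act a \<delta> 0 v = v"
  using Exp_T_pair[of 0 v] by (simp add: Exp_T_0 fps_pair_eq_iff)

end

locale lie_algebra =
  fixes lb :: "'l::rat_vector \<Rightarrow> 'l \<Rightarrow> 'l"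
  assumes bil: "bilQ lb" and antisym: "lb x y = - lb y x"
    and jacobi: "lb (lb x y) z = lb x (lb y z) - lb y (lb x z)"
begin

sublocale E: lie_cocycle lb lb euler
proof (rule lie_cocycle.intro)
  show "euler (p + q) (lb x y) = lb x (euler q y) - lb y (euler p x)" for p q x y
    using antisym[of y x]
    by (simp add: euler_def bilQ_simps[OF bil] scaleQ_add_left)
qed (simp_all add: bil linQ_euler jacobi)

text \<open>The exponential determines the operator, and the operator sends (0, 1) to (-E X, 0).
  Here X can be recovered: its constant term vanishes and every n > 0 is invertible.\<close>

lemma Exp_T_inj:
  assumes "X $ 0 = 0" "Y $ 0 = 0" "\<And>f. Exp (E.T X) f = Exp (E.T Y) f"
  shows "X = Y"
proof -
  have "E.T X = E.T Y"
    by (intro Exp_inj raising_fps_bilin E.bil_affine assms)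
  then have "fps_map euler X = fps_map euler Y"
    using affine_bilin_const(1)[where \<delta> = euler, OF bil linQ_euler, where Z = X and v = 0]
      affine_bilin_const(1)[where \<delta> = euler, OF bil linQ_euler, where Z = Y and v = 0]
      bilQ_simps(6)[OF bilQ_fps_bilin[of "\<lambda>_ _. lb"], OF bil]
    by (simp add: fps_pair_eq_iff)
  then have "euler n (X $ n) = euler n (Y $ n)" for n by (simp add: fps_eq_iff)
  then have "X $ n = Y $ n" for n using assms(1,2) by (cases "n = 0") (auto simp: euler_def)
  then show ?thesis by (simp add: fps_eq_iff)
qed

lemma bch_closed: "X $ 0 = 0 \<Longrightarrow> Y $ 0 = 0 \<Longrightarrow> bch_series lb X Y $ 0 = 0"
  by (rule bch_series_0[OF bil])

text \<open>Both sides exponentiate to the composition of the same three operators; associativity is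
  inherited from composition of maps.\<close>

lemma bch_assoc_law:
  assumes "X $ 0 = 0" "Y $ 0 = 0" "Z $ 0 = 0"
  shows "bch_series lb (bch_series lb X Y) Z = bch_series lb X (bch_series lb Y Z)"
  by (rule Exp_T_inj) (simp_all add: bch_closed assms E.Exp_bch_series)

lemma bch_0_left:
  assumes "X $ 0 = 0" shows "bch_series lb 0 X = X"
  by (rule Exp_T_inj) (simp_all add: bch_closed assms E.Exp_bch_series E.Exp_T_0)

lemma bch_uminus_left:
  assumes "X $ 0 = 0" shows "bch_series lb (- X) X = 0"
proof (rule Exp_T_inj)
  have "E.T (- X) = (\<lambda>f. - E.T X f)"
    by (simp add: fun_eq_iff bilQ_simps[OF bilQ_fps_bilin[OF E.bil_affine]])
  then show "Exp (E.T (bch_series lb (- X) X)) f = Exp (E.T 0) f" for f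
    by (simp add: assms E.Exp_bch_series E.Exp_T_0 Exp_uminus[OF raising_fps_bilin[OF E.bil_affine assms]])
qed (simp_all add: bch_closed assms)

end

definition curvature :: "('v::rat_vector \<Rightarrow> 'v \<Rightarrow> 'u::rat_vector) \<Rightarrow> ('v \<Rightarrow> 'u) \<Rightarrow> 'v fps \<Rightarrow> 'u fps" where
  "curvature b d v = fps_map (\<lambda>_. d) v + (1 / 2) *\<^sub>Q fps_bilin (\<lambda>_ _. b) v v"

text \<open>
  The pair \<open>(v, c)\<close> stands for \<open>v + c d\<close> in the extension of the algebra by its differential, in
  which twice the curvature of \<open>v\<close> is the square of \<open>v + d\<close>.
\<close>

lemma curvature_gauge_act:
  fixes a :: "'l::rat_vector \<Rightarrow> 'v::rat_vector \<Rightarrow> 'v" and a2 :: "'l \<Rightarrow> 'u::rat_vector \<Rightarrow> 'u"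
    and b :: "'v \<Rightarrow> 'v \<Rightarrow> 'u"
  assumes bil: "bilQ a" "bilQ a2" "bilQ b" and lin: "linQ d" "linQ d1"
    and sym: "\<And>v w. b v w = b w v"
    and leib: "\<And>z v w. a2 z (b v w) = b (a z v) w + b v (a z w)"
    and d_a: "\<And>z v. d1 (a z v) = b (d z) v + a2 z (d1 v)"
    and dd: "\<And>z. d1 (d z) = 0"
    and X: "X $ 0 = 0" and v: "curvature b d1 v = 0"
  shows "curvature b d1 (gauge_act a (\<lambda>_. d) X v) = 0"
proof -
  \<comment> \<open>\<open>q\<close> is the bracket of v + c d and w + c' d in the extended algebra;
    a term with c c' is absent because d has square zero.\<close>
  define q :: "nat \<Rightarrow> nat \<Rightarrow> 'v \<times> rat \<Rightarrow> 'v \<times> rat \<Rightarrow> 'u"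
    where "q i j u w = b (fst u) (fst w) + snd u *\<^sub>Q d1 (fst w) + snd w *\<^sub>Q d1 (fst u)" for i j u w
  let ?D = "fps_bilin (affine (\<lambda>_ _. a) (\<lambda>_. d)) X"
  have q: "bilQ (q i j)" for i j
    by (rule bilQI) (simp_all add: q_def linQ_add[OF lin(2)] linQ_scale[OF lin(2)] bilQ_simps[OF bil(3)]
        scaleQ_add_left scaleQ_add_right scaleQ_scaleQ scaleQ_rat_def algebra_simps)
  have q1: "fps_bilin q (fps_pair v 1) (fps_pair v 1) = 2 *\<^sub>Q curvature b d1 v" for v
  proof (rule fps_ext)
    fix n
    have 1: "(\<Sum>p\<le>n. (if p = 0 then 1 else 0) *\<^sub>Q d1 (v $ (n - p))) = d1 (v $ n)"
      by (rule sum_unit_scaleQ(2))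
    have 2: "(\<Sum>p\<le>n. (if n - p = 0 then 1 else 0) *\<^sub>Q d1 (v $ p)) = d1 (v $ n)"
      by (rule sum_unit_scaleQ(1))
    have 3: "2 *\<^sub>Q x = x + x" for x :: 'u using scaleQ_add_left[of 1 1 x] by simp
    have "fps_bilin q (fps_pair v 1) (fps_pair v 1) $ n =
        (\<Sum>p\<le>n. b (v $ p) (v $ (n - p))) + (d1 (v $ n) + d1 (v $ n))"
      using 1 2 by (simp add: fps_bilin_nth q_def sum.distrib)
    also have "\<dots> = (2 *\<^sub>Q curvature b d1 v) $ n"
      by (simp add: curvature_def fps_bilin_nth scaleQ_add_right scaleQ_scaleQ 3[of "d1 _"])
    finally show "fps_bilin q (fps_pair v 1) (fps_pair v 1) $ n = (2 *\<^sub>Q curvature b d1 v) $ n" .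
  qed
  have r2: "raising (fps_bilin (\<lambda>_ _. a2) X)" by (intro raising_fps_bilin bil X)
  have rD: "raising ?D" by (intro raising_fps_bilin bilQ_affine bil lin X)
  \<comment> \<open>The exponential preserves \<open>q\<close>, so the square of v + d, which is 0,
    is mapped to the square of the transformed element.\<close>
  have "Exp (fps_bilin (\<lambda>_ _. a2) X) (fps_bilin q (fps_pair v 1) (fps_pair v 1)) =
      fps_bilin q (Exp ?D (fps_pair v 1)) (Exp ?D (fps_pair v 1))"
  proof (rule Exp_leibniz[OF q r2 rD rD])
    show "fps_bilin (\<lambda>_ _. a2) X (fps_bilin q u w) = fps_bilin q (?D u) w + fps_bilin q u (?D w)" for u w
      by (rule fps_bilin_leibniz[OF bil(2) q q])
        (simp add: q_def affine_def bilQ_simps[OF bil(1)] bilQ_simps[OF bil(2)] bilQ_simps[OF bil(3)] leib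
          linQ_diff[OF lin(2)] linQ_scale[OF lin(2)] d_a dd sym[of _ "d _"] scaleQ_add_right ratv.scale_right_diff_distrib)
  qed
  then have "2 *\<^sub>Q curvature b d1 (gauge_act a (\<lambda>_. d) X v) = 0"
    using v Exp_affine[OF bil(1) lin(1) X, of v] linQ_0[OF causal_linQ[OF causal_opsum[OF r2]]]
    by (simp add: q1 gauge_act_def)
  then show ?thesis by simp
qed

section \<open>Embedding modules into rational vector spaces\<close>

text \<open>The module becomes a retract of the free rational space on its underlying type. As
  \<open>r\<close> is defined everywhere with values in the carrier, a structure map f extends to
  the whole type as \<open>r\<close>, then f, then \<open>e\<close>.\<close>

definition rat_embedding ::
  "(rat \<Rightarrow> 'r) \<Rightarrow> ('r, 'a) module \<Rightarrow> ('a \<Rightarrow> 'a \<Rightarrow>\<^sub>0 rat) \<Rightarrow> (('a \<Rightarrow>\<^sub>0 rat) \<Rightarrow> 'a) \<Rightarrow> bool" where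
  "rat_embedding \<rho> M e r \<longleftrightarrow>
     (\<forall>u. r u \<in> carrier M) \<and> (\<forall>x\<in>carrier M. r (e x) = x) \<and>
     (\<forall>u v. r (u + v) = r u \<oplus>\<^bsub>M\<^esub> r v) \<and> (\<forall>c u. r (c *\<^sub>Q u) = \<rho> c \<odot>\<^bsub>M\<^esub> r u) \<and>
     (\<forall>x\<in>carrier M. \<forall>y\<in>carrier M. e (x \<oplus>\<^bsub>M\<^esub> y) = e x + e y) \<and>
     (\<forall>c. \<forall>x\<in>carrier M. e (\<rho> c \<odot>\<^bsub>M\<^esub> x) = c *\<^sub>Q e x)"

text \<open>A basis of \<open>K\<close> is extended to the whole space and its vectors are sent to
  0, the new ones to themselves. The two stated properties make \<open>p\<close> a projection with
  kernel \<open>K\<close>.\<close>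

lemma exists_projection_with_kernel:
  assumes "ratv.subspace K"
  obtains p :: "'v::rat_vector \<Rightarrow> 'v"
  where "linQ p" "\<And>u. u \<in> K \<Longrightarrow> p u = 0" "\<And>u. u - p u \<in> K"
proof -
  obtain B where B: "B \<subseteq> K" "ratv.independent B" "K \<subseteq> ratv.span B"
    using ratv.maximal_independent_subset[of K] by blast
  let ?B' = "ratv.extend_basis B"
  define p where "p = ratvp.construct ?B' (\<lambda>b. if b \<in> B then 0 else b)"
  note ind = ratv.independent_extend_basis[OF B(2)]
  have lin: "linQ p" unfolding p_def by (rule ratvp.linear_construct[OF ind])
  have basis: "p b = (if b \<in> B then 0 else b)" if "b \<in> ?B'" for b
    unfolding p_def by (rule ratvp.construct_basis[OF ind that])
  have "p u = 0" if "u \<in> K" for u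
    by (rule ratvp.linear_eq_0_on_span[OF lin, of B])
      (use that B basis ratv.extend_basis_superset[OF B(2)] in auto)
  moreover have "u - p u \<in> K" for u
  proof -
    have "u \<in> ratv.span ?B'" using ratv.span_extend_basis[OF B(2)] by simp
    then show ?thesis
    proof (induction rule: ratv.span_induct_alt)
      case base
      then show ?case using linQ_0[OF lin] ratv.subspace_0[OF assms] by simp
    next
      case (step c b v)
      have "b - p b \<in> K" using step(1) B(1) basis ratv.subspace_0[OF assms] by auto
      then have "c *\<^sub>Q (b - p b) + (v - p v) \<in> K"
        using step assms by (intro ratv.subspace_add ratv.subspace_scale)
      then show ?case by (simp add: linQ_add[OF lin] linQ_scale[OF lin] ratv.scale_right_diff_distrib algebra_simps)
    qed
  qed
  ultimately show thesis using lin that by blast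
qed

context
  fixes k :: "('r, 'm) ring_scheme" and \<rho> :: "rat \<Rightarrow> 'r"
  assumes \<rho>: "\<rho> \<in> ring_hom rat_ring k" and k: "cring k"
begin

lemma rho_simps:
  "\<rho> c \<in> carrier k" "\<rho> (c + d) = \<rho> c \<oplus>\<^bsub>k\<^esub> \<rho> d" "\<rho> (c * d) = \<rho> c \<otimes>\<^bsub>k\<^esub> \<rho> d" "\<rho> 1 = \<one>\<^bsub>k\<^esub>"
  using \<rho> unfolding ring_hom_def rat_ring_def by auto

lemma rho_0: "\<rho> 0 = \<zero>\<^bsub>k\<^esub>"
proof -
  interpret cring k by (rule k)
  show ?thesis using rho_simps(1)[of 0] rho_simps(2)[of 0 0] by (simp add: add.r_cancel_one')
qed

text \<open>Evaluation of formal rational combinations maps the free space onto \<open>M\<close>,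
  with rationals acting through \<rho>. Its kernel has a complement, and the projection onto this
  complement factors through the evaluation; the factor is the embedding.\<close>

lemma exists_rat_embedding:
  fixes M :: "('r, 'a) module"
  assumes "module k M"
  shows "\<exists>e r. rat_embedding \<rho> M e r"
proof -
  interpret M: module k M by (rule assms)
  let ?l = "poly_mapping.lookup :: ('a \<Rightarrow>\<^sub>0 rat) \<Rightarrow> 'a \<Rightarrow> rat"
  \<comment> \<open>Keys outside the carrier are dropped, which makes \<open>r\<close> total with
    values in \<open>M\<close>.\<close>
  define r where "r u = (\<Oplus>\<^bsub>M\<^esub>x\<in>Poly_Mapping.keys u \<inter> carrier M. \<rho> (?l u x) \<odot>\<^bsub>M\<^esub> x)" for u
  have r_eq: "r u = (\<Oplus>\<^bsub>M\<^esub>x\<in>A. \<rho> (?l u x) \<odot>\<^bsub>M\<^esub> x)"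
    if "finite A" "Poly_Mapping.keys u \<inter> carrier M \<subseteq> A" "A \<subseteq> carrier M" for u A
    unfolding r_def using that
    by (intro M.add.finprod_mono_neutral_cong_left) (auto simp: rho_simps rho_0 in_keys_iff)
  have r_closed: "r u \<in> carrier M" for u
    unfolding r_def by (intro M.finsum_closed) (auto simp: rho_simps)
  have r_add: "r (u + v) = r u \<oplus>\<^bsub>M\<^esub> r v" for u v
  proof -
    let ?A = "(Poly_Mapping.keys u \<union> Poly_Mapping.keys v) \<inter> carrier M"
    have "r (u + v) = (\<Oplus>\<^bsub>M\<^esub>x\<in>?A. \<rho> (?l (u + v) x) \<odot>\<^bsub>M\<^esub> x)"
      using Poly_Mapping.keys_add[of u v] by (intro r_eq) auto
    also have "\<dots> = (\<Oplus>\<^bsub>M\<^esub>x\<in>?A. \<rho> (?l u x) \<odot>\<^bsub>M\<^esub> x \<oplus>\<^bsub>M\<^esub> \<rho> (?l v x) \<odot>\<^bsub>M\<^esub> x)"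
      by (intro M.finsum_cong' refl) (auto simp: rho_simps lookup_add M.smult_l_distr)
    also have "\<dots> = (\<Oplus>\<^bsub>M\<^esub>x\<in>?A. \<rho> (?l u x) \<odot>\<^bsub>M\<^esub> x) \<oplus>\<^bsub>M\<^esub> (\<Oplus>\<^bsub>M\<^esub>x\<in>?A. \<rho> (?l v x) \<odot>\<^bsub>M\<^esub> x)"
      by (intro M.finsum_addf) (auto simp: rho_simps)
    also have "(\<Oplus>\<^bsub>M\<^esub>x\<in>?A. \<rho> (?l u x) \<odot>\<^bsub>M\<^esub> x) = r u" by (rule r_eq[symmetric]) auto
    also have "(\<Oplus>\<^bsub>M\<^esub>x\<in>?A. \<rho> (?l v x) \<odot>\<^bsub>M\<^esub> x) = r v" by (rule r_eq[symmetric]) auto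
    finally show ?thesis .
  qed
  have r_scale: "r (c *\<^sub>Q u) = \<rho> c \<odot>\<^bsub>M\<^esub> r u" for c u
  proof -
    let ?A = "Poly_Mapping.keys u \<inter> carrier M"
    have "Poly_Mapping.keys (c *\<^sub>Q u) \<subseteq> Poly_Mapping.keys u" by (auto simp: in_keys_iff scaleQ_rat_def)
    then have "r (c *\<^sub>Q u) = (\<Oplus>\<^bsub>M\<^esub>x\<in>?A. \<rho> (?l (c *\<^sub>Q u) x) \<odot>\<^bsub>M\<^esub> x)"
      by (intro r_eq) auto
    also have "\<dots> = (\<Oplus>\<^bsub>M\<^esub>x\<in>?A. \<rho> c \<odot>\<^bsub>M\<^esub> (\<rho> (?l u x) \<odot>\<^bsub>M\<^esub> x))"
      by (intro M.finsum_cong' refl) (auto simp: rho_simps scaleQ_rat_def M.smult_assoc1)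
    also have "\<dots> = \<rho> c \<odot>\<^bsub>M\<^esub> r u"
      unfolding r_def by (intro M.finsum_smult_ldistr[symmetric]) (auto simp: rho_simps)
    finally show ?thesis .
  qed
  have r_single: "r (Poly_Mapping.single x 1) = x" if "x \<in> carrier M" for x
    by (subst r_eq[of "{x}"]) (use that in \<open>auto simp: rho_simps\<close>)
  have r_0: "r 0 = \<zero>\<^bsub>M\<^esub>" by (simp add: r_def)
  have r_diff: "r (u - v) = r u \<ominus>\<^bsub>M\<^esub> r v" for u v
    using r_add[of "u - v" v] r_closed by (simp add: M.minus_eq M.a_assoc M.r_neg)
  define K where "K = {u. r u = \<zero>\<^bsub>M\<^esub>}"
  have "ratv.subspace K"
    unfolding K_def by (auto intro!: ratv.subspaceI simp: r_0 r_add r_scale rho_simps)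
  then obtain p where p: "linQ p" "\<And>u. u \<in> K \<Longrightarrow> p u = 0" "\<And>u. u - p u \<in> K"
    using exists_projection_with_kernel[of K] by metis
  \<comment> \<open>\<open>p u\<close> depends on \<open>r u\<close> alone. This makes
    \<open>e\<close> additive and homogeneous although the passage from x to the basis vector
    \<open>single x 1\<close> is neither.\<close>
  have p_cong: "p u = p v" if "r u = r v" for u v
  proof -
    have "u - v \<in> K" using that r_closed[of v] by (simp add: K_def r_diff M.minus_eq M.r_neg)
    then show ?thesis using p(2)[of "u - v"] by (simp add: linQ_diff[OF p(1)])
  qed
  have r_p: "r (p u) = r u" for u
  proof -
    have "r (u - p u) = \<zero>\<^bsub>M\<^esub>" using p(3)[of u] by (simp add: K_def)
    then show ?thesis using r_add[of "u - p u" "p u"] r_closed by simp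
  qed
  define e where "e x = p (Poly_Mapping.single x 1)" for x
  have "rat_embedding \<rho> M e r"
    unfolding rat_embedding_def e_def
    by (auto simp: r_closed r_p r_single r_add r_scale linQ_add[OF p(1), symmetric] linQ_scale[OF p(1), symmetric]
        rho_simps intro!: p_cong)
  then show ?thesis by blast
qed

end

section \<open>Transfer from a differential graded Lie algebra\<close>

definition sgnv :: "int \<Rightarrow> 'v::rat_vector \<Rightarrow> 'v" where "sgnv i v = (if even i then v else - v)"

lemma lambda_dgla_simps:
  "carrier (component (lambda_dgla h) i) =
     {X. (\<forall>n. X n \<in> carrier (component h i)) \<and> X 0 = \<zero>\<^bsub>component h i\<^esub>}"
  "X \<oplus>\<^bsub>component (lambda_dgla h) i\<^esub> Y = (\<lambda>n. X n \<oplus>\<^bsub>component h i\<^esub> Y n)"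
  "c \<odot>\<^bsub>component (lambda_dgla h) i\<^esub> X = (\<lambda>n. c \<odot>\<^bsub>component h i\<^esub> X n)"
  "\<zero>\<^bsub>component (lambda_dgla h) i\<^esub> = (\<lambda>n. \<zero>\<^bsub>component h i\<^esub>)"
  "bracket (lambda_dgla h) i j X Y =
     (\<lambda>n. \<Oplus>\<^bsub>component h (i + j)\<^esub>p\<in>{..n}. bracket h i j (X p) (Y (n - p)))"
  "differential (lambda_dgla h) i X = (\<lambda>n. differential h i (X n))"
  by (auto simp: lambda_dgla_def series_dgla_def series_module_def series_map_def)

context dgla
begin

lemma bracket_closed:
  "x \<in> carrier (component h i) \<Longrightarrow> y \<in> carrier (component h j) \<Longrightarrow>
     bracket h i j x y \<in> carrier (component h (i + j))"
  using bracket_linear_right[of x i j] unfolding module_map_def by blast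

lemma differential_closed:
  "x \<in> carrier (component h i) \<Longrightarrow> differential h i x \<in> carrier (component h (i + 1))"
  using differential_linear[of i] unfolding module_map_def by blast

lemma abelian_group_component: "abelian_group (component h i)"
  using component_module module.axioms by blast

lemma abelian_group_lambda: "abelian_group (component (lambda_dgla h) i)"
proof -
  interpret M: abelian_group "component h i" by (rule abelian_group_component)
  show ?thesis
  proof (rule abelian_groupI)
    fix X assume X: "X \<in> carrier (component (lambda_dgla h) i)"
    then show "\<exists>Y\<in>carrier (component (lambda_dgla h) i).
        Y \<oplus>\<^bsub>component (lambda_dgla h) i\<^esub> X = \<zero>\<^bsub>component (lambda_dgla h) i\<^esub>"
      by (intro bexI[of _ "\<lambda>n. \<ominus>\<^bsub>component h i\<^esub> X n"]) (auto simp: lambda_dgla_simps M.l_neg)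
  qed (auto simp: lambda_dgla_simps M.a_ac)
qed

text \<open>The additive inverse is given by a description over the carrier, so it is identified
  with the coefficientwise one through uniqueness of inverses.\<close>

lemma minus_lambda:
  assumes "X \<in> carrier (component (lambda_dgla h) i)" "Y \<in> carrier (component (lambda_dgla h) i)"
  shows "X \<ominus>\<^bsub>component (lambda_dgla h) i\<^esub> Y = (\<lambda>n. X n \<ominus>\<^bsub>component h i\<^esub> Y n)"
proof -
  interpret M: abelian_group "component h i" by (rule abelian_group_component)
  interpret L: abelian_group "component (lambda_dgla h) i" by (rule abelian_group_lambda)
  have "\<ominus>\<^bsub>component (lambda_dgla h) i\<^esub> Y = (\<lambda>n. \<ominus>\<^bsub>component h i\<^esub> Y n)"
    by (rule L.minus_equality) (use assms in \<open>auto simp: lambda_dgla_simps M.l_neg\<close>)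
  then show ?thesis by (simp add: a_minus_def lambda_dgla_simps)
qed

end

locale rat_dgla = dgla k h for k :: "('r, 'm) ring_scheme" and h :: "('r, 'a) dgla" +
  fixes \<rho> :: "rat \<Rightarrow> 'r"
  assumes rho: "\<rho> \<in> ring_hom rat_ring k" and cring_k: "cring k"
begin

text \<open>Chosen as a pair, so that \<open>e i\<close> and \<open>r i\<close> belong to the same
  embedding.\<close>

definition "emb i = (SOME p. rat_embedding \<rho> (component h i) (fst p) (snd p))"

definition "e i = fst (emb i)"
definition "r i = snd (emb i)"

text \<open>Because every argument first passes through \<open>r\<close>, the identities of
  \<open>h\<close> hold for all vectors of the type, not only for images of carrier
  elements.\<close>

definition "tb i j u v = e (i + j) (bracket h i j (r i u) (r j v))"
definition "td i u = e (i + 1) (differential h i (r i u))"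

definition "embs i X = Abs_fps (\<lambda>n. e i (X n))"

lemma rat_embedding_e_r: "rat_embedding \<rho> (component h i) (e i) (r i)"
proof -
  have "\<exists>p. rat_embedding \<rho> (component h i) (fst p) (snd p)"
    using exists_rat_embedding[OF rho cring_k component_module, of i] by auto
  then show ?thesis unfolding e_def r_def emb_def by (rule someI_ex)
qed

lemma
  shows r_closed [simp]: "r i u \<in> carrier (component h i)"
    and r_e [simp]: "x \<in> carrier (component h i) \<Longrightarrow> r i (e i x) = x"
    and r_add: "r i (u + v) = r i u \<oplus>\<^bsub>component h i\<^esub> r i v"
    and r_scale: "r i (c *\<^sub>Q u) = \<rho> c \<odot>\<^bsub>component h i\<^esub> r i u"
    and e_add: "x \<in> carrier (component h i) \<Longrightarrow> y \<in> carrier (component h i) \<Longrightarrow>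
      e i (x \<oplus>\<^bsub>component h i\<^esub> y) = e i x + e i y"
    and e_scale: "x \<in> carrier (component h i) \<Longrightarrow> e i (\<rho> c \<odot>\<^bsub>component h i\<^esub> x) = c *\<^sub>Q e i x"
  using rat_embedding_e_r[of i] by (auto simp: rat_embedding_def)

lemma rho_closed [simp]: "\<rho> c \<in> carrier k"
  using rho_simps(1)[OF rho cring_k] .

lemma e_eq_iff: "x \<in> carrier (component h i) \<Longrightarrow> y \<in> carrier (component h i) \<Longrightarrow> e i x = e i y \<longleftrightarrow> x = y"
  using r_e by metis

lemma e_zero [simp]: "e i \<zero>\<^bsub>component h i\<^esub> = 0"
proof -
  interpret M: abelian_group "component h i" by (rule abelian_group_component)
  show ?thesis using e_add[OF M.zero_closed M.zero_closed] by simp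
qed

lemma e_eq_0_iff: "x \<in> carrier (component h i) \<Longrightarrow> e i x = 0 \<longleftrightarrow> x = \<zero>\<^bsub>component h i\<^esub>"
proof -
  interpret M: abelian_group "component h i" by (rule abelian_group_component)
  show "x \<in> carrier (component h i) \<Longrightarrow> ?thesis" using e_eq_iff[of x i "\<zero>\<^bsub>component h i\<^esub>"] by simp
qed

lemma e_neg: "x \<in> carrier (component h i) \<Longrightarrow> e i (\<ominus>\<^bsub>component h i\<^esub> x) = - e i x"
proof -
  interpret M: abelian_group "component h i" by (rule abelian_group_component)
  assume x: "x \<in> carrier (component h i)"
  have "e i (\<ominus>\<^bsub>component h i\<^esub> x \<oplus>\<^bsub>component h i\<^esub> x) = 0" using x by (simp add: M.l_neg)
  then show ?thesis using x by (simp add: e_add eq_neg_iff_add_eq_0)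
qed

lemma e_minus: "x \<in> carrier (component h i) \<Longrightarrow> y \<in> carrier (component h i) \<Longrightarrow>
    e i (x \<ominus>\<^bsub>component h i\<^esub> y) = e i x - e i y"
proof -
  interpret M: abelian_group "component h i" by (rule abelian_group_component)
  show "x \<in> carrier (component h i) \<Longrightarrow> y \<in> carrier (component h i) \<Longrightarrow> ?thesis"
    by (simp add: a_minus_def e_add e_neg)
qed

lemma e_signed: "x \<in> carrier (component h i) \<Longrightarrow> e i (signed (component h i) l x) = sgnv l (e i x)"
  by (simp add: signed_def sgnv_def e_neg)

lemma signed_closed: "x \<in> carrier (component h i) \<Longrightarrow> signed (component h i) l x \<in> carrier (component h i)"
proof -
  interpret M: abelian_group "component h i" by (rule abelian_group_component)
  show "x \<in> carrier (component h i) \<Longrightarrow> ?thesis" by (simp add: signed_def)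
qed

lemma e_finsum:
  assumes "\<And>x. x \<in> A \<Longrightarrow> f x \<in> carrier (component h i)"
  shows "e i (\<Oplus>\<^bsub>component h i\<^esub>x\<in>A. f x) = (\<Sum>x\<in>A. e i (f x))"
proof -
  interpret M: abelian_group "component h i" by (rule abelian_group_component)
  show ?thesis
    using assms
    by (induction A rule: infinite_finite_induct) (auto simp: e_add Pi_def)
qed

lemma e_bracket:
  "x \<in> carrier (component h i) \<Longrightarrow> y \<in> carrier (component h j) \<Longrightarrow> e (i + j) (bracket h i j x y) = tb i j (e i x) (e j y)"
  by (simp add: tb_def)

lemma e_differential: "x \<in> carrier (component h i) \<Longrightarrow> e (i + 1) (differential h i x) = td i (e i x)"
  by (simp add: td_def)

lemma bilQ_tb: "bilQ (tb i j)"
proof (rule bilQI)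
  show "tb i j (u + u') v = tb i j u v + tb i j u' v" for u u' v
    using bracket_linear_left[of "r j v" j i] unfolding module_map_def
    by (simp add: tb_def r_add e_add[symmetric] bracket_closed)
  show "tb i j u (v + v') = tb i j u v + tb i j u v'" for u v v'
    using bracket_linear_right[of "r i u" i j] unfolding module_map_def
    by (simp add: tb_def r_add e_add[symmetric] bracket_closed)
  show "tb i j (c *\<^sub>Q u) v = c *\<^sub>Q tb i j u v" for c u v
    using bracket_linear_left[of "r j v" j i] unfolding module_map_def
    by (simp add: tb_def r_scale e_scale[symmetric] bracket_closed)
  show "tb i j u (c *\<^sub>Q v) = c *\<^sub>Q tb i j u v" for c u v
    using bracket_linear_right[of "r i u" i j] unfolding module_map_def
    by (simp add: tb_def r_scale e_scale[symmetric] bracket_closed)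
qed

lemma linQ_td: "linQ (td i)"
proof (rule linQI)
  show "td i (u + v) = td i u + td i v" for u v
    using differential_linear[of i] unfolding module_map_def
    by (simp add: td_def r_add e_add[symmetric] differential_closed)
  show "td i (c *\<^sub>Q u) = c *\<^sub>Q td i u" for c u
    using differential_linear[of i] unfolding module_map_def
    by (simp add: td_def r_scale e_scale[symmetric] differential_closed)
qed

lemma r_tb: "r (i + j) (tb i j u v) = bracket h i j (r i u) (r j v)"
  by (simp add: tb_def bracket_closed)

lemma r_td: "r (i + 1) (td i u) = differential h i (r i u)"
  by (simp add: td_def differential_closed)

lemma tb_antisym: "tb i j u v = sgnv (i * j + 1) (tb j i v u)"
proof -
  have "bracket h j i (r j v) (r i u) \<in> carrier (component h (i + j))"
    using bracket_closed[of "r j v" j "r i u" i] by (simp add: add.commute)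
  then have "e (i + j) (signed (component h (i + j)) (i * j + 1) (bracket h j i (r j v) (r i u))) =
      sgnv (i * j + 1) (e (i + j) (bracket h j i (r j v) (r i u)))"
    by (rule e_signed)
  then show ?thesis
    using bracket_antisymmetric[of "r i u" i "r j v" j] by (simp add: tb_def add.commute[of j i])
qed

lemma tb_jacobi:
  "tb i (j + l) x (tb j l y z) = tb (i + j) l (tb i j x y) z + sgnv (i * j) (tb j (i + l) y (tb i l x z))"
proof -
  let ?M = "component h (i + j + l)"
  let ?a = "bracket h (i + j) l (bracket h i j (r i x) (r j y)) (r l z)"
  let ?b = "bracket h j (i + l) (r j y) (bracket h i l (r i x) (r l z))"
  have a: "?a \<in> carrier ?M" by (simp add: bracket_closed)
  have b: "?b \<in> carrier ?M"
    using bracket_closed[of "r j y" j "bracket h i l (r i x) (r l z)" "i + l"]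
    by (simp add: bracket_closed algebra_simps)
  have "e (i + j + l) (bracket h i (j + l) (r i x) (bracket h j l (r j y) (r l z))) =
      e (i + j + l) ?a + sgnv (i * j) (e (i + j + l) ?b)"
    by (subst bracket_jacobi[OF r_closed r_closed r_closed]) (simp add: e_add a b signed_closed e_signed)
  \<comment> \<open>The three double brackets lie in the same degree written in different ways; the
    components can be compared only after rewriting it to one form.\<close>
  moreover have eqs: "i + (j + l) = i + j + l" "j + (i + l) = i + j + l" by simp_all
  ultimately show ?thesis
    unfolding tb_def[of i "j + l"] tb_def[of "i + j" l] tb_def[of j "i + l"] r_tb eqs by metis
qed

lemma td_tb:
  "td (i + j) (tb i j x y) = tb (i + 1) j (td i x) y + sgnv i (tb i (j + 1) x (td j y))"
proof -
  let ?M = "component h (i + j + 1)"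
  let ?a = "bracket h (i + 1) j (differential h i (r i x)) (r j y)"
  let ?b = "bracket h i (j + 1) (r i x) (differential h j (r j y))"
  have a: "?a \<in> carrier ?M"
    using bracket_closed[OF differential_closed[OF r_closed] r_closed, of i j x y]
    by (simp add: algebra_simps)
  have b: "?b \<in> carrier ?M"
    using bracket_closed[OF r_closed differential_closed[OF r_closed], of i j x y]
    by (simp add: algebra_simps)
  have "e (i + j + 1) (differential h (i + j) (bracket h i j (r i x) (r j y))) =
      e (i + j + 1) ?a + sgnv i (e (i + j + 1) ?b)"
    by (subst differential_bracket[OF r_closed r_closed]) (simp add: e_add a b signed_closed e_signed)
  moreover have eqs: "i + 1 + j = i + j + 1" "i + (j + 1) = i + j + 1" by simp_all
  ultimately show ?thesis
    unfolding td_def[of "i + j"] tb_def[of "i + 1" j] tb_def[of i "j + 1"] r_td r_tb eqs by metis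
qed

lemma td_td: "td (i + 1) (td i x) = 0"
  unfolding td_def[of "i + 1"] r_td by (subst differential_square[OF r_closed]) (use e_zero[of "i + 2"] in \<open>simp add: add.commute\<close>)

sublocale Lie: lie_algebra "tb 0 0"
proof (rule lie_algebra.intro)
  show "tb 0 0 x y = - tb 0 0 y x" for x y using tb_antisym[of 0 0 x y] by (simp add: sgnv_def)
  show "tb 0 0 (tb 0 0 x y) z = tb 0 0 x (tb 0 0 y z) - tb 0 0 y (tb 0 0 x z)" for x y z
    using tb_jacobi[of 0 0 0 x y z] by (simp add: sgnv_def)
qed (rule bilQ_tb)

text \<open>The cocycle identity is the Leibniz rule in degree 0 combined with [dx, y] =
  -[y, dx].\<close>

sublocale D: lie_cocycle "tb 0 0" "tb 0 1" "\<lambda>_. td 0"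
proof (rule lie_cocycle.intro)
  show "tb 0 1 (tb 0 0 x y) v = tb 0 1 x (tb 0 1 y v) - tb 0 1 y (tb 0 1 x v)" for x y v
    using tb_jacobi[of 0 0 1 x y v] by (simp add: sgnv_def)
  show "td 0 (tb 0 0 x y) = tb 0 1 x (td 0 y) - tb 0 1 y (td 0 x)" for x y
    using td_tb[of 0 0 x y] tb_antisym[of 1 0 "td 0 x" y] by (simp add: sgnv_def)
qed (rule bilQ_tb linQ_td)+

text \<open>Antisymmetry becomes symmetry for two elements of degree 1, and the signs in the Jacobi
  identity and in the Leibniz rule disappear when the acting element has degree 0.\<close>

lemma curvature_gauge:
  assumes "X $ 0 = 0" "curvature (tb 1 1) (td 1) v = 0"
  shows "curvature (tb 1 1) (td 1) (gauge_act (tb 0 1) (\<lambda>_. td 0) X v) = 0"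
proof (rule curvature_gauge_act[where ?a2.0 = "tb 0 2"])
  show "tb 1 1 v w = tb 1 1 w v" for v w using tb_antisym[of 1 1 v w] by (simp add: sgnv_def)
  show "tb 0 2 z (tb 1 1 v w) = tb 1 1 (tb 0 1 z v) w + tb 1 1 v (tb 0 1 z w)" for z v w
    using tb_jacobi[of 0 1 1 z v w] by (simp add: sgnv_def)
  show "td 1 (tb 0 1 z v) = tb 1 1 (td 0 z) v + tb 0 2 z (td 1 v)" for z v
    using td_tb[of 0 1 z v] by (simp add: sgnv_def)
  show "td 1 (td 0 z) = 0" for z using td_td[of 0 z] by simp
qed (use assms bilQ_tb linQ_td in auto)

end

section \<open>Series over a differential graded Lie algebra, computed in the rational
  spaces\<close>

context rat_dgla
begin

abbreviation "ser i \<equiv> {X. \<forall>n. X n \<in> carrier (component h i)}"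

lemma embs_nth [simp]: "embs i X $ n = e i (X n)"
  by (simp add: embs_def)

lemma embs_inj: "X \<in> ser i \<Longrightarrow> Y \<in> ser i \<Longrightarrow> embs i X = embs i Y \<Longrightarrow> X = Y"
  by (auto simp: fps_eq_iff e_eq_iff)

lemma lambda_ser: "X \<in> carrier (component (lambda_dgla h) i) \<Longrightarrow> X \<in> ser i"
  by (simp add: lambda_dgla_simps)

lemma embs_0: "X \<in> carrier (component (lambda_dgla h) i) \<Longrightarrow> embs i X $ 0 = 0"
  by (simp add: lambda_dgla_simps)

lemma e_constant_term: "X \<in> carrier (component (lambda_dgla h) i) \<Longrightarrow> e i (X 0) = 0"
  using embs_0 by simp

lemma lambda_iff: "X \<in> carrier (component (lambda_dgla h) i) \<longleftrightarrow> X \<in> ser i \<and> embs i X $ 0 = 0"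
  by (auto simp: lambda_dgla_simps e_eq_0_iff)

lemma zero_lambda: "\<zero>\<^bsub>component (lambda_dgla h) i\<^esub> \<in> carrier (component (lambda_dgla h) i)"
  "embs i \<zero>\<^bsub>component (lambda_dgla h) i\<^esub> = 0"
  using abelian_group.axioms(1)[OF abelian_group_lambda[of i]]
  by (auto simp: abelian_monoid.zero_closed) (simp add: fps_eq_iff lambda_dgla_simps)

lemma finsum_closed_component:
  "(\<And>x. x \<in> A \<Longrightarrow> f x \<in> carrier (component h i)) \<Longrightarrow> (\<Oplus>\<^bsub>component h i\<^esub>x\<in>A. f x) \<in> carrier (component h i)"
proof -
  interpret M: abelian_group "component h i" by (rule abelian_group_component)
  show "(\<And>x. x \<in> A \<Longrightarrow> f x \<in> carrier (component h i)) \<Longrightarrow> ?thesis"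
    by (rule M.finsum_closed) auto
qed

lemma bracket_lambda:
  assumes "X \<in> ser i" "Y \<in> ser j"
  shows "bracket (lambda_dgla h) i j X Y \<in> ser (i + j)"
    and "embs (i + j) (bracket (lambda_dgla h) i j X Y) = fps_bilin (\<lambda>_ _. tb i j) (embs i X) (embs j Y)"
proof -
  have *: "bracket h i j (X p) (Y q) \<in> carrier (component h (i + j))" for p q
    using assms by (simp add: bracket_closed)
  show "bracket (lambda_dgla h) i j X Y \<in> ser (i + j)"
    by (simp add: lambda_dgla_simps finsum_closed_component *)
  show "embs (i + j) (bracket (lambda_dgla h) i j X Y) = fps_bilin (\<lambda>_ _. tb i j) (embs i X) (embs j Y)"
    by (rule fps_ext) (use assms in \<open>simp add: lambda_dgla_simps e_finsum * fps_bilin_nth e_bracket\<close>)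
qed

lemma smult_closed: "x \<in> carrier (component h i) \<Longrightarrow> \<rho> c \<odot>\<^bsub>component h i\<^esub> x \<in> carrier (component h i)"
  using module.smult_closed[OF component_module] by simp

text \<open>\<open>series_sum\<close> ranges over the exact support in order n, which is awkward to
  handle. Terms outside \<open>A\<close> vanish, so the support is replaced by this finite
  set.\<close>

lemma e_series_sum:
  assumes "finite A" "A \<subseteq> I" "\<And>i. i \<in> I \<Longrightarrow> f i n \<in> carrier (component h l)"
    and "\<And>i. i \<in> I - A \<Longrightarrow> e l (f i n) = 0"
  shows "series_sum (component h l) I f n \<in> carrier (component h l)"
    and "e l (series_sum (component h l) I f n) = (\<Sum>i\<in>A. e l (f i n))"
proof -
  let ?S = "{i \<in> I. f i n \<noteq> \<zero>\<^bsub>component h l\<^esub>}"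
  show "series_sum (component h l) I f n \<in> carrier (component h l)"
    unfolding series_sum_def by (rule finsum_closed_component) (simp add: assms(3))
  have S: "?S \<subseteq> A" using assms(3,4) e_eq_0_iff by blast
  have "e l (series_sum (component h l) I f n) = (\<Sum>i\<in>?S. e l (f i n))"
    unfolding series_sum_def by (rule e_finsum) (simp add: assms(3))
  also have "\<dots> = (\<Sum>i\<in>A. e l (f i n))"
    using S assms(1,2) by (intro sum.mono_neutral_left) auto
  finally show "e l (series_sum (component h l) I f n) = (\<Sum>i\<in>A. e l (f i n))" .
qed

text \<open>In the applications \<open>A\<close> depends on n alone. This matters for morphisms,
  which can annihilate coefficients and thereby change the support.\<close>

lemma series_sum_eq_finsum:
  assumes "finite A" "A \<subseteq> I" "\<And>i. i \<in> I \<Longrightarrow> f i n \<in> carrier (component h l)"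
    and "\<And>i. i \<in> I - A \<Longrightarrow> e l (f i n) = 0"
  shows "series_sum (component h l) I f n = (\<Oplus>\<^bsub>component h l\<^esub>i\<in>A. f i n)"
proof -
  have A: "f i n \<in> carrier (component h l)" if "i \<in> A" for i using that assms(2,3) by blast
  show ?thesis
    using e_series_sum[where f = f and n = n, OF assms] e_finsum[of A "\<lambda>i. f i n", OF A]
      finsum_closed_component[of A "\<lambda>i. f i n", OF A]
    by (simp add: e_eq_iff[symmetric])
qed

lemma nested_bracket_lambda:
  assumes "p \<in> bch_index" "X \<in> ser 0" "Y \<in> ser 0"
  shows "nested_bracket (bracket (lambda_dgla h) 0 0) (bch_word p X Y) \<in> ser 0"
    and "embs 0 (nested_bracket (bracket (lambda_dgla h) 0 0) (bch_word p X Y)) =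
      nested_bracket (fps_bilin (\<lambda>_ _. tb 0 0)) (bch_word p (embs 0 X) (embs 0 Y))"
proof -
  have "set (bch_word p X Y) \<subseteq> ser 0" using set_bch_word[of p X Y] assms by auto
  then have "nested_bracket (bracket (lambda_dgla h) 0 0) (bch_word p X Y) \<in> ser 0 \<and>
      embs 0 (nested_bracket (bracket (lambda_dgla h) 0 0) (bch_word p X Y)) =
      nested_bracket (fps_bilin (\<lambda>_ _. tb 0 0)) (map (embs 0) (bch_word p X Y))"
    using bracket_lambda[of _ 0 _ 0]
    by (intro nested_bracket_hom[OF bch_word_nonempty[OF assms(1)]]) auto
  then show "nested_bracket (bracket (lambda_dgla h) 0 0) (bch_word p X Y) \<in> ser 0"
    "embs 0 (nested_bracket (bracket (lambda_dgla h) 0 0) (bch_word p X Y)) =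
      nested_bracket (fps_bilin (\<lambda>_ _. tb 0 0)) (bch_word p (embs 0 X) (embs 0 Y))"
    by (simp_all add: map_bch_word)
qed

lemma
  assumes X: "X \<in> carrier (component (lambda_dgla h) 0)" and Y: "Y \<in> carrier (component (lambda_dgla h) 0)"
  shows bch_closed: "bch \<rho> h X Y \<in> carrier (component (lambda_dgla h) 0)"
    and bch_nth: "bch \<rho> h X Y n = (\<Oplus>\<^bsub>component h 0\<^esub>p\<in>(\<Union>m\<in>{..n}. bch_index_deg m).
      \<rho> (bch_coeff p) \<odot>\<^bsub>component h 0\<^esub> nested_bracket (bracket (lambda_dgla h) 0 0) (bch_word p X Y) n)"
    and bch_transfer: "embs 0 (bch \<rho> h X Y) = bch_series (tb 0 0) (embs 0 X) (embs 0 Y)"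
proof -
  let ?N = "\<lambda>p. nested_bracket (bracket (lambda_dgla h) 0 0) (bch_word p X Y)"
  let ?f = "\<lambda>p. \<rho> (bch_coeff p) \<odot>\<^bsub>component (lambda_dgla h) 0\<^esub> ?N p"
  note N = nested_bracket_lambda[OF _ lambda_ser[OF X] lambda_ser[OF Y]]
  have f: "?f p n \<in> carrier (component h 0)" if "p \<in> bch_index" for p n
    using N(1)[OF that] by (simp add: lambda_dgla_simps smult_closed)
  have ef: "e 0 (?f p n) = bch_coeff p *\<^sub>Q
      nested_bracket (fps_bilin (\<lambda>_ _. tb 0 0)) (bch_word p (embs 0 X) (embs 0 Y)) $ n"
    if "p \<in> bch_index" for p n
    using N(1)[OF that] by (simp add: N(2)[OF that, symmetric] lambda_dgla_simps e_scale)
  \<comment> \<open>These are the indices whose words have more than n letters, hence order above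
    n.\<close>
  have z: "e 0 (?f p n) = 0" if "p \<in> bch_index - (\<Union>m\<in>{..n}. bch_index_deg m)" for p n
  proof -
    have "set (bch_word p (embs 0 X) (embs 0 Y)) \<subseteq> {embs 0 X, embs 0 Y}" by (rule set_bch_word)
    then have "nested_bracket (fps_bilin (\<lambda>_ _. tb 0 0)) (bch_word p (embs 0 X) (embs 0 Y)) $ n = 0"
      using that embs_0[OF X] embs_0[OF Y]
      by (intro nested_bracket_order bilQ_tb) (auto simp: bch_word_nonempty length_bch_word bch_index_deg_def not_le)
    then show ?thesis using that by (simp add: ef)
  qed
  have sub: "(\<Union>m\<in>{..n}. bch_index_deg m) \<subseteq> bch_index" for n by (auto simp: bch_index_deg_def)
  have fin: "finite (\<Union>m\<in>{..n}. bch_index_deg m)" for n by (simp add: finite_bch_index_deg)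
  have closed: "bch \<rho> h X Y n \<in> carrier (component h 0)" for n
    unfolding bch_def by (rule e_series_sum(1)[OF fin sub f z])
  show "bch \<rho> h X Y n = (\<Oplus>\<^bsub>component h 0\<^esub>p\<in>(\<Union>m\<in>{..n}. bch_index_deg m).
      \<rho> (bch_coeff p) \<odot>\<^bsub>component h 0\<^esub> nested_bracket (bracket (lambda_dgla h) 0 0) (bch_word p X Y) n)"
    unfolding bch_def by (subst series_sum_eq_finsum[OF fin[of n] sub f z]) (simp_all add: lambda_dgla_simps)
  show eq: "embs 0 (bch \<rho> h X Y) = bch_series (tb 0 0) (embs 0 X) (embs 0 Y)"
  proof (rule fps_ext)
    fix n
    have "e 0 (bch \<rho> h X Y n) = (\<Sum>p\<in>(\<Union>m\<in>{..n}. bch_index_deg m). e 0 (?f p n))"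
      unfolding bch_def by (rule e_series_sum(2)[OF fin sub f z])
    also have "\<dots> = (\<Sum>m\<le>n. \<Sum>p\<in>bch_index_deg m. e 0 (?f p n))"
    proof (rule sum.UNION_disjoint)
      show "\<forall>m\<in>{..n}. finite (bch_index_deg m)" by (simp add: finite_bch_index_deg)
      show "\<forall>m\<in>{..n}. \<forall>m'\<in>{..n}. m \<noteq> m' \<longrightarrow> bch_index_deg m \<inter> bch_index_deg m' = {}"
        by (auto simp: bch_index_deg_def)
    qed simp
    also have "\<dots> = bch_series (tb 0 0) (embs 0 X) (embs 0 Y) $ n"
      unfolding bch_series_def fps_nth_Abs_fps bch_deg_def fps_sum_nth fps_nth_scaleQ
      by (intro sum.cong refl ef) (simp add: bch_index_deg_def)
    finally show "embs 0 (bch \<rho> h X Y) $ n = bch_series (tb 0 0) (embs 0 X) (embs 0 Y) $ n" by simp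
  qed
  show "bch \<rho> h X Y \<in> carrier (component (lambda_dgla h) 0)"
    unfolding lambda_iff eq using closed X Y by (auto simp: e_constant_term intro!: Lie.bch_closed)
qed

lemma gauge_group_simps [simp]:
  "carrier (gauge_group \<rho> h) = carrier (component (lambda_dgla h) 0)"
  "x \<otimes>\<^bsub>gauge_group \<rho> h\<^esub> y = bch \<rho> h x y"
  "\<one>\<^bsub>gauge_group \<rho> h\<^esub> = \<zero>\<^bsub>component (lambda_dgla h) 0\<^esub>"
  by (simp_all add: gauge_group_def)

text \<open>\<open>embs 0\<close> is injective on series and takes \<open>bch\<close> to
  \<open>bch_series\<close>, so the laws come from the Lie algebra on the whole type. The inverse of
  X is -X.\<close>

theorem group_gauge_group: "group (gauge_group \<rho> h)"
proof -
  note inj = embs_inj[OF lambda_ser lambda_ser, where i = 0]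
  show ?thesis
  proof (rule groupI; unfold gauge_group_simps)
    fix X Y assume X: "X \<in> carrier (component (lambda_dgla h) 0)" and Y: "Y \<in> carrier (component (lambda_dgla h) 0)"
    show "bch \<rho> h X Y \<in> carrier (component (lambda_dgla h) 0)" by (rule bch_closed[OF X Y])
    fix Z assume Z: "Z \<in> carrier (component (lambda_dgla h) 0)"
    show "bch \<rho> h (bch \<rho> h X Y) Z = bch \<rho> h X (bch \<rho> h Y Z)"
      by (rule inj) (simp_all add: bch_closed bch_transfer X Y Z Lie.bch_assoc_law e_constant_term)
  next
    fix X assume X: "X \<in> carrier (component (lambda_dgla h) 0)"
    show "bch \<rho> h \<zero>\<^bsub>component (lambda_dgla h) 0\<^esub> X = X"
      by (rule inj) (simp_all add: bch_closed bch_transfer X zero_lambda Lie.bch_0_left e_constant_term)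
    let ?Y = "\<lambda>n. \<ominus>\<^bsub>component h 0\<^esub> X n"
    interpret M: abelian_group "component h 0" by (rule abelian_group_component)
    have Y: "?Y \<in> carrier (component (lambda_dgla h) 0)" using X by (simp add: lambda_dgla_simps)
    moreover have "embs 0 ?Y = - embs 0 X" using lambda_ser[OF X] by (simp add: fps_eq_iff e_neg)
    ultimately have "bch \<rho> h ?Y X = \<zero>\<^bsub>component (lambda_dgla h) 0\<^esub>"
      by (intro inj) (simp_all add: bch_closed bch_transfer X zero_lambda Lie.bch_uminus_left e_constant_term)
    then show "\<exists>Y\<in>carrier (component (lambda_dgla h) 0). bch \<rho> h Y X = \<zero>\<^bsub>component (lambda_dgla h) 0\<^esub>"
      using Y by blast
  qed (simp add: zero_lambda)
qed

lemma ad_power_lambda: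
  assumes "\<gamma> \<in> ser 0" "\<xi> \<in> ser 1"
  shows "(bracket (lambda_dgla h) 0 1 \<gamma> ^^ j) \<xi> \<in> ser 1"
    and "embs 1 ((bracket (lambda_dgla h) 0 1 \<gamma> ^^ j) \<xi>) = (fps_bilin (\<lambda>_ _. tb 0 1) (embs 0 \<gamma>) ^^ j) (embs 1 \<xi>)"
proof (induction j)
  case (Suc j)
  { case 1 then show ?case using bracket_lambda(1)[OF assms(1) Suc(1)] by simp }
  { case 2 then show ?case using bracket_lambda(2)[OF assms(1) Suc(1)] Suc(2) by simp }
qed (use assms in auto)

text \<open>Both series of the gauge action have this form: 1/j! belongs to \<open>fps_exp 1\<close>
  and 1/(1+j)! to \<open>phi\<close>. The last conclusion, a sum inside the module, is meant for
  morphisms.\<close>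

lemma series_sum_ad:
  assumes \<gamma>: "\<gamma> \<in> carrier (component (lambda_dgla h) 0)" and \<xi>: "\<xi> \<in> ser 1"
    and a: "\<And>j. c j = a $ j"
  shows "series_sum (component h 1) UNIV
      (\<lambda>j. \<rho> (c j) \<odot>\<^bsub>component (lambda_dgla h) 1\<^esub> (bracket (lambda_dgla h) 0 1 \<gamma> ^^ j) \<xi>) \<in> ser 1"
    and "embs 1 (series_sum (component h 1) UNIV
      (\<lambda>j. \<rho> (c j) \<odot>\<^bsub>component (lambda_dgla h) 1\<^esub> (bracket (lambda_dgla h) 0 1 \<gamma> ^^ j) \<xi>)) =
      opsum a (fps_bilin (\<lambda>_ _. tb 0 1) (embs 0 \<gamma>)) (embs 1 \<xi>)"
    and "series_sum (component h 1) UNIV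
      (\<lambda>j. \<rho> (c j) \<odot>\<^bsub>component (lambda_dgla h) 1\<^esub> (bracket (lambda_dgla h) 0 1 \<gamma> ^^ j) \<xi>) n =
      (\<Oplus>\<^bsub>component h 1\<^esub>j\<in>{..n}. \<rho> (c j) \<odot>\<^bsub>component h 1\<^esub> (bracket (lambda_dgla h) 0 1 \<gamma> ^^ j) \<xi> n)"
proof -
  let ?f = "\<lambda>j. \<rho> (c j) \<odot>\<^bsub>component (lambda_dgla h) 1\<^esub> (bracket (lambda_dgla h) 0 1 \<gamma> ^^ j) \<xi>"
  let ?T = "fps_bilin (\<lambda>_ _. tb 0 1) (embs 0 \<gamma>)"
  note P = ad_power_lambda[OF lambda_ser[OF \<gamma>] \<xi>]
  have r: "raising ?T" by (rule raising_fps_bilin[OF bilQ_tb embs_0[OF \<gamma>]])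
  have f: "?f j n \<in> carrier (component h 1)" for j n
    using P(1)[of j] by (simp add: lambda_dgla_simps smult_closed)
  have ef: "e 1 (?f j n) = a $ j *\<^sub>Q (?T ^^ j) (embs 1 \<xi>) $ n" for j n
    using P(1)[of j] by (simp add: P(2)[symmetric] lambda_dgla_simps e_scale a)
  have z: "e 1 (?f j n) = 0" if "j \<in> UNIV - {..n}" for j n
    using that by (simp add: ef raising_funpow_0[OF r])
  show "series_sum (component h 1) UNIV ?f \<in> ser 1"
    using e_series_sum(1)[where A = "{..n}" and I = UNIV and f = ?f and n = n for n, OF _ _ f z] by simp
  show "series_sum (component h 1) UNIV ?f n =
      (\<Oplus>\<^bsub>component h 1\<^esub>j\<in>{..n}. \<rho> (c j) \<odot>\<^bsub>component h 1\<^esub> (bracket (lambda_dgla h) 0 1 \<gamma> ^^ j) \<xi> n)"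
    by (subst series_sum_eq_finsum[where A = "{..n}", OF _ _ f z]) (simp_all add: lambda_dgla_simps)
  show "embs 1 (series_sum (component h 1) UNIV ?f) = opsum a ?T (embs 1 \<xi>)"
    using e_series_sum(2)[where A = "{..n}" and I = UNIV and f = ?f and n = n for n, OF _ _ f z]
    by (intro fps_ext) (simp add: ef opsum_def)
qed

lemma gauge_action_transfer:
  assumes \<gamma>: "\<gamma> \<in> carrier (component (lambda_dgla h) 0)" and \<xi>: "\<xi> \<in> carrier (component (lambda_dgla h) 1)"
  shows "gauge_action \<rho> h \<gamma> \<xi> \<in> carrier (component (lambda_dgla h) 1)"
    and "gauge_action \<rho> h \<gamma> \<xi> n =
      (\<Oplus>\<^bsub>component h 1\<^esub>j\<in>{..n}. \<rho> (1 / fact j) \<odot>\<^bsub>component h 1\<^esub> (bracket (lambda_dgla h) 0 1 \<gamma> ^^ j) \<xi> n)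
      \<ominus>\<^bsub>component h 1\<^esub> (\<Oplus>\<^bsub>component h 1\<^esub>j\<in>{..n}. \<rho> (1 / fact (1 + j)) \<odot>\<^bsub>component h 1\<^esub>
        (bracket (lambda_dgla h) 0 1 \<gamma> ^^ j) (differential (lambda_dgla h) 0 \<gamma>) n)"
    and "embs 1 (gauge_action \<rho> h \<gamma> \<xi>) = gauge_act (tb 0 1) (\<lambda>_. td 0) (embs 0 \<gamma>) (embs 1 \<xi>)"
proof -
  let ?T = "fps_bilin (\<lambda>_ _. tb 0 1) (embs 0 \<gamma>)"
  let ?d = "differential (lambda_dgla h) 0 \<gamma>"
  let ?A = "series_sum (component h 1) UNIV
    (\<lambda>j. \<rho> (1 / fact j) \<odot>\<^bsub>component (lambda_dgla h) 1\<^esub> (bracket (lambda_dgla h) 0 1 \<gamma> ^^ j) \<xi>)"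
  let ?B = "series_sum (component h 1) UNIV
    (\<lambda>j. \<rho> (1 / fact (1 + j)) \<odot>\<^bsub>component (lambda_dgla h) 1\<^esub> (bracket (lambda_dgla h) 0 1 \<gamma> ^^ j) ?d)"
  have d: "?d \<in> ser 1" using lambda_ser[OF \<gamma>] differential_closed[of _ 0] by (simp add: lambda_dgla_simps)
  have ed: "embs 1 ?d = fps_map (\<lambda>_. td 0) (embs 0 \<gamma>)"
    using lambda_ser[OF \<gamma>] e_differential[of _ 0] by (simp add: fps_eq_iff lambda_dgla_simps)
  have c: "1 / fact j = fps_exp (1 :: rat) $ j" "1 / fact (1 + j) = phi $ j" for j
    by (simp_all add: phi_nth)
  note A = series_sum_ad[OF \<gamma> lambda_ser[OF \<xi>], of "\<lambda>j. 1 / fact j", OF c(1)]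
  note B = series_sum_ad[OF \<gamma> d, of "\<lambda>j. 1 / fact (1 + j)", OF c(2)]
  have r: "raising ?T" by (rule raising_fps_bilin[OF bilQ_tb embs_0[OF \<gamma>]])
  have A0: "embs 1 ?A $ 0 = 0" unfolding A(2) using embs_0[OF \<xi>] by (simp add: opsum_def)
  have B0: "embs 1 ?B $ 0 = 0" unfolding B(2) ed using embs_0[OF \<gamma>] by (simp add: opsum_def linQ_0[OF linQ_td])
  have AL: "?A \<in> carrier (component (lambda_dgla h) 1)" using A(1) A0 by (simp add: lambda_iff)
  have BL: "?B \<in> carrier (component (lambda_dgla h) 1)" using B(1) B0 by (simp add: lambda_iff)
  have eq: "gauge_action \<rho> h \<gamma> \<xi> = (\<lambda>n. ?A n \<ominus>\<^bsub>component h 1\<^esub> ?B n)"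
    unfolding gauge_action_def Let_def by (rule minus_lambda[OF AL BL])
  interpret L: abelian_group "component (lambda_dgla h) 1" by (rule abelian_group_lambda)
  show "gauge_action \<rho> h \<gamma> \<xi> \<in> carrier (component (lambda_dgla h) 1)"
    unfolding gauge_action_def Let_def using AL BL by (rule L.minus_closed)
  show "gauge_action \<rho> h \<gamma> \<xi> n =
      (\<Oplus>\<^bsub>component h 1\<^esub>j\<in>{..n}. \<rho> (1 / fact j) \<odot>\<^bsub>component h 1\<^esub> (bracket (lambda_dgla h) 0 1 \<gamma> ^^ j) \<xi> n)
      \<ominus>\<^bsub>component h 1\<^esub> (\<Oplus>\<^bsub>component h 1\<^esub>j\<in>{..n}. \<rho> (1 / fact (1 + j)) \<odot>\<^bsub>component h 1\<^esub>
        (bracket (lambda_dgla h) 0 1 \<gamma> ^^ j) (differential (lambda_dgla h) 0 \<gamma>) n)"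
    unfolding eq A(3) B(3) ..
  have "embs 1 (gauge_action \<rho> h \<gamma> \<xi>) = embs 1 ?A - embs 1 ?B"
    unfolding eq using lambda_ser[OF AL] lambda_ser[OF BL] by (simp add: fps_eq_iff e_minus)
  then show "embs 1 (gauge_action \<rho> h \<gamma> \<xi>) = gauge_act (tb 0 1) (\<lambda>_. td 0) (embs 0 \<gamma>) (embs 1 \<xi>)"
    unfolding A(2) B(2) ed gauge_act_def .
qed

lemma maurer_cartan_transfer:
  "\<xi> \<in> maurer_cartan \<rho> (lambda_dgla h) \<longleftrightarrow>
     \<xi> \<in> carrier (component (lambda_dgla h) 1) \<and> curvature (tb 1 1) (td 1) (embs 1 \<xi>) = 0"
proof (cases "\<xi> \<in> carrier (component (lambda_dgla h) 1)")
  case True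
  let ?C = "differential (lambda_dgla h) 1 \<xi> \<oplus>\<^bsub>component (lambda_dgla h) 2\<^esub>
    (\<rho> (1/2) \<odot>\<^bsub>component (lambda_dgla h) 2\<^esub> bracket (lambda_dgla h) 1 1 \<xi> \<xi>)"
  interpret M: abelian_group "component h 2" by (rule abelian_group_component)
  have b: "bracket (lambda_dgla h) 1 1 \<xi> \<xi> n \<in> carrier (component h 2)" for n
    using bracket_lambda(1)[OF lambda_ser[OF True] lambda_ser[OF True]] by simp
  have eb: "e 2 (bracket (lambda_dgla h) 1 1 \<xi> \<xi> n) = fps_bilin (\<lambda>_ _. tb 1 1) (embs 1 \<xi>) (embs 1 \<xi>) $ n" for n
    using bracket_lambda(2)[OF lambda_ser[OF True] lambda_ser[OF True]] by (simp add: fps_eq_iff)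
  have d: "differential h 1 (\<xi> n) \<in> carrier (component h 2)" for n
    using differential_closed[of "\<xi> n" 1] lambda_ser[OF True] by simp
  have ed: "e 2 (differential h 1 (\<xi> n)) = td 1 (e 1 (\<xi> n))" for n
    using e_differential[of "\<xi> n" 1] lambda_ser[OF True] by simp
  have "?C n \<in> carrier (component h 2)" for n
    unfolding lambda_dgla_simps(2,3,6) using b d by (simp add: smult_closed)
  moreover have "e 2 (?C n) = curvature (tb 1 1) (td 1) (embs 1 \<xi>) $ n" for n
    unfolding lambda_dgla_simps(2,3,6) using b d by (simp add: smult_closed e_add e_scale eb ed curvature_def)
  ultimately have "?C n = \<zero>\<^bsub>component h 2\<^esub> \<longleftrightarrow> curvature (tb 1 1) (td 1) (embs 1 \<xi>) $ n = 0" for n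
    by (metis e_eq_0_iff)
  then have "?C = (\<lambda>n. \<zero>\<^bsub>component h 2\<^esub>) \<longleftrightarrow> curvature (tb 1 1) (td 1) (embs 1 \<xi>) = 0"
    by (simp add: fun_eq_iff fps_eq_iff)
  then show ?thesis using True by (simp add: maurer_cartan_def lambda_dgla_simps(4))
qed (simp add: maurer_cartan_def)

lemma maurer_cartan_carrier: "\<xi> \<in> maurer_cartan \<rho> (lambda_dgla h) \<Longrightarrow> \<xi> \<in> carrier (component (lambda_dgla h) 1)"
  by (simp add: maurer_cartan_def)

theorem gauge_action_maurer_cartan:
  "\<gamma> \<in> carrier (gauge_group \<rho> h) \<Longrightarrow> \<xi> \<in> maurer_cartan \<rho> (lambda_dgla h) \<Longrightarrow>
     gauge_action \<rho> h \<gamma> \<xi> \<in> maurer_cartan \<rho> (lambda_dgla h)"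
  by (simp add: maurer_cartan_transfer gauge_action_transfer curvature_gauge e_constant_term)

theorem gauge_action_mult:
  assumes "\<gamma> \<in> carrier (gauge_group \<rho> h)" "\<gamma>' \<in> carrier (gauge_group \<rho> h)" "\<xi> \<in> maurer_cartan \<rho> (lambda_dgla h)"
  shows "gauge_action \<rho> h (\<gamma> \<otimes>\<^bsub>gauge_group \<rho> h\<^esub> \<gamma>') \<xi> = gauge_action \<rho> h \<gamma> (gauge_action \<rho> h \<gamma>' \<xi>)"
  using assms maurer_cartan_carrier[OF assms(3)]
  by (intro embs_inj[OF lambda_ser lambda_ser, where i = 1])
    (simp_all add: gauge_action_transfer bch_closed bch_transfer D.gauge_act_bch e_constant_term)

theorem gauge_action_one:
  assumes "\<xi> \<in> maurer_cartan \<rho> (lambda_dgla h)"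
  shows "gauge_action \<rho> h \<one>\<^bsub>gauge_group \<rho> h\<^esub> \<xi> = \<xi>"
  using maurer_cartan_carrier[OF assms]
  by (intro embs_inj[OF lambda_ser lambda_ser, where i = 1])
    (simp_all add: gauge_action_transfer zero_lambda D.gauge_act_0)

end

section \<open>Naturality under morphisms\<close>

text \<open>The embeddings of \<open>h\<close> and \<open>h'\<close> are unrelated choices, so
  \<phi> is not followed through the rational spaces. Compatibility is proved in the modules
  themselves, with the finite sums of \<open>bch_nth\<close> and
  \<open>gauge_action_transfer\<close>.\<close>

locale rat_dgla_hom = H: rat_dgla k h \<rho> + H': rat_dgla k h' \<rho>
  for k :: "('r, 'm) ring_scheme" and h :: "('r, 'a) dgla" and h' :: "('r, 'b) dgla" and \<rho> :: "rat \<Rightarrow> 'r" +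
  fixes \<phi> :: "int \<Rightarrow> 'a \<Rightarrow> 'b"
  assumes morphism: "dgla_morphism k h h' \<phi>"
begin

lemma
  shows map_closed: "x \<in> carrier (component h i) \<Longrightarrow> \<phi> i x \<in> carrier (component h' i)"
    and map_add: "x \<in> carrier (component h i) \<Longrightarrow> y \<in> carrier (component h i) \<Longrightarrow>
      \<phi> i (x \<oplus>\<^bsub>component h i\<^esub> y) = \<phi> i x \<oplus>\<^bsub>component h' i\<^esub> \<phi> i y"
    and map_smult: "c \<in> carrier k \<Longrightarrow> x \<in> carrier (component h i) \<Longrightarrow>
      \<phi> i (c \<odot>\<^bsub>component h i\<^esub> x) = c \<odot>\<^bsub>component h' i\<^esub> \<phi> i x"
    and map_bracket: "x \<in> carrier (component h i) \<Longrightarrow> y \<in> carrier (component h j) \<Longrightarrow>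
      \<phi> (i + j) (bracket h i j x y) = bracket h' i j (\<phi> i x) (\<phi> j y)"
    and map_differential: "x \<in> carrier (component h i) \<Longrightarrow>
      \<phi> (i + 1) (differential h i x) = differential h' i (\<phi> i x)"
  using morphism unfolding dgla_morphism_def module_map_def by auto

lemma map_zero: "\<phi> i \<zero>\<^bsub>component h i\<^esub> = \<zero>\<^bsub>component h' i\<^esub>"
proof -
  interpret M: abelian_group "component h i" by (rule H.abelian_group_component)
  interpret M': abelian_group "component h' i" by (rule H'.abelian_group_component)
  show ?thesis
    using map_add[OF M.zero_closed M.zero_closed] map_closed[OF M.zero_closed]
    by (metis M.l_zero M.zero_closed M'.add.l_cancel_one')
qed

lemma map_minus:
  assumes "x \<in> carrier (component h i)" "y \<in> carrier (component h i)"
  shows "\<phi> i (x \<ominus>\<^bsub>component h i\<^esub> y) = \<phi> i x \<ominus>\<^bsub>component h' i\<^esub> \<phi> i y"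
proof -
  interpret M: abelian_group "component h i" by (rule H.abelian_group_component)
  interpret M': abelian_group "component h' i" by (rule H'.abelian_group_component)
  have "\<phi> i (\<ominus>\<^bsub>component h i\<^esub> y) \<oplus>\<^bsub>component h' i\<^esub> \<phi> i y = \<zero>\<^bsub>component h' i\<^esub>"
    using assms by (simp add: map_add[symmetric] M.l_neg map_zero)
  then have "\<ominus>\<^bsub>component h' i\<^esub> \<phi> i y = \<phi> i (\<ominus>\<^bsub>component h i\<^esub> y)"
    using assms by (intro M'.minus_equality) (simp_all add: map_closed)
  then show ?thesis using assms by (simp add: a_minus_def map_add)
qed

lemma map_finsum:
  assumes "\<And>x. x \<in> A \<Longrightarrow> f x \<in> carrier (component h i)"
  shows "\<phi> i (\<Oplus>\<^bsub>component h i\<^esub>x\<in>A. f x) = (\<Oplus>\<^bsub>component h' i\<^esub>x\<in>A. \<phi> i (f x))"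
proof -
  interpret M: abelian_group "component h i" by (rule H.abelian_group_component)
  interpret M': abelian_group "component h' i" by (rule H'.abelian_group_component)
  show ?thesis
    using assms
    by (induction A rule: infinite_finite_induct) (auto simp: map_zero map_add map_closed Pi_def)
qed

lemma series_map_ser: "X \<in> H.ser i \<Longrightarrow> series_map \<phi> i X \<in> H'.ser i"
  by (simp add: series_map_def map_closed)

lemma series_map_lambda:
  "X \<in> carrier (component (lambda_dgla h) i) \<Longrightarrow> series_map \<phi> i X \<in> carrier (component (lambda_dgla h') i)"
  by (simp add: lambda_dgla_simps series_map_def map_closed map_zero)

lemma series_map_bracket:
  assumes "X \<in> H.ser i" "Y \<in> H.ser j"
  shows "series_map \<phi> (i + j) (bracket (lambda_dgla h) i j X Y) =
    bracket (lambda_dgla h') i j (series_map \<phi> i X) (series_map \<phi> j Y)"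
  using assms
  by (auto simp: series_map_def lambda_dgla_simps map_finsum map_bracket H.bracket_closed intro!: ext)

lemma series_map_differential:
  assumes "X \<in> H.ser i"
  shows "series_map \<phi> (i + 1) (differential (lambda_dgla h) i X) =
    differential (lambda_dgla h') i (series_map \<phi> i X)"
  using assms by (auto simp: series_map_def lambda_dgla_simps map_differential)

lemma series_map_nested_bracket:
  assumes "p \<in> bch_index" "X \<in> H.ser 0" "Y \<in> H.ser 0"
  shows "series_map \<phi> 0 (nested_bracket (bracket (lambda_dgla h) 0 0) (bch_word p X Y)) =
    nested_bracket (bracket (lambda_dgla h') 0 0) (bch_word p (series_map \<phi> 0 X) (series_map \<phi> 0 Y))"
proof -
  have "set (bch_word p X Y) \<subseteq> H.ser 0" using set_bch_word[of p X Y] assms by auto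
  then have "series_map \<phi> 0 (nested_bracket (bracket (lambda_dgla h) 0 0) (bch_word p X Y)) =
      nested_bracket (bracket (lambda_dgla h') 0 0) (map (series_map \<phi> 0) (bch_word p X Y))"
    using H.bracket_lambda(1)[of _ 0 _ 0] series_map_bracket[of _ 0 _ 0]
    by (intro conjunct2[OF nested_bracket_hom[OF bch_word_nonempty[OF assms(1)]]]) auto
  then show ?thesis by (simp add: map_bch_word)
qed

lemma series_map_bch:
  assumes X: "X \<in> carrier (component (lambda_dgla h) 0)" and Y: "Y \<in> carrier (component (lambda_dgla h) 0)"
  shows "series_map \<phi> 0 (bch \<rho> h X Y) = bch \<rho> h' (series_map \<phi> 0 X) (series_map \<phi> 0 Y)"
proof
  fix n
  let ?A = "\<Union>m\<in>{..n}. bch_index_deg m"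
  let ?N = "\<lambda>p. nested_bracket (bracket (lambda_dgla h) 0 0) (bch_word p X Y)"
  interpret M': abelian_group "component h' 0" by (rule H'.abelian_group_component)
  have A: "p \<in> bch_index" if "p \<in> ?A" for p using that by (auto simp: bch_index_deg_def)
  have N: "?N p n \<in> carrier (component h 0)" if "p \<in> ?A" for p
    using H.nested_bracket_lambda(1)[OF A[OF that] H.lambda_ser[OF X] H.lambda_ser[OF Y]] by simp
  have "series_map \<phi> 0 (bch \<rho> h X Y) n =
      (\<Oplus>\<^bsub>component h' 0\<^esub>p\<in>?A. \<phi> 0 (\<rho> (bch_coeff p) \<odot>\<^bsub>component h 0\<^esub> ?N p n))"
    unfolding series_map_def H.bch_nth[OF X Y] by (rule map_finsum) (rule H.smult_closed[OF N])
  also have "\<dots> = (\<Oplus>\<^bsub>component h' 0\<^esub>p\<in>?A. \<rho> (bch_coeff p) \<odot>\<^bsub>component h' 0\<^esub>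
      nested_bracket (bracket (lambda_dgla h') 0 0) (bch_word p (series_map \<phi> 0 X) (series_map \<phi> 0 Y)) n)"
  proof (intro M'.finsum_cong' refl)
    show "(\<lambda>p. \<rho> (bch_coeff p) \<odot>\<^bsub>component h' 0\<^esub> nested_bracket (bracket (lambda_dgla h') 0 0)
        (bch_word p (series_map \<phi> 0 X) (series_map \<phi> 0 Y)) n) \<in> ?A \<rightarrow> carrier (component h' 0)"
      using H'.nested_bracket_lambda(1)[OF A series_map_ser[OF H.lambda_ser[OF X]] series_map_ser[OF H.lambda_ser[OF Y]]]
      by (auto intro!: H'.smult_closed)
    fix p assume p: "p \<in> ?A"
    have "\<phi> 0 (?N p n) = nested_bracket (bracket (lambda_dgla h') 0 0)
        (bch_word p (series_map \<phi> 0 X) (series_map \<phi> 0 Y)) n"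
      using series_map_nested_bracket[OF A[OF p] H.lambda_ser[OF X] H.lambda_ser[OF Y]]
      by (simp add: series_map_def fun_eq_iff)
    then show "\<phi> 0 (\<rho> (bch_coeff p) \<odot>\<^bsub>component h 0\<^esub> ?N p n) = \<rho> (bch_coeff p) \<odot>\<^bsub>component h' 0\<^esub>
        nested_bracket (bracket (lambda_dgla h') 0 0) (bch_word p (series_map \<phi> 0 X) (series_map \<phi> 0 Y)) n"
      by (simp add: map_smult N[OF p])
  qed
  also have "\<dots> = bch \<rho> h' (series_map \<phi> 0 X) (series_map \<phi> 0 Y) n"
    by (rule H'.bch_nth[OF series_map_lambda[OF X] series_map_lambda[OF Y], symmetric])
  finally show "series_map \<phi> 0 (bch \<rho> h X Y) n = bch \<rho> h' (series_map \<phi> 0 X) (series_map \<phi> 0 Y) n" .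
qed

lemma series_map_ad_power:
  assumes "\<gamma> \<in> H.ser 0" "\<xi> \<in> H.ser 1"
  shows "series_map \<phi> 1 ((bracket (lambda_dgla h) 0 1 \<gamma> ^^ j) \<xi>) =
    (bracket (lambda_dgla h') 0 1 (series_map \<phi> 0 \<gamma>) ^^ j) (series_map \<phi> 1 \<xi>)"
proof (induction j)
  case (Suc j)
  then show ?case
    using series_map_bracket[OF assms(1) H.ad_power_lambda(1)[OF assms], of j] by simp
qed simp

lemma map_ad_sum:
  assumes "\<gamma> \<in> H.ser 0" "\<xi> \<in> H.ser 1"
  shows "\<phi> 1 (\<Oplus>\<^bsub>component h 1\<^esub>j\<in>{..n::nat}. \<rho> (c j) \<odot>\<^bsub>component h 1\<^esub> (bracket (lambda_dgla h) 0 1 \<gamma> ^^ j) \<xi> n) =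
    (\<Oplus>\<^bsub>component h' 1\<^esub>j\<in>{..n}. \<rho> (c j) \<odot>\<^bsub>component h' 1\<^esub>
      (bracket (lambda_dgla h') 0 1 (series_map \<phi> 0 \<gamma>) ^^ j) (series_map \<phi> 1 \<xi>) n)"
proof -
  interpret M': abelian_group "component h' 1" by (rule H'.abelian_group_component)
  have P: "(bracket (lambda_dgla h) 0 1 \<gamma> ^^ j) \<xi> n \<in> carrier (component h 1)" for j
    using H.ad_power_lambda(1)[OF assms, of j] by simp
  have "\<phi> 1 ((bracket (lambda_dgla h) 0 1 \<gamma> ^^ j) \<xi> n) =
      (bracket (lambda_dgla h') 0 1 (series_map \<phi> 0 \<gamma>) ^^ j) (series_map \<phi> 1 \<xi>) n" for j
    using series_map_ad_power[OF assms, of j] by (simp add: series_map_def fun_eq_iff)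
  then have "\<phi> 1 (\<rho> (c j) \<odot>\<^bsub>component h 1\<^esub> (bracket (lambda_dgla h) 0 1 \<gamma> ^^ j) \<xi> n) = \<rho> (c j) \<odot>\<^bsub>component h' 1\<^esub>
      (bracket (lambda_dgla h') 0 1 (series_map \<phi> 0 \<gamma>) ^^ j) (series_map \<phi> 1 \<xi>) n" for j
    using P by (simp add: map_smult)
  then show ?thesis using P by (simp add: map_finsum H.smult_closed)
qed

lemma series_map_gauge_action:
  assumes \<gamma>: "\<gamma> \<in> carrier (component (lambda_dgla h) 0)" and \<xi>: "\<xi> \<in> carrier (component (lambda_dgla h) 1)"
  shows "series_map \<phi> 1 (gauge_action \<rho> h \<gamma> \<xi>) = gauge_action \<rho> h' (series_map \<phi> 0 \<gamma>) (series_map \<phi> 1 \<xi>)"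
proof
  fix n
  have d: "differential (lambda_dgla h) 0 \<gamma> \<in> H.ser 1"
    using H.lambda_ser[OF \<gamma>] H.differential_closed[of _ 0] by (simp add: lambda_dgla_simps)
  have fin: "(\<Oplus>\<^bsub>component h 1\<^esub>j\<in>{..n}. \<rho> (c j) \<odot>\<^bsub>component h 1\<^esub> (bracket (lambda_dgla h) 0 1 \<gamma> ^^ j) \<zeta> n)
      \<in> carrier (component h 1)" if "\<zeta> \<in> H.ser 1" for c \<zeta>
    using H.ad_power_lambda(1)[OF H.lambda_ser[OF \<gamma>] that]
    by (intro H.finsum_closed_component H.smult_closed) auto
  have *: "series_map \<phi> 1 (gauge_action \<rho> h \<gamma> \<xi>) n = \<phi> 1 (
      (\<Oplus>\<^bsub>component h 1\<^esub>j\<in>{..n}. \<rho> (1 / fact j) \<odot>\<^bsub>component h 1\<^esub> (bracket (lambda_dgla h) 0 1 \<gamma> ^^ j) \<xi> n)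
      \<ominus>\<^bsub>component h 1\<^esub> (\<Oplus>\<^bsub>component h 1\<^esub>j\<in>{..n}. \<rho> (1 / fact (1 + j)) \<odot>\<^bsub>component h 1\<^esub>
        (bracket (lambda_dgla h) 0 1 \<gamma> ^^ j) (differential (lambda_dgla h) 0 \<gamma>) n))"
    unfolding series_map_def H.gauge_action_transfer(2)[OF \<gamma> \<xi>] ..
  show "series_map \<phi> 1 (gauge_action \<rho> h \<gamma> \<xi>) n =
      gauge_action \<rho> h' (series_map \<phi> 0 \<gamma>) (series_map \<phi> 1 \<xi>) n"
    unfolding H'.gauge_action_transfer(2)[OF series_map_lambda[OF \<gamma>] series_map_lambda[OF \<xi>]]
      map_ad_sum[OF H.lambda_ser[OF \<gamma>] H.lambda_ser[OF \<xi>], symmetric]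
      series_map_differential[OF H.lambda_ser[OF \<gamma>], symmetric, simplified]
      map_ad_sum[OF H.lambda_ser[OF \<gamma>] d, symmetric]
      *
    by (rule map_minus[OF fin[OF H.lambda_ser[OF \<xi>]] fin[OF d]])
qed

lemma maurer_cartan_map:
  assumes "\<xi> \<in> maurer_cartan \<rho> h" shows "\<phi> 1 \<xi> \<in> maurer_cartan \<rho> h'"
proof -
  have \<xi>: "\<xi> \<in> carrier (component h 1)" using assms by (simp add: maurer_cartan_def)
  have d: "differential h 1 \<xi> \<in> carrier (component h 2)" and b: "bracket h 1 1 \<xi> \<xi> \<in> carrier (component h 2)"
    using H.differential_closed[OF \<xi>] H.bracket_closed[OF \<xi> \<xi>] by simp_all
  have "\<phi> 2 (differential h 1 \<xi> \<oplus>\<^bsub>component h 2\<^esub> (\<rho> (1/2) \<odot>\<^bsub>component h 2\<^esub> bracket h 1 1 \<xi> \<xi>)) =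
      differential h' 1 (\<phi> 1 \<xi>) \<oplus>\<^bsub>component h' 2\<^esub> (\<rho> (1/2) \<odot>\<^bsub>component h' 2\<^esub> bracket h' 1 1 (\<phi> 1 \<xi>) (\<phi> 1 \<xi>))"
    using d b map_bracket[OF \<xi> \<xi>] map_differential[OF \<xi>] by (simp add: map_add map_smult H.smult_closed)
  then show ?thesis using assms \<xi> by (simp add: maurer_cartan_def map_closed map_zero)
qed

text \<open>For series the Maurer-Cartan equation splits into one equation in
  \<open>component h 2\<close> per coefficient, and \<phi> is applied to each of them.\<close>

lemma maurer_cartan_lambda_map:
  assumes "\<xi> \<in> maurer_cartan \<rho> (lambda_dgla h)" shows "series_map \<phi> 1 \<xi> \<in> maurer_cartan \<rho> (lambda_dgla h')"
proof -
  let ?L = "lambda_dgla h" and ?L' = "lambda_dgla h'"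
  have \<xi>: "\<xi> \<in> carrier (component ?L 1)" using assms by (simp add: maurer_cartan_def)
  have d: "differential ?L 1 \<xi> n \<in> carrier (component h 2)" and b: "bracket ?L 1 1 \<xi> \<xi> n \<in> carrier (component h 2)" for n
    using H.differential_closed[of "\<xi> n" 1] H.bracket_lambda(1)[OF H.lambda_ser[OF \<xi>] H.lambda_ser[OF \<xi>]]
      H.lambda_ser[OF \<xi>] by (simp_all add: lambda_dgla_simps(6))
  have m: "\<phi> 2 (differential ?L 1 \<xi> n) = differential ?L' 1 (series_map \<phi> 1 \<xi>) n"
    "\<phi> 2 (bracket ?L 1 1 \<xi> \<xi> n) = bracket ?L' 1 1 (series_map \<phi> 1 \<xi>) (series_map \<phi> 1 \<xi>) n" for n
    using series_map_differential[OF H.lambda_ser[OF \<xi>]] series_map_bracket[OF H.lambda_ser[OF \<xi>] H.lambda_ser[OF \<xi>]]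
    by (simp_all add: series_map_def[of _ 2] fun_eq_iff)
  have "differential ?L' 1 (series_map \<phi> 1 \<xi>) n \<oplus>\<^bsub>component h' 2\<^esub>
      (\<rho> (1/2) \<odot>\<^bsub>component h' 2\<^esub> bracket ?L' 1 1 (series_map \<phi> 1 \<xi>) (series_map \<phi> 1 \<xi>) n) = \<zero>\<^bsub>component h' 2\<^esub>" for n
  proof -
    have "differential ?L 1 \<xi> n \<oplus>\<^bsub>component h 2\<^esub> (\<rho> (1/2) \<odot>\<^bsub>component h 2\<^esub> bracket ?L 1 1 \<xi> \<xi> n) = \<zero>\<^bsub>component h 2\<^esub>"
      using assms unfolding maurer_cartan_def lambda_dgla_simps(2,3,4) by (auto simp: fun_eq_iff)
    from arg_cong[OF this, of "\<phi> 2"] show ?thesis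
      using d b by (simp add: map_add map_smult H.smult_closed m map_zero)
  qed
  then show ?thesis
    using series_map_lambda[OF \<xi>] unfolding maurer_cartan_def lambda_dgla_simps(2,3,4) by auto
qed

lemma series_map_hom: "series_map \<phi> 0 \<in> hom (gauge_group \<rho> h) (gauge_group \<rho> h')"
  by (auto simp: hom_def series_map_lambda series_map_bch)

end

section \<open>Gauge orbits\<close>

abbreviation gauge_orbit :: "(rat \<Rightarrow> 'r) \<Rightarrow> ('r, 'a) dgla \<Rightarrow> (nat \<Rightarrow> 'a) \<Rightarrow> (nat \<Rightarrow> 'a) set" where
  "gauge_orbit \<rho> h \<equiv> orbit (gauge_group \<rho> h) (gauge_action \<rho> h)"

context rat_dgla
begin

lemma gauge_orbit_subset: "\<xi> \<in> maurer_cartan \<rho> (lambda_dgla h) \<Longrightarrow> gauge_orbit \<rho> h \<xi> \<subseteq> maurer_cartan \<rho> (lambda_dgla h)"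
  unfolding orbit_def using gauge_action_maurer_cartan by blast

lemma gauge_orbit_refl: "\<xi> \<in> maurer_cartan \<rho> (lambda_dgla h) \<Longrightarrow> \<xi> \<in> gauge_orbit \<rho> h \<xi>"
  using group.is_monoid[OF group_gauge_group] gauge_action_one[of \<xi>]
  unfolding orbit_def by (metis (mono_tags, lifting) mem_Collect_eq monoid.one_closed)

text \<open>Multiplication of gauge elements shows that the orbit of any point of an orbit is
  contained in that orbit. The inverse of the gauge element moves \<zeta> back to \<xi>, so the
  inclusion also applies with the roles exchanged.\<close>

lemma gauge_orbit_eq:
  assumes \<xi>: "\<xi> \<in> maurer_cartan \<rho> (lambda_dgla h)" and \<zeta>: "\<zeta> \<in> gauge_orbit \<rho> h \<xi>"
  shows "gauge_orbit \<rho> h \<zeta> = gauge_orbit \<rho> h \<xi>"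
proof -
  interpret G: group "gauge_group \<rho> h" by (rule group_gauge_group)
  have sub: "gauge_orbit \<rho> h \<zeta> \<subseteq> gauge_orbit \<rho> h \<xi>"
    if \<xi>: "\<xi> \<in> maurer_cartan \<rho> (lambda_dgla h)" and \<zeta>: "\<zeta> \<in> gauge_orbit \<rho> h \<xi>" for \<xi> \<zeta>
  proof
    obtain \<gamma> where \<gamma>: "\<gamma> \<in> carrier (gauge_group \<rho> h)" "\<zeta> = gauge_action \<rho> h \<gamma> \<xi>"
      using \<zeta> unfolding orbit_def by blast
    fix x assume "x \<in> gauge_orbit \<rho> h \<zeta>"
    then obtain \<gamma>' where \<gamma>': "\<gamma>' \<in> carrier (gauge_group \<rho> h)" "x = gauge_action \<rho> h \<gamma>' \<zeta>"
      unfolding orbit_def by blast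
    have "x = gauge_action \<rho> h (\<gamma>' \<otimes>\<^bsub>gauge_group \<rho> h\<^esub> \<gamma>) \<xi>"
      using gauge_action_mult[OF \<gamma>'(1) \<gamma>(1) \<xi>] \<gamma>(2) \<gamma>'(2) by simp
    then show "x \<in> gauge_orbit \<rho> h \<xi>" unfolding orbit_def using G.m_closed[OF \<gamma>'(1) \<gamma>(1)] by blast
  qed
  obtain \<gamma> where \<gamma>: "\<gamma> \<in> carrier (gauge_group \<rho> h)" "\<zeta> = gauge_action \<rho> h \<gamma> \<xi>"
    using \<zeta> unfolding orbit_def by blast
  have "gauge_action \<rho> h (inv\<^bsub>gauge_group \<rho> h\<^esub> \<gamma>) \<zeta> = \<xi>"
    using gauge_action_mult[OF G.inv_closed[OF \<gamma>(1)] \<gamma>(1) \<xi>] gauge_action_one[OF \<xi>] G.l_inv[OF \<gamma>(1)] \<gamma>(2)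
    by metis
  then have "\<xi> \<in> gauge_orbit \<rho> h \<zeta>" unfolding orbit_def using G.inv_closed[OF \<gamma>(1)] by blast
  then show ?thesis using sub[OF \<xi> \<zeta>] sub[of \<zeta> \<xi>] gauge_orbit_subset[OF \<xi>] \<zeta> by blast
qed

lemma deformationsE:
  assumes "X \<in> deformations \<rho> h"
  obtains \<xi> where "\<xi> \<in> maurer_cartan \<rho> (lambda_dgla h)" "X = gauge_orbit \<rho> h \<xi>"
  using assms unfolding deformations_def orbits_def by blast

lemma deformationsI: "\<xi> \<in> maurer_cartan \<rho> (lambda_dgla h) \<Longrightarrow> gauge_orbit \<rho> h \<xi> \<in> deformations \<rho> h"
  unfolding deformations_def orbits_def by blast

lemma deformations_mem:
  assumes "X \<in> deformations \<rho> h" "\<xi> \<in> X"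
  shows "\<xi> \<in> maurer_cartan \<rho> (lambda_dgla h)" "X = gauge_orbit \<rho> h \<xi>"
proof -
  obtain \<zeta> where \<zeta>: "\<zeta> \<in> maurer_cartan \<rho> (lambda_dgla h)" "X = gauge_orbit \<rho> h \<zeta>"
    using assms(1) by (rule deformationsE)
  show "\<xi> \<in> maurer_cartan \<rho> (lambda_dgla h)" using gauge_orbit_subset[OF \<zeta>(1)] assms(2) \<zeta>(2) by blast
  show "X = gauge_orbit \<rho> h \<xi>" unfolding \<zeta>(2) using gauge_orbit_eq[OF \<zeta>(1)] assms(2) \<zeta>(2) by simp
qed

lemma UN_gauge_orbit:
  assumes "X \<in> deformations \<rho> h" shows "(\<Union>\<xi>\<in>X. gauge_orbit \<rho> h \<xi>) = X"
proof -
  obtain \<zeta> where \<zeta>: "\<zeta> \<in> maurer_cartan \<rho> (lambda_dgla h)" "X = gauge_orbit \<rho> h \<zeta>"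
    using assms by (rule deformationsE)
  have "\<zeta> \<in> X" using gauge_orbit_refl[OF \<zeta>(1)] \<zeta>(2) by simp
  moreover have "gauge_orbit \<rho> h \<xi> = X" if "\<xi> \<in> X" for \<xi> by (rule deformations_mem(2)[OF assms that, symmetric])
  ultimately show ?thesis by blast
qed

end

context rat_dgla_hom
begin

lemma gauge_orbit_map:
  assumes "\<xi> \<in> maurer_cartan \<rho> (lambda_dgla h)" "\<zeta> \<in> gauge_orbit \<rho> h \<xi>"
  shows "gauge_orbit \<rho> h' (series_map \<phi> 1 \<zeta>) = gauge_orbit \<rho> h' (series_map \<phi> 1 \<xi>)"
proof (rule H'.gauge_orbit_eq[OF maurer_cartan_lambda_map[OF assms(1)]])
  obtain \<gamma> where \<gamma>: "\<gamma> \<in> carrier (component (lambda_dgla h) 0)" "\<zeta> = gauge_action \<rho> h \<gamma> \<xi>"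
    using assms(2) unfolding orbit_def by auto
  have "series_map \<phi> 1 \<zeta> = gauge_action \<rho> h' (series_map \<phi> 0 \<gamma>) (series_map \<phi> 1 \<xi>)"
    unfolding \<gamma>(2) by (rule series_map_gauge_action[OF \<gamma>(1) H.maurer_cartan_carrier[OF assms(1)]])
  then show "series_map \<phi> 1 \<zeta> \<in> gauge_orbit \<rho> h' (series_map \<phi> 1 \<xi>)"
    unfolding orbit_def using series_map_lambda[OF \<gamma>(1)] by auto
qed

text \<open>The union in \<open>deformation_map\<close> runs over all representatives. They all give
  the same orbit, and \<xi> itself is one of them.\<close>

lemma deformation_map_orbit:
  assumes "\<xi> \<in> maurer_cartan \<rho> (lambda_dgla h)"
  shows "deformation_map \<rho> h' \<phi> (gauge_orbit \<rho> h \<xi>) = gauge_orbit \<rho> h' (series_map \<phi> 1 \<xi>)"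
  unfolding deformation_map_def
  using gauge_orbit_map[OF assms] H.gauge_orbit_refl[OF assms] by blast

lemma deformation_map_closed: "X \<in> deformations \<rho> h \<Longrightarrow> deformation_map \<rho> h' \<phi> X \<in> deformations \<rho> h'"
  by (auto elim!: H.deformationsE simp: deformation_map_orbit intro!: H'.deformationsI maurer_cartan_lambda_map)

end

section \<open>Functors to differential graded Lie algebras\<close>

text \<open>Meant for the functor that takes the N-component and for reduction. Their element types,
  \<open>'b\<close> and \<open>'b set\<close>, differ, which is why a transformation below relates
  two type parameters.\<close>

definition functor_to_dglas ::
  "('r, 's) ring_scheme \<Rightarrow> ('o, 'm) category \<Rightarrow>
   ('o, 'm, ('r, 'a) dgla, int \<Rightarrow> 'a \<Rightarrow> 'a) functor_data \<Rightarrow> bool" where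
  "functor_to_dglas k C D \<longleftrightarrow>
     (\<forall>A\<in>objects C. dgla k (ob D A)) \<and>
     (\<forall>A\<in>objects C. \<forall>B\<in>objects C. \<forall>f\<in>arrows C A B. dgla_morphism k (ob D A) (ob D B) (mor D A B f)) \<and>
     (\<forall>A\<in>objects C. \<forall>i. \<forall>x\<in>carrier (component (ob D A) i). mor D A A (identity C A) i x = x) \<and>
     (\<forall>A\<in>objects C. \<forall>B\<in>objects C. \<forall>E\<in>objects C. \<forall>f\<in>arrows C A B. \<forall>g\<in>arrows C B E.
        \<forall>i. \<forall>x\<in>carrier (component (ob D A) i).
          mor D A E (compose_arrows C g f) i x = mor D B E g i (mor D A B f i x))"

definition dgla_natural_transformation ::
  "('r, 's) ring_scheme \<Rightarrow> ('o, 'm) category \<Rightarrow>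
   ('o, 'm, ('r, 'a) dgla, int \<Rightarrow> 'a \<Rightarrow> 'a) functor_data \<Rightarrow>
   ('o, 'm, ('r, 'b) dgla, int \<Rightarrow> 'b \<Rightarrow> 'b) functor_data \<Rightarrow> ('o \<Rightarrow> int \<Rightarrow> 'a \<Rightarrow> 'b) \<Rightarrow> bool" where
  "dgla_natural_transformation k C D D' \<tau> \<longleftrightarrow>
     functor_to_dglas k C D \<and> functor_to_dglas k C D' \<and>
     (\<forall>A\<in>objects C. dgla_morphism k (ob D A) (ob D' A) (\<tau> A)) \<and>
     (\<forall>A\<in>objects C. \<forall>B\<in>objects C. \<forall>f\<in>arrows C A B. \<forall>i. \<forall>x\<in>carrier (component (ob D A) i).
        \<tau> B i (mor D A B f i x) = mor D' A B f i (\<tau> A i x))"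

lemma compose_functor_simps [simp]:
  "ob (G \<circ>\<^sub>F F) A = ob G (ob F A)" "mor (G \<circ>\<^sub>F F) A B f = mor G (ob F A) (ob F B) (mor F A B f)"
  by (simp_all add: compose_functor_def)

lemma functor_simps [simp]:
  "ob (MC \<rho>) h = maurer_cartan \<rho> h" "mor (MC \<rho>) h h' \<phi> = \<phi> 1"
  "ob (Gauge \<rho>) h = gauge_group \<rho> h" "mor (Gauge \<rho>) h h' \<phi> = series_map \<phi> 0"
  "ob (Def \<rho>) h = deformations \<rho> h" "mor (Def \<rho>) h h' \<phi> = deformation_map \<rho> h' \<phi>"
  by (simp_all add: MC_def Gauge_def Def_def)

context
  fixes k :: "('r, 's) ring_scheme" and \<rho> :: "rat \<Rightarrow> 'r"
  assumes k: "cring k" and \<rho>: "\<rho> \<in> ring_hom rat_ring k"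
begin

lemma rat_dglaI: "dgla k h \<Longrightarrow> rat_dgla k h \<rho>"
  using k \<rho> by (simp add: rat_dgla_def rat_dgla_axioms_def)

lemma rat_dgla_homI: "dgla k h \<Longrightarrow> dgla k h' \<Longrightarrow> dgla_morphism k h h' \<phi> \<Longrightarrow> rat_dgla_hom k h h' \<rho> \<phi>"
  by (simp add: rat_dgla_hom_def rat_dgla_hom_axioms_def rat_dglaI)

context
  fixes C :: "('o, 'm) category" and D :: "('o, 'm, ('r, 'a) dgla, int \<Rightarrow> 'a \<Rightarrow> 'a) functor_data"
  assumes D: "functor_to_dglas k C D"
begin

lemma functor_rat_dgla: "A \<in> objects C \<Longrightarrow> rat_dgla k (ob D A) \<rho>"
  using D by (auto simp: functor_to_dglas_def intro: rat_dglaI)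

lemma functor_rat_dgla_hom:
  "A \<in> objects C \<Longrightarrow> B \<in> objects C \<Longrightarrow> f \<in> arrows C A B \<Longrightarrow>
     rat_dgla_hom k (ob D A) (ob D B) \<rho> (mor D A B f)"
  using D by (auto simp: functor_to_dglas_def intro!: rat_dgla_homI)

lemma functor_id: "A \<in> objects C \<Longrightarrow> x \<in> carrier (component (ob D A) i) \<Longrightarrow> mor D A A (identity C A) i x = x"
  and functor_comp: "A \<in> objects C \<Longrightarrow> B \<in> objects C \<Longrightarrow> E \<in> objects C \<Longrightarrow> f \<in> arrows C A B \<Longrightarrow> g \<in> arrows C B E \<Longrightarrow>
    x \<in> carrier (component (ob D A) i) \<Longrightarrow>
    mor D A E (compose_arrows C g f) i x = mor D B E g i (mor D A B f i x)"
  using D unfolding functor_to_dglas_def by blast+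

lemma functor_series_id:
  "A \<in> objects C \<Longrightarrow> X \<in> carrier (component (lambda_dgla (ob D A)) i) \<Longrightarrow>
     series_map (mor D A A (identity C A)) i X = X"
  using functor_id[of A] by (auto simp: series_map_def lambda_dgla_simps)

lemma functor_series_comp:
  "A \<in> objects C \<Longrightarrow> B \<in> objects C \<Longrightarrow> E \<in> objects C \<Longrightarrow> f \<in> arrows C A B \<Longrightarrow> g \<in> arrows C B E \<Longrightarrow>
    X \<in> carrier (component (lambda_dgla (ob D A)) i) \<Longrightarrow>
    series_map (mor D A E (compose_arrows C g f)) i X = series_map (mor D B E g) i (series_map (mor D A B f) i X)"
  using functor_comp[of A B E f g] by (auto simp: series_map_def lambda_dgla_simps)

lemma functor_MC: "functor_to_sets C (MC \<rho> \<circ>\<^sub>F D)"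
  unfolding functor_to_sets_def compose_functor_simps functor_simps
  using rat_dgla_hom.maurer_cartan_map[OF functor_rat_dgla_hom]
  by (auto simp: maurer_cartan_def functor_id functor_comp)

lemma functor_Gauge: "functor_to_groups C (Gauge \<rho> \<circ>\<^sub>F D)"
  unfolding functor_to_groups_def compose_functor_simps functor_simps
  using rat_dgla_hom.series_map_hom[OF functor_rat_dgla_hom] rat_dgla.group_gauge_group[OF functor_rat_dgla]
  by (auto simp: rat_dgla.gauge_group_simps[OF functor_rat_dgla] functor_series_id functor_series_comp)

text \<open>On the orbit of \<xi> both sides of the composition law are the orbit of the image of
  \<xi>: gauge-equivalent elements stay equivalent under each of the two maps, so the union over
  representatives collapses.\<close>

lemma functor_Def: "functor_to_sets C (Def \<rho> \<circ>\<^sub>F D)"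
  unfolding functor_to_sets_def compose_functor_simps functor_simps
proof (intro conjI ballI)
  show "deformation_map \<rho> (ob D B) (mor D A B f) \<in> deformations \<rho> (ob D A) \<rightarrow> deformations \<rho> (ob D B)"
    if "A \<in> objects C" "B \<in> objects C" "f \<in> arrows C A B" for A B f
    using rat_dgla_hom.deformation_map_closed[OF functor_rat_dgla_hom[OF that]] by auto
  show "deformation_map \<rho> (ob D A) (mor D A A (identity C A)) X = X"
    if A: "A \<in> objects C" and X: "X \<in> deformations \<rho> (ob D A)" for A X
  proof -
    interpret rat_dgla k "ob D A" \<rho> by (rule functor_rat_dgla[OF A])
    have "deformation_map \<rho> (ob D A) (mor D A A (identity C A)) X = (\<Union>\<xi>\<in>X. gauge_orbit \<rho> (ob D A) \<xi>)"
      unfolding deformation_map_def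
      using functor_series_id[OF A] maurer_cartan_carrier[OF deformations_mem(1)[OF X]] by simp
    then show ?thesis by (simp add: UN_gauge_orbit[OF X])
  qed
  show "deformation_map \<rho> (ob D E) (mor D A E (compose_arrows C g f)) X =
      deformation_map \<rho> (ob D E) (mor D B E g) (deformation_map \<rho> (ob D B) (mor D A B f) X)"
    if o: "A \<in> objects C" "B \<in> objects C" "E \<in> objects C" and f: "f \<in> arrows C A B" "g \<in> arrows C B E"
      and X: "X \<in> deformations \<rho> (ob D A)" for A B E f g X
  proof -
    interpret F: rat_dgla_hom k "ob D A" "ob D B" \<rho> "mor D A B f" by (rule functor_rat_dgla_hom[OF o(1,2) f(1)])
    interpret G: rat_dgla_hom k "ob D B" "ob D E" \<rho> "mor D B E g" by (rule functor_rat_dgla_hom[OF o(2,3) f(2)])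
    obtain \<xi> where \<xi>: "\<xi> \<in> maurer_cartan \<rho> (lambda_dgla (ob D A))" "X = gauge_orbit \<rho> (ob D A) \<xi>"
      using X by (rule F.H.deformationsE)
    have c: "series_map (mor D A E (compose_arrows C g f)) 1 \<zeta> =
        series_map (mor D B E g) 1 (series_map (mor D A B f) 1 \<zeta>)" if "\<zeta> \<in> X" for \<zeta>
      by (rule functor_series_comp[OF o f F.H.maurer_cartan_carrier[OF F.H.deformations_mem(1)[OF X that]]])
    have "deformation_map \<rho> (ob D E) (mor D A E (compose_arrows C g f)) X =
        (\<Union>\<zeta>\<in>X. gauge_orbit \<rho> (ob D E) (series_map (mor D B E g) 1 (series_map (mor D A B f) 1 \<zeta>)))"
      unfolding deformation_map_def using c by simp
    also have "\<dots> = gauge_orbit \<rho> (ob D E) (series_map (mor D B E g) 1 (series_map (mor D A B f) 1 \<xi>))"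
    proof -
      have "gauge_orbit \<rho> (ob D E) (series_map (mor D B E g) 1 (series_map (mor D A B f) 1 \<zeta>)) =
          gauge_orbit \<rho> (ob D E) (series_map (mor D B E g) 1 (series_map (mor D A B f) 1 \<xi>))" if "\<zeta> \<in> X" for \<zeta>
      proof (rule G.gauge_orbit_map[OF F.maurer_cartan_lambda_map[OF \<xi>(1)]])
        have "\<zeta> \<in> maurer_cartan \<rho> (lambda_dgla (ob D A))" by (rule F.H.deformations_mem(1)[OF X that])
        then show "series_map (mor D A B f) 1 \<zeta> \<in> gauge_orbit \<rho> (ob D B) (series_map (mor D A B f) 1 \<xi>)"
          using F.gauge_orbit_map[OF \<xi>(1), of \<zeta>] that \<xi>(2)
            F.H'.gauge_orbit_refl[OF F.maurer_cartan_lambda_map] by metis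
      qed
      moreover have "\<xi> \<in> X" using F.H.gauge_orbit_refl[OF \<xi>(1)] \<xi>(2) by simp
      ultimately show ?thesis by blast
    qed
    also have "\<dots> = deformation_map \<rho> (ob D E) (mor D B E g) (deformation_map \<rho> (ob D B) (mor D A B f) X)"
      unfolding \<xi>(2) F.deformation_map_orbit[OF \<xi>(1)]
      by (rule G.deformation_map_orbit[OF F.maurer_cartan_lambda_map[OF \<xi>(1)], symmetric])
    finally show ?thesis .
  qed
qed

end

context
  fixes C :: "('o, 'm) category" and D :: "('o, 'm, ('r, 'a) dgla, int \<Rightarrow> 'a \<Rightarrow> 'a) functor_data"
    and D' :: "('o, 'm, ('r, 'b) dgla, int \<Rightarrow> 'b \<Rightarrow> 'b) functor_data" and \<tau>
  assumes \<tau>: "dgla_natural_transformation k C D D' \<tau>"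
begin

lemma natural_functors: "functor_to_dglas k C D" "functor_to_dglas k C D'"
  using \<tau> by (simp_all add: dgla_natural_transformation_def)

lemma natural_rat_dgla_hom: "A \<in> objects C \<Longrightarrow> rat_dgla_hom k (ob D A) (ob D' A) \<rho> (\<tau> A)"
  using \<tau> by (auto simp: dgla_natural_transformation_def functor_to_dglas_def intro!: rat_dgla_homI)

lemma natural_square:
  "A \<in> objects C \<Longrightarrow> B \<in> objects C \<Longrightarrow> f \<in> arrows C A B \<Longrightarrow> x \<in> carrier (component (ob D A) i) \<Longrightarrow>
     \<tau> B i (mor D A B f i x) = mor D' A B f i (\<tau> A i x)"
  using \<tau> unfolding dgla_natural_transformation_def by blast

lemma natural_series_square:
  "A \<in> objects C \<Longrightarrow> B \<in> objects C \<Longrightarrow> f \<in> arrows C A B \<Longrightarrow> X \<in> carrier (component (lambda_dgla (ob D A)) i) \<Longrightarrow>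
     series_map (\<tau> B) i (series_map (mor D A B f) i X) = series_map (mor D' A B f) i (series_map (\<tau> A) i X)"
  using natural_square[of A B f] by (auto simp: series_map_def lambda_dgla_simps)

lemma natural_MC: "set_natural_transformation C (MC \<rho> \<circ>\<^sub>F D) (MC \<rho> \<circ>\<^sub>F D') (\<lambda>A. \<tau> A 1)"
  unfolding set_natural_transformation_def
  using functor_MC[OF natural_functors(1)] functor_MC[OF natural_functors(2)]
    rat_dgla_hom.maurer_cartan_map[OF natural_rat_dgla_hom]
  by (auto simp: maurer_cartan_def natural_square)

lemma natural_Gauge:
  "group_natural_transformation C (Gauge \<rho> \<circ>\<^sub>F D) (Gauge \<rho> \<circ>\<^sub>F D') (\<lambda>A. series_map (\<tau> A) 0)"
  unfolding group_natural_transformation_def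
  using functor_Gauge[OF natural_functors(1)] functor_Gauge[OF natural_functors(2)]
    rat_dgla_hom.series_map_hom[OF natural_rat_dgla_hom]
  by (auto simp: rat_dgla.gauge_group_simps[OF functor_rat_dgla[OF natural_functors(1)]] natural_series_square)

text \<open>Orbits go to orbits of images along all four sides of the square, so the square for a
  single representative series suffices.\<close>

lemma natural_Def:
  "set_natural_transformation C (Def \<rho> \<circ>\<^sub>F D) (Def \<rho> \<circ>\<^sub>F D') (\<lambda>A. deformation_map \<rho> (ob D' A) (\<tau> A))"
  unfolding set_natural_transformation_def
proof (intro conjI ballI)
  show "deformation_map \<rho> (ob D' A) (\<tau> A) \<in> ob (Def \<rho> \<circ>\<^sub>F D) A \<rightarrow> ob (Def \<rho> \<circ>\<^sub>F D') A" if "A \<in> objects C" for A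
    using rat_dgla_hom.deformation_map_closed[OF natural_rat_dgla_hom[OF that]] by auto
  fix A B f X assume A: "A \<in> objects C" and B: "B \<in> objects C" and f: "f \<in> arrows C A B"
    and "X \<in> ob (Def \<rho> \<circ>\<^sub>F D) A"
  then have X: "X \<in> deformations \<rho> (ob D A)" by simp
  interpret F: rat_dgla_hom k "ob D A" "ob D B" \<rho> "mor D A B f"
    by (rule functor_rat_dgla_hom[OF natural_functors(1) A B f])
  interpret F': rat_dgla_hom k "ob D' A" "ob D' B" \<rho> "mor D' A B f"
    by (rule functor_rat_dgla_hom[OF natural_functors(2) A B f])
  interpret A: rat_dgla_hom k "ob D A" "ob D' A" \<rho> "\<tau> A" by (rule natural_rat_dgla_hom[OF A])
  interpret B: rat_dgla_hom k "ob D B" "ob D' B" \<rho> "\<tau> B" by (rule natural_rat_dgla_hom[OF B])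
  obtain \<xi> where \<xi>: "\<xi> \<in> maurer_cartan \<rho> (lambda_dgla (ob D A))" "X = gauge_orbit \<rho> (ob D A) \<xi>"
    using X by (rule F.H.deformationsE)
  show "deformation_map \<rho> (ob D' B) (\<tau> B) (mor (Def \<rho> \<circ>\<^sub>F D) A B f X) =
      mor (Def \<rho> \<circ>\<^sub>F D') A B f (deformation_map \<rho> (ob D' A) (\<tau> A) X)"
    unfolding compose_functor_simps functor_simps \<xi>(2)
    by (simp add: F.deformation_map_orbit A.deformation_map_orbit B.deformation_map_orbit F'.deformation_map_orbit
        \<xi>(1) F.maurer_cartan_lambda_map A.maurer_cartan_lambda_map
        natural_series_square[OF A B f F.H.maurer_cartan_carrier])
qed (rule functor_Def[OF natural_functors(1)] functor_Def[OF natural_functors(2)])+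

end

end

section \<open>Quotients by the fibres of a natural transformation\<close>

text \<open>An identity in \<open>Q\<close> can be tested after applying the injections \<eta>,
  where it becomes a functor law of \<open>G\<close>. This spares computations with equivalence
  classes.\<close>

lemma functor_to_sets_reflect:
  assumes G: "functor_to_sets C G"
    and mor: "\<And>A B f. A \<in> objects C \<Longrightarrow> B \<in> objects C \<Longrightarrow> f \<in> arrows C A B \<Longrightarrow> mor Q A B f \<in> ob Q A \<rightarrow> ob Q B"
    and \<eta>: "\<And>A. A \<in> objects C \<Longrightarrow> \<eta> A \<in> ob Q A \<rightarrow> ob G A" "\<And>A. A \<in> objects C \<Longrightarrow> inj_on (\<eta> A) (ob Q A)"
    and nat: "\<And>A B f X. A \<in> objects C \<Longrightarrow> B \<in> objects C \<Longrightarrow> f \<in> arrows C A B \<Longrightarrow> X \<in> ob Q A \<Longrightarrow>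
      \<eta> B (mor Q A B f X) = mor G A B f (\<eta> A X)"
    and cat: "\<And>A. A \<in> objects C \<Longrightarrow> identity C A \<in> arrows C A A"
      "\<And>A B E f g. A \<in> objects C \<Longrightarrow> B \<in> objects C \<Longrightarrow> E \<in> objects C \<Longrightarrow> f \<in> arrows C A B \<Longrightarrow> g \<in> arrows C B E \<Longrightarrow>
        compose_arrows C g f \<in> arrows C A E"
  shows "functor_to_sets C Q"
  unfolding functor_to_sets_def
proof (intro conjI ballI)
  show "mor Q A A (identity C A) X = X" if A: "A \<in> objects C" and X: "X \<in> ob Q A" for A X
  proof (rule inj_onD[OF \<eta>(2)[OF A] _ _ X])
    show "\<eta> A (mor Q A A (identity C A) X) = \<eta> A X"
      using nat[OF A A cat(1)[OF A] X] G funcset_mem[OF \<eta>(1)[OF A] X] A by (simp add: functor_to_sets_def)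
    show "mor Q A A (identity C A) X \<in> ob Q A" using mor[OF A A cat(1)[OF A]] X by auto
  qed
  show "mor Q A E (compose_arrows C g f) X = mor Q B E g (mor Q A B f X)"
    if o: "A \<in> objects C" "B \<in> objects C" "E \<in> objects C" and f: "f \<in> arrows C A B" "g \<in> arrows C B E"
      and X: "X \<in> ob Q A" for A B E f g X
  proof (rule inj_onD[OF \<eta>(2)[OF o(3)]])
    have fX: "mor Q A B f X \<in> ob Q B" using mor[OF o(1,2) f(1)] X by auto
    have "mor G A E (compose_arrows C g f) (\<eta> A X) = mor G B E g (mor G A B f (\<eta> A X))"
      using G o f \<eta>(1)[OF o(1)] X unfolding functor_to_sets_def by blast
    then show "\<eta> E (mor Q A E (compose_arrows C g f) X) = \<eta> E (mor Q B E g (mor Q A B f X))"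
      by (simp add: nat[OF o(1,3) cat(2)[OF o f] X] nat[OF o(2,3) f(2) fX] nat[OF o(1,2) f(1) X])
    show "mor Q A E (compose_arrows C g f) X \<in> ob Q E" using mor[OF o(1,3) cat(2)[OF o f]] X by auto
    show "mor Q B E g (mor Q A B f X) \<in> ob Q E" using mor[OF o(2,3) f(2)] fX by auto
  qed
qed (rule mor)

text \<open>Dividing by the fibres of p is the image factorisation of p: it descends to the classes
  and is injective there. The hypothesis on \<open>mor\<close> is the shape that
  \<open>Red_set\<close> gives to maps.\<close>

lemma fibre_quotient:
  assumes nat: "set_natural_transformation C S G p"
    and ob: "\<And>A. A \<in> objects C \<Longrightarrow> ob Q A = ob S A // R A"
    and R: "\<And>A. A \<in> objects C \<Longrightarrow> R A = {(x, y). x \<in> ob S A \<and> y \<in> ob S A \<and> p A x = p A y}"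
    and mor: "\<And>A B f X. mor Q A B f X = (\<Union>x\<in>X. R B `` {mor S A B f x})"
    and cat: "\<And>A. A \<in> objects C \<Longrightarrow> identity C A \<in> arrows C A A"
      "\<And>A B E f g. A \<in> objects C \<Longrightarrow> B \<in> objects C \<Longrightarrow> E \<in> objects C \<Longrightarrow> f \<in> arrows C A B \<Longrightarrow> g \<in> arrows C B E \<Longrightarrow>
        compose_arrows C g f \<in> arrows C A E"
  shows "\<exists>\<eta>. set_natural_transformation C Q G \<eta> \<and> (\<forall>A\<in>objects C. inj_on (\<eta> A) (ob Q A))"
proof -
  \<comment> \<open>\<open>p A\<close> is constant on a class, so the image of the class is a
    singleton.\<close>
  define \<eta> where "\<eta> A X = the_elem (p A ` X)" for A X
  have obE: "\<exists>x\<in>ob S A. X = R A `` {x}" if "A \<in> objects C" "X \<in> ob Q A" for A X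
    using that ob[OF that(1)] by (auto elim: quotientE)
  have \<eta>: "\<eta> A (R A `` {x}) = p A x" if "A \<in> objects C" "x \<in> ob S A" for A x
  proof -
    have "p A ` (R A `` {x}) = {p A x}" unfolding R[OF that(1)] using that(2) by force
    then show ?thesis by (simp add: \<eta>_def)
  qed
  have S: "mor S A B f x \<in> ob S B" "p A x \<in> ob G A" "p B (mor S A B f x) = mor G A B f (p A x)"
    if "A \<in> objects C" "B \<in> objects C" "f \<in> arrows C A B" "x \<in> ob S A" for A B f x
    using nat that unfolding set_natural_transformation_def functor_to_sets_def by auto
  have pG: "p A x \<in> ob G A" if "A \<in> objects C" "x \<in> ob S A" for A x
    using nat that unfolding set_natural_transformation_def by auto
  have morQ: "mor Q A B f (R A `` {x}) = R B `` {mor S A B f x}"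
    if A: "A \<in> objects C" and B: "B \<in> objects C" and f: "f \<in> arrows C A B" and x: "x \<in> ob S A" for A B f x
  proof -
    have "R B `` {mor S A B f y} = R B `` {mor S A B f x}" if "y \<in> R A `` {x}" for y
    proof -
      have y: "y \<in> ob S A" "p A y = p A x" using that R[OF A] by auto
      have "p B (mor S A B f y) = p B (mor S A B f x)"
        using S(3)[OF A B f x] S(3)[OF A B f y(1)] y(2) by simp
      then show ?thesis unfolding R[OF B] using S(1)[OF A B f x] S(1)[OF A B f y(1)] by auto
    qed
    moreover have "x \<in> R A `` {x}" using R[OF A] x by auto
    ultimately show ?thesis unfolding mor by blast
  qed
  have Qmor: "mor Q A B f \<in> ob Q A \<rightarrow> ob Q B" if "A \<in> objects C" "B \<in> objects C" "f \<in> arrows C A B" for A B f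
    using obE[OF that(1)] morQ[OF that] S(1)[OF that] ob[OF that(2)] by (fastforce intro: quotientI)
  have \<eta>G: "\<eta> A \<in> ob Q A \<rightarrow> ob G A" if "A \<in> objects C" for A
    using obE[OF that] \<eta>[OF that] pG[OF that] by fastforce
  have inj: "inj_on (\<eta> A) (ob Q A)" if A: "A \<in> objects C" for A
  proof (rule inj_onI)
    fix X Y assume "X \<in> ob Q A" "Y \<in> ob Q A" and eq: "\<eta> A X = \<eta> A Y"
    then obtain x y where "x \<in> ob S A" "X = R A `` {x}" "y \<in> ob S A" "Y = R A `` {y}"
      using obE[OF A] by metis
    then show "X = Y" using eq \<eta>[OF A] R[OF A] by auto
  qed
  have natQ: "\<eta> B (mor Q A B f X) = mor G A B f (\<eta> A X)"
    if A: "A \<in> objects C" and B: "B \<in> objects C" and f: "f \<in> arrows C A B" and X: "X \<in> ob Q A" for A B f X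
  proof -
    obtain x where x: "x \<in> ob S A" "X = R A `` {x}" using obE[OF A X] by blast
    then show ?thesis
      by (simp add: morQ[OF A B f] \<eta>[OF A] \<eta>[OF B S(1)[OF A B f]] S(3)[OF A B f])
  qed
  have G: "functor_to_sets C G" using nat by (simp add: set_natural_transformation_def)
  have "functor_to_sets C Q"
    by (rule functor_to_sets_reflect[of C G Q \<eta>, OF G Qmor \<eta>G inj natQ cat])
  then have "set_natural_transformation C Q G \<eta>"
    unfolding set_natural_transformation_def using G \<eta>G natQ by blast
  then show ?thesis using inj by blast
qed

text \<open>The first isomorphism theorem in each component, with surjectivity of p making the
  induced maps isomorphisms. The maps of \<open>Q\<close> are homomorphisms, and functorial, because
  this can be tested after the injective natural \<eta>.\<close>

lemma kernel_quotient:
  assumes nat: "group_natural_transformation C S G p"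
    and ob: "\<And>A. A \<in> objects C \<Longrightarrow> ob Q A = ob S A Mod K A"
    and K: "\<And>A. A \<in> objects C \<Longrightarrow> K A = kernel (ob S A) (ob G A) (p A)"
    and surj: "\<And>A. A \<in> objects C \<Longrightarrow> p A ` carrier (ob S A) = carrier (ob G A)"
    and mor: "\<And>A B f X. mor Q A B f X = (\<Union>x\<in>X. K B #>\<^bsub>ob S B\<^esub> mor S A B f x)"
    and cat: "\<And>A. A \<in> objects C \<Longrightarrow> identity C A \<in> arrows C A A"
      "\<And>A B E f g. A \<in> objects C \<Longrightarrow> B \<in> objects C \<Longrightarrow> E \<in> objects C \<Longrightarrow> f \<in> arrows C A B \<Longrightarrow> g \<in> arrows C B E \<Longrightarrow>
        compose_arrows C g f \<in> arrows C A E"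
  shows "\<exists>\<eta>. group_natural_transformation C Q G \<eta> \<and> (\<forall>A\<in>objects C. \<eta> A \<in> iso (ob Q A) (ob G A))"
proof -
  define \<eta> where "\<eta> A X = the_elem (p A ` X)" for A X
  have SG: "group (ob S A)" "group (ob G A)" "p A \<in> hom (ob S A) (ob G A)" if "A \<in> objects C" for A
    using nat that unfolding group_natural_transformation_def functor_to_groups_def by auto
  have hom: "group_hom (ob S A) (ob G A) (p A)" if "A \<in> objects C" for A
    using SG[OF that] by (simp add: group_hom_def group_hom_axioms_def)
  have S: "mor S A B f \<in> hom (ob S A) (ob S B)" "mor G A B f \<in> hom (ob G A) (ob G B)"
    if "A \<in> objects C" "B \<in> objects C" "f \<in> arrows C A B" for A B f
    using nat that unfolding group_natural_transformation_def functor_to_groups_def by auto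
  have sq: "p B (mor S A B f x) = mor G A B f (p A x)"
    if "A \<in> objects C" "B \<in> objects C" "f \<in> arrows C A B" "x \<in> carrier (ob S A)" for A B f x
    using nat that unfolding group_natural_transformation_def by auto
  have coset: "K A #>\<^bsub>ob S A\<^esub> x = {y \<in> carrier (ob S A). p A y = p A x}"
    if A: "A \<in> objects C" and x: "x \<in> carrier (ob S A)" for A x
  proof -
    interpret h: group_hom "ob S A" "ob G A" "p A" by (rule hom[OF A])
    show ?thesis
    proof safe
      fix y assume "y \<in> K A #>\<^bsub>ob S A\<^esub> x"
      then obtain u where "u \<in> carrier (ob S A)" "p A u = \<one>\<^bsub>ob G A\<^esub>" "y = u \<otimes>\<^bsub>ob S A\<^esub> x"
        unfolding r_coset_def K[OF A] kernel_def by auto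
      then show "y \<in> carrier (ob S A)" "p A y = p A x" using x by auto
    next
      fix y assume y: "y \<in> carrier (ob S A)" "p A y = p A x"
      have "y \<otimes>\<^bsub>ob S A\<^esub> inv\<^bsub>ob S A\<^esub> x \<in> K A" using x y by (simp add: K[OF A] kernel_def)
      moreover have "y = (y \<otimes>\<^bsub>ob S A\<^esub> inv\<^bsub>ob S A\<^esub> x) \<otimes>\<^bsub>ob S A\<^esub> x" using x y by (simp add: h.G.m_assoc)
      ultimately show "y \<in> K A #>\<^bsub>ob S A\<^esub> x" unfolding r_coset_def by blast
    qed
  qed
  have obE: "\<exists>x\<in>carrier (ob S A). X = K A #>\<^bsub>ob S A\<^esub> x" if "A \<in> objects C" "X \<in> carrier (ob Q A)" for A X
    using that ob[OF that(1)] by (auto simp: FactGroup_def RCOSETS_def)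
  have obI: "K A #>\<^bsub>ob S A\<^esub> x \<in> carrier (ob Q A)" if "A \<in> objects C" "x \<in> carrier (ob S A)" for A x
    using that ob[OF that(1)] by (auto simp: FactGroup_def RCOSETS_def)
  have \<eta>: "\<eta> A (K A #>\<^bsub>ob S A\<^esub> x) = p A x" if "A \<in> objects C" "x \<in> carrier (ob S A)" for A x
  proof -
    have "p A ` (K A #>\<^bsub>ob S A\<^esub> x) = {p A x}" unfolding coset[OF that] using that(2) by force
    then show ?thesis by (simp add: \<eta>_def)
  qed
  have morQ: "mor Q A B f (K A #>\<^bsub>ob S A\<^esub> x) = K B #>\<^bsub>ob S B\<^esub> mor S A B f x"
    if A: "A \<in> objects C" and B: "B \<in> objects C" and f: "f \<in> arrows C A B" and x: "x \<in> carrier (ob S A)" for A B f x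
  proof -
    have m: "mor S A B f y \<in> carrier (ob S B)" if "y \<in> carrier (ob S A)" for y
      using S(1)[OF A B f] that by (auto simp: hom_def)
    have "K B #>\<^bsub>ob S B\<^esub> mor S A B f y = K B #>\<^bsub>ob S B\<^esub> mor S A B f x" if "y \<in> K A #>\<^bsub>ob S A\<^esub> x" for y
    proof -
      have y: "y \<in> carrier (ob S A)" "p A y = p A x" using that coset[OF A x] by auto
      have "p B (mor S A B f y) = p B (mor S A B f x)" using sq[OF A B f x] sq[OF A B f y(1)] y(2) by simp
      then show ?thesis unfolding coset[OF B m[OF x]] coset[OF B m[OF y(1)]] by simp
    qed
    moreover have "x \<in> K A #>\<^bsub>ob S A\<^esub> x" unfolding coset[OF A x] using x by simp
    ultimately show ?thesis unfolding mor by blast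
  qed
  have iso: "\<eta> A \<in> iso (ob Q A) (ob G A)" if A: "A \<in> objects C" for A
    using group_hom.FactGroup_iso_set[OF hom[OF A] surj[OF A]] unfolding \<eta>_def ob[OF A] K[OF A] .
  have groupQ: "group (ob Q A)" if A: "A \<in> objects C" for A
    unfolding ob[OF A] K[OF A] by (rule normal.factorgroup_is_group[OF group_hom.normal_kernel[OF hom[OF A]]])
  have Qmor: "mor Q A B f \<in> carrier (ob Q A) \<rightarrow> carrier (ob Q B)"
    if A: "A \<in> objects C" and B: "B \<in> objects C" and f: "f \<in> arrows C A B" for A B f
  proof
    fix X assume "X \<in> carrier (ob Q A)"
    then obtain x where x: "x \<in> carrier (ob S A)" "X = K A #>\<^bsub>ob S A\<^esub> x" using obE[OF A] by blast
    have "mor S A B f x \<in> carrier (ob S B)" using S(1)[OF A B f] x by (auto simp: hom_def)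
    then show "mor Q A B f X \<in> carrier (ob Q B)"
      unfolding x(2) morQ[OF A B f x(1)] by (rule obI[OF B])
  qed
  have natQ: "\<eta> B (mor Q A B f X) = mor G A B f (\<eta> A X)"
    if A: "A \<in> objects C" and B: "B \<in> objects C" and f: "f \<in> arrows C A B" and X: "X \<in> carrier (ob Q A)" for A B f X
  proof -
    obtain x where x: "x \<in> carrier (ob S A)" "X = K A #>\<^bsub>ob S A\<^esub> x" using obE[OF A X] by blast
    moreover have "mor S A B f x \<in> carrier (ob S B)" using S(1)[OF A B f] x by (auto simp: hom_def)
    ultimately show ?thesis by (simp add: morQ[OF A B f] \<eta>[OF A] \<eta>[OF B] sq[OF A B f])
  qed
  have homQ: "mor Q A B f \<in> hom (ob Q A) (ob Q B)"
    if A: "A \<in> objects C" and B: "B \<in> objects C" and f: "f \<in> arrows C A B" for A B f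
  proof (rule homI)
    fix X Y assume X: "X \<in> carrier (ob Q A)" and Y: "Y \<in> carrier (ob Q A)"
    interpret QA: group "ob Q A" by (rule groupQ[OF A])
    interpret QB: group "ob Q B" by (rule groupQ[OF B])
    show fX: "mor Q A B f X \<in> carrier (ob Q B)" using Qmor[OF that] X by auto
    have fY: "mor Q A B f Y \<in> carrier (ob Q B)" using Qmor[OF that] Y by auto
    have XY: "X \<otimes>\<^bsub>ob Q A\<^esub> Y \<in> carrier (ob Q A)" using X Y by simp
    have \<eta>A: "\<eta> A \<in> hom (ob Q A) (ob G A)" and \<eta>B: "\<eta> B \<in> hom (ob Q B) (ob G B)"
      using iso[OF A] iso[OF B] by (auto simp: iso_def)
    have "\<eta> B (mor Q A B f (X \<otimes>\<^bsub>ob Q A\<^esub> Y)) = \<eta> B (mor Q A B f X \<otimes>\<^bsub>ob Q B\<^esub> mor Q A B f Y)"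
      using hom_mult[OF \<eta>A X Y] hom_mult[OF \<eta>B fX fY] hom_mult[OF S(2)[OF that], of "\<eta> A X" "\<eta> A Y"]
        hom_in_carrier[OF \<eta>A X] hom_in_carrier[OF \<eta>A Y]
      by (simp add: natQ[OF that] X Y XY)
    moreover have "inj_on (\<eta> B) (carrier (ob Q B))" using iso[OF B] by (auto simp: iso_def bij_betw_def)
    ultimately show "mor Q A B f (X \<otimes>\<^bsub>ob Q A\<^esub> Y) = mor Q A B f X \<otimes>\<^bsub>ob Q B\<^esub> mor Q A B f Y"
      using Qmor[OF that] XY fX fY by (auto dest: inj_onD)
  qed
  have setQ: "functor_to_sets C \<lparr>ob = (\<lambda>A. carrier (ob Q A)), mor = mor Q\<rparr>"
  proof (rule functor_to_sets_reflect[of C "\<lparr>ob = (\<lambda>A. carrier (ob G A)), mor = mor G\<rparr>" _ \<eta>])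
    show "functor_to_sets C \<lparr>ob = (\<lambda>A. carrier (ob G A)), mor = mor G\<rparr>"
      using nat unfolding group_natural_transformation_def functor_to_groups_def functor_to_sets_def hom_def by auto
  qed (use Qmor natQ cat iso in \<open>auto simp: iso_def hom_def bij_betw_def\<close>)
  have "functor_to_groups C Q"
    unfolding functor_to_groups_def using groupQ homQ setQ unfolding functor_to_sets_def by auto
  then have "group_natural_transformation C Q G \<eta>"
    unfolding group_natural_transformation_def
    using nat iso natQ by (auto simp: group_natural_transformation_def iso_def)
  then show ?thesis using iso by blast
qed

section \<open>Reduction\<close>

definition red_proj :: "('r, 'a, 'b) cois_dgla \<Rightarrow> int \<Rightarrow> 'b \<Rightarrow> 'b set" where
  "red_proj g i x = dgla_0 g i +>\<^bsub>component (dgla_N g) i\<^esub> x"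

lemma (in dgla) component_closed:
  "x \<in> carrier (component h i) \<Longrightarrow> y \<in> carrier (component h i) \<Longrightarrow>
     x \<oplus>\<^bsub>component h i\<^esub> y \<in> carrier (component h i)"
  "c \<in> carrier k \<Longrightarrow> x \<in> carrier (component h i) \<Longrightarrow> c \<odot>\<^bsub>component h i\<^esub> x \<in> carrier (component h i)"
proof -
  interpret M: module k "component h i" by (rule component_module)
  show "x \<in> carrier (component h i) \<Longrightarrow> y \<in> carrier (component h i) \<Longrightarrow>
     x \<oplus>\<^bsub>component h i\<^esub> y \<in> carrier (component h i)"
    "c \<in> carrier k \<Longrightarrow> x \<in> carrier (component h i) \<Longrightarrow> c \<odot>\<^bsub>component h i\<^esub> x \<in> carrier (component h i)"
    by simp_all
qed

context cois_dgla
begin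

sublocale N: dgla k "dgla_N g" by (rule N)

abbreviation "N i \<equiv> component (dgla_N g) i"
abbreviation "red i \<equiv> component (red_dgla g) i"
abbreviation "proj \<equiv> red_proj g"

lemma abelian_subgroup_null: "abelian_subgroup (dgla_0 g i) (N i)"
  using N.abelian_group_component submodule.axioms(1)[OF null_submodule]
  by (intro abelian_subgroupI3) (auto simp: additive_subgroup_def)

lemma null_subset: "x \<in> dgla_0 g i \<Longrightarrow> x \<in> carrier (N i)"
  using additive_subgroup.a_Hcarr[OF abelian_subgroup.axioms(1)[OF abelian_subgroup_null]] .

lemma null_zero: "\<zero>\<^bsub>N i\<^esub> \<in> dgla_0 g i"
  using additive_subgroup.zero_closed[OF abelian_subgroup.axioms(1)[OF abelian_subgroup_null]] .

lemma proj_absorb: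
  assumes "u \<in> dgla_0 g i" "x \<in> carrier (N i)" shows "proj i (u \<oplus>\<^bsub>N i\<^esub> x) = proj i x"
proof -
  interpret U: abelian_subgroup "dgla_0 g i" "N i" by (rule abelian_subgroup_null)
  show ?thesis
    unfolding red_proj_def using assms
    by (intro U.a_repr_independence[symmetric] U.a_subgroup) (auto simp: a_r_coset_def')
qed

lemma proj_memE:
  assumes "y \<in> proj i x" obtains u where "u \<in> dgla_0 g i" "y = u \<oplus>\<^bsub>N i\<^esub> x"
  using assms unfolding red_proj_def a_r_coset_def' by blast

lemma proj_mem:
  assumes "x \<in> carrier (N i)" "y \<in> proj i x" shows "y \<in> carrier (N i)" "proj i y = proj i x"
proof -
  interpret M: abelian_group "N i" by (rule N.abelian_group_component)
  obtain u where "u \<in> dgla_0 g i" "y = u \<oplus>\<^bsub>N i\<^esub> x" using assms(2) by (rule proj_memE)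
  then show "y \<in> carrier (N i)" "proj i y = proj i x" using assms(1) null_subset proj_absorb by auto
qed

lemma proj_self: "x \<in> carrier (N i) \<Longrightarrow> x \<in> proj i x"
  unfolding red_proj_def by (rule abelian_subgroup.a_rcos_self[OF abelian_subgroup_null])

lemma proj_eq_iff:
  assumes "x \<in> carrier (N i)" "y \<in> carrier (N i)"
  shows "proj i x = proj i y \<longleftrightarrow> x \<ominus>\<^bsub>N i\<^esub> y \<in> dgla_0 g i"
proof -
  interpret M: abelian_group "N i" by (rule N.abelian_group_component)
  have x: "x = (x \<ominus>\<^bsub>N i\<^esub> y) \<oplus>\<^bsub>N i\<^esub> y" using assms by (simp add: M.minus_eq M.a_assoc M.l_neg)
  show ?thesis
  proof
    assume "proj i x = proj i y"
    then obtain u where u: "u \<in> dgla_0 g i" "x = u \<oplus>\<^bsub>N i\<^esub> y" using proj_self[OF assms(1)] by (auto elim: proj_memE)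
    then have "x \<ominus>\<^bsub>N i\<^esub> y = u" using assms null_subset by (simp add: M.minus_eq M.a_assoc M.r_neg)
    then show "x \<ominus>\<^bsub>N i\<^esub> y \<in> dgla_0 g i" using u by simp
  next
    assume "x \<ominus>\<^bsub>N i\<^esub> y \<in> dgla_0 g i"
    then show "proj i x = proj i y" using proj_absorb[of "x \<ominus>\<^bsub>N i\<^esub> y" i y] assms x by simp
  qed
qed

lemma proj_null_iff: "x \<in> carrier (N i) \<Longrightarrow> proj i x = dgla_0 g i \<longleftrightarrow> x \<in> dgla_0 g i"
proof -
  assume x: "x \<in> carrier (N i)"
  interpret U: abelian_subgroup "dgla_0 g i" "N i" by (rule abelian_subgroup_null)
  have "proj i \<zero>\<^bsub>N i\<^esub> = dgla_0 g i" unfolding red_proj_def using U.a_coset_add_zero U.a_subset by blast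
  moreover have "x \<ominus>\<^bsub>N i\<^esub> \<zero>\<^bsub>N i\<^esub> = x"
  proof -
    have "\<ominus>\<^bsub>N i\<^esub> \<zero>\<^bsub>N i\<^esub> = \<zero>\<^bsub>N i\<^esub>" by (rule U.minus_equality) simp_all
    then show ?thesis unfolding a_minus_def using x by (simp only: U.r_zero)
  qed
  ultimately show ?thesis using proj_eq_iff[OF x U.zero_closed] by simp
qed

lemma proj_zero: "proj i \<zero>\<^bsub>N i\<^esub> = dgla_0 g i"
  using proj_null_iff[of "\<zero>\<^bsub>N i\<^esub>" i] null_zero[of i] null_subset by auto

text \<open>Scalar multiplication, bracket, differential and induced maps on the quotient are unions
  over representatives. If translation by null elements does not change \<open>F\<close>, all
  members of the union coincide.\<close>

lemma UN_proj:
  assumes "x \<in> carrier (N i)" "\<And>u. u \<in> dgla_0 g i \<Longrightarrow> F (u \<oplus>\<^bsub>N i\<^esub> x) = F x"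
  shows "(\<Union>y\<in>proj i x. F y) = F x"
  using proj_self[OF assms(1)] assms(2) by (fastforce elim: proj_memE)

lemma red_carrier: "carrier (red i) = proj i ` carrier (N i)"
  by (auto simp: red_dgla_def quotient_module_def A_RCOSETS_def' red_proj_def)

lemma red_zero: "\<zero>\<^bsub>red i\<^esub> = proj i \<zero>\<^bsub>N i\<^esub>"
  unfolding proj_zero by (simp add: red_dgla_def quotient_module_def)

lemma red_add:
  "x \<in> carrier (N i) \<Longrightarrow> y \<in> carrier (N i) \<Longrightarrow> proj i x \<oplus>\<^bsub>red i\<^esub> proj i y = proj i (x \<oplus>\<^bsub>N i\<^esub> y)"
  using abelian_subgroup.a_rcos_sum[OF abelian_subgroup_null]
  by (simp add: red_dgla_def quotient_module_def red_proj_def)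

lemma red_smult:
  assumes "c \<in> carrier k" "x \<in> carrier (N i)"
  shows "c \<odot>\<^bsub>red i\<^esub> proj i x = proj i (c \<odot>\<^bsub>N i\<^esub> x)"
proof -
  interpret M: module k "N i" by (rule N.component_module)
  have "(\<Union>y\<in>proj i x. proj i (c \<odot>\<^bsub>N i\<^esub> y)) = proj i (c \<odot>\<^bsub>N i\<^esub> x)"
    using assms null_subset submodule.smult_closed[OF null_submodule]
    by (intro UN_proj) (auto simp: M.smult_r_distr proj_absorb)
  then show ?thesis by (simp add: red_dgla_def quotient_module_def red_proj_def)
qed

text \<open>The ideal property is assumed in the second argument; antisymmetry carries it to the
  first, up to a sign.\<close>

lemma null_ideal_left:
  assumes "x \<in> dgla_0 g i" "y \<in> carrier (N j)" shows "bracket (dgla_N g) i j x y \<in> dgla_0 g (i + j)"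
proof -
  have "bracket (dgla_N g) j i y x \<in> dgla_0 g (i + j)" using null_ideal[OF assms(2,1)] by (simp add: add.commute)
  then show ?thesis
    using N.bracket_antisymmetric[OF null_subset[OF assms(1)] assms(2)]
      additive_subgroup.a_inv_closed[OF abelian_subgroup.axioms(1)[OF abelian_subgroup_null]]
    by (simp add: signed_def)
qed

lemma red_bracket:
  assumes x: "x \<in> carrier (N i)" and y: "y \<in> carrier (N j)"
  shows "bracket (red_dgla g) i j (proj i x) (proj j y) = proj (i + j) (bracket (dgla_N g) i j x y)"
proof -
  let ?b = "bracket (dgla_N g) i j"
  have left: "proj (i + j) (?b (u \<oplus>\<^bsub>N i\<^esub> x) z) = proj (i + j) (?b x z)" if "u \<in> dgla_0 g i" "z \<in> carrier (N j)" for u z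
    using that x N.bracket_linear_left[OF that(2), of i] null_subset[OF that(1)] null_ideal_left[OF that]
    by (simp add: module_map_def proj_absorb N.bracket_closed)
  have right: "proj (i + j) (?b x (u \<oplus>\<^bsub>N j\<^esub> y)) = proj (i + j) (?b x y)" if "u \<in> dgla_0 g j" for u
    using that y N.bracket_linear_right[OF x, of j] null_subset[OF that] null_ideal[OF x that]
    by (simp add: module_map_def proj_absorb N.bracket_closed x)
  have "(\<Union>x'\<in>proj i x. \<Union>y'\<in>proj j y. proj (i + j) (?b x' y')) = (\<Union>y'\<in>proj j y. proj (i + j) (?b x y'))"
    using left proj_mem(1)[OF y] by (intro UN_proj[OF x]) auto
  also have "\<dots> = proj (i + j) (?b x y)" by (rule UN_proj[OF y right])
  finally show ?thesis by (simp add: red_dgla_def red_proj_def)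
qed

lemma red_differential:
  assumes x: "x \<in> carrier (N i)"
  shows "differential (red_dgla g) i (proj i x) = proj (i + 1) (differential (dgla_N g) i x)"
proof -
  have "(\<Union>y\<in>proj i x. proj (i + 1) (differential (dgla_N g) i y)) = proj (i + 1) (differential (dgla_N g) i x)"
    using x N.differential_linear[of i] null_subset null_differential
    by (intro UN_proj) (auto simp: module_map_def proj_absorb N.differential_closed)
  then show ?thesis by (simp add: red_dgla_def red_proj_def)
qed

lemma module_red: "module k (red i)"
proof -
  interpret M: module k "N i" by (rule N.component_module)
  have "abelian_group (red i)"
  proof (rule abelian_groupI)
    fix X assume "X \<in> carrier (red i)"
    then obtain x where x: "x \<in> carrier (N i)" "X = proj i x" by (auto simp: red_carrier)
    then show "\<exists>Y\<in>carrier (red i). Y \<oplus>\<^bsub>red i\<^esub> X = \<zero>\<^bsub>red i\<^esub>"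
      by (intro bexI[of _ "proj i (\<ominus>\<^bsub>N i\<^esub> x)"]) (auto simp: red_carrier red_add red_zero M.l_neg)
  qed (auto simp: red_carrier red_add red_zero M.a_ac)
  then show ?thesis
    by (intro module.intro module_axioms.intro M.R.is_cring)
      (auto simp: red_carrier red_add red_smult M.smult_l_distr M.smult_r_distr M.smult_assoc1)
qed

lemma red_signed:
  assumes "x \<in> carrier (N i)" shows "signed (red i) l (proj i x) = proj i (signed (N i) l x)"
proof -
  interpret M: abelian_group "N i" by (rule N.abelian_group_component)
  interpret Q: module k "red i" by (rule module_red)
  have "\<ominus>\<^bsub>red i\<^esub> proj i x = proj i (\<ominus>\<^bsub>N i\<^esub> x)"
    using assms by (intro Q.minus_equality) (auto simp: red_carrier red_add red_zero M.l_neg)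
  then show ?thesis by (simp add: signed_def)
qed

lemma signed_closed: "x \<in> carrier (N i) \<Longrightarrow> signed (N i) l x \<in> carrier (N i)"
proof -
  interpret M: abelian_group "N i" by (rule N.abelian_group_component)
  show "x \<in> carrier (N i) \<Longrightarrow> ?thesis" by (simp add: signed_def)
qed

text \<open>The projection is surjective and compatible with all operations, so each law is the
  image of the law for representatives. The auxiliary facts bring degrees to a common form.\<close>

lemma dgla_red: "dgla k (red_dgla g)"
proof (rule dgla.intro)
  fix i j l :: int and X Y Z :: "'b set"
  show "module k (red i)" by (rule module_red)
  show "module_map k (red i) (red (i + 1)) (differential (red_dgla g) i)"
    using N.differential_linear[of i]
    by (auto simp: module_map_def red_carrier red_add red_smult red_differential N.differential_closed
        N.component_closed)
  { assume "X \<in> carrier (red i)"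
    then obtain x where x: "x \<in> carrier (N i)" and X: "X = proj i x" by (auto simp: red_carrier)
    show "module_map k (red j) (red (i + j)) (bracket (red_dgla g) i j X)"
      using N.bracket_linear_right[OF x, of j]
      by (auto simp: X module_map_def red_carrier red_add red_smult red_bracket x N.bracket_closed
          N.component_closed)
    show "differential (red_dgla g) (i + 1) (differential (red_dgla g) i X) = \<zero>\<^bsub>red (i + 2)\<^esub>"
      using N.differential_square[OF x] red_differential[OF N.differential_closed[OF x]]
      by (simp add: X red_differential x red_zero add.commute)
    assume "Y \<in> carrier (red j)"
    then obtain y where y: "y \<in> carrier (N j)" and Y: "Y = proj j y" by (auto simp: red_carrier)
    have yx: "bracket (dgla_N g) j i y x \<in> carrier (N (i + j))"
      using N.bracket_closed[OF y x] by (simp add: add.commute)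
    show "bracket (red_dgla g) i j X Y = signed (red (i + j)) (i * j + 1) (bracket (red_dgla g) j i Y X)"
      using red_signed[OF yx, of "i * j + 1"] N.bracket_antisymmetric[OF x y] red_bracket[OF y x]
      by (simp add: X Y red_bracket x y add.commute[of j i])
    have 1: "bracket (dgla_N g) (i + 1) j (differential (dgla_N g) i x) y \<in> carrier (N (i + j + 1))"
      using N.bracket_closed[OF N.differential_closed[OF x] y] by (simp add: algebra_simps)
    have 2: "bracket (dgla_N g) i (j + 1) x (differential (dgla_N g) j y) \<in> carrier (N (i + j + 1))"
      using N.bracket_closed[OF x N.differential_closed[OF y]] by (simp add: algebra_simps)
    have e1: "bracket (red_dgla g) (i + 1) j (differential (red_dgla g) i X) Y =
        proj (i + j + 1) (bracket (dgla_N g) (i + 1) j (differential (dgla_N g) i x) y)"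
      using red_bracket[OF N.differential_closed[OF x] y] by (simp add: X Y red_differential x algebra_simps)
    have e2: "bracket (red_dgla g) i (j + 1) X (differential (red_dgla g) j Y) =
        proj (i + j + 1) (bracket (dgla_N g) i (j + 1) x (differential (dgla_N g) j y))"
      using red_bracket[OF x N.differential_closed[OF y]] by (simp add: X Y red_differential y algebra_simps)
    show "differential (red_dgla g) (i + j) (bracket (red_dgla g) i j X Y) =
         bracket (red_dgla g) (i + 1) j (differential (red_dgla g) i X) Y
         \<oplus>\<^bsub>red (i + j + 1)\<^esub>
         signed (red (i + j + 1)) i (bracket (red_dgla g) i (j + 1) X (differential (red_dgla g) j Y))"
      unfolding e1 e2 red_signed[OF 2] red_add[OF 1 signed_closed[OF 2]] N.differential_bracket[OF x y, symmetric]
      by (simp add: X Y red_bracket x y red_differential N.bracket_closed)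
    assume "Z \<in> carrier (red l)"
    then obtain z where z: "z \<in> carrier (N l)" and Z: "Z = proj l z" by (auto simp: red_carrier)
    have 1: "bracket (dgla_N g) (i + j) l (bracket (dgla_N g) i j x y) z \<in> carrier (N (i + j + l))"
      by (rule N.bracket_closed[OF N.bracket_closed[OF x y] z])
    have 2: "bracket (dgla_N g) j (i + l) y (bracket (dgla_N g) i l x z) \<in> carrier (N (i + j + l))"
      using N.bracket_closed[OF y N.bracket_closed[OF x z]] by (simp add: algebra_simps)
    have e1: "bracket (red_dgla g) (i + j) l (bracket (red_dgla g) i j X Y) Z =
        proj (i + j + l) (bracket (dgla_N g) (i + j) l (bracket (dgla_N g) i j x y) z)"
      using red_bracket[OF N.bracket_closed[OF x y] z] by (simp add: X Y Z red_bracket x y)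
    have e2: "bracket (red_dgla g) j (i + l) Y (bracket (red_dgla g) i l X Z) =
        proj (i + j + l) (bracket (dgla_N g) j (i + l) y (bracket (dgla_N g) i l x z))"
      using red_bracket[OF y N.bracket_closed[OF x z]] by (simp add: X Y Z red_bracket x z algebra_simps)
    have e3: "bracket (red_dgla g) i (j + l) X (bracket (red_dgla g) j l Y Z) =
        proj (i + j + l) (bracket (dgla_N g) i (j + l) x (bracket (dgla_N g) j l y z))"
      using red_bracket[OF x N.bracket_closed[OF y z]] by (simp add: X Y Z red_bracket y z algebra_simps)
    show "bracket (red_dgla g) i (j + l) X (bracket (red_dgla g) j l Y Z) =
         bracket (red_dgla g) (i + j) l (bracket (red_dgla g) i j X Y) Z
         \<oplus>\<^bsub>red (i + j + l)\<^esub>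
         signed (red (i + j + l)) (i * j) (bracket (red_dgla g) j (i + l) Y (bracket (red_dgla g) i l X Z))"
      unfolding e1 e2 e3 red_signed[OF 2] red_add[OF 1 signed_closed[OF 2]]
      by (rule arg_cong[OF N.bracket_jacobi[OF x y z]]) }
  assume "Y \<in> carrier (red j)"
  then obtain y where y: "y \<in> carrier (N j)" and Y: "Y = proj j y" by (auto simp: red_carrier)
  show "module_map k (red i) (red (i + j)) (\<lambda>X. bracket (red_dgla g) i j X Y)"
    using N.bracket_linear_left[OF y, of i]
    by (auto simp: Y module_map_def red_carrier red_add red_smult red_bracket y N.bracket_closed
        N.component_closed)
qed

lemma proj_morphism: "dgla_morphism k (dgla_N g) (red_dgla g) proj"
  by (auto simp: dgla_morphism_def module_map_def red_carrier red_add red_smult red_bracket red_differential)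

text \<open>Coefficients are lifted one at a time. The constant term is lifted to zero rather than
  to an arbitrary null element, so that the lift again has no constant term.\<close>

lemma series_proj_surj:
  assumes "Y \<in> carrier (component (lambda_dgla (red_dgla g)) i)"
  obtains X where "X \<in> carrier (component (lambda_dgla (dgla_N g)) i)" "series_map proj i X = Y"
proof -
  have "\<forall>n. \<exists>x. x \<in> carrier (N i) \<and> proj i x = Y n \<and> (n = 0 \<longrightarrow> x = \<zero>\<^bsub>N i\<^esub>)"
  proof
    fix n
    have "Y n \<in> proj i ` carrier (N i)" and "Y 0 = proj i \<zero>\<^bsub>N i\<^esub>"
      using assms by (auto simp: lambda_dgla_simps red_carrier red_zero)
    then show "\<exists>x. x \<in> carrier (N i) \<and> proj i x = Y n \<and> (n = 0 \<longrightarrow> x = \<zero>\<^bsub>N i\<^esub>)"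
      using null_subset[OF null_zero, of i] by (cases "n = 0") auto
  qed
  then obtain X where "\<forall>n. X n \<in> carrier (N i) \<and> proj i (X n) = Y n \<and> (n = 0 \<longrightarrow> X n = \<zero>\<^bsub>N i\<^esub>)"
    by metis
  then show thesis by (intro that[of X]) (auto simp: lambda_dgla_simps series_map_def)
qed

lemma lambda_null: "dgla_0 (lambda_cois_dgla g) i = {X. (\<forall>n. X n \<in> dgla_0 g i) \<and> X 0 = \<zero>\<^bsub>N i\<^esub>}"
  by (auto simp: lambda_cois_dgla_def series_cois_dgla_def)

lemma dgla_N_lambda: "dgla_N (lambda_cois_dgla g) = lambda_dgla (dgla_N g)"
  by (simp add: lambda_cois_dgla_def)

text \<open>The difference of two series without constant term has none either, so only the
  coefficientwise condition remains.\<close>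

lemma series_proj_eq_iff:
  assumes X: "X \<in> carrier (component (lambda_dgla (dgla_N g)) i)" and Y: "Y \<in> carrier (component (lambda_dgla (dgla_N g)) i)"
  shows "X \<ominus>\<^bsub>component (lambda_dgla (dgla_N g)) i\<^esub> Y \<in> dgla_0 (lambda_cois_dgla g) i \<longleftrightarrow>
    series_map proj i X = series_map proj i Y"
proof -
  interpret M: abelian_group "N i" by (rule N.abelian_group_component)
  show ?thesis
    using X Y unfolding N.minus_lambda[OF X Y] lambda_null
    by (auto simp: lambda_dgla_simps series_map_def fun_eq_iff proj_eq_iff a_minus_def)
qed

lemma set_rel_maurer_cartan:
  "set_rel (cois_maurer_cartan \<rho> g) =
     {(x, y). x \<in> maurer_cartan \<rho> (dgla_N g) \<and> y \<in> maurer_cartan \<rho> (dgla_N g) \<and> proj 1 x = proj 1 y}"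
  by (simp add: cois_maurer_cartan_def maurer_cartan_def proj_eq_iff cong: conj_cong)

lemma set_rel_maurer_cartan_lambda:
  "set_rel (cois_maurer_cartan \<rho> (lambda_cois_dgla g)) =
     {(x, y). x \<in> maurer_cartan \<rho> (lambda_dgla (dgla_N g)) \<and> y \<in> maurer_cartan \<rho> (lambda_dgla (dgla_N g)) \<and>
       series_map proj 1 x = series_map proj 1 y}"
  by (simp add: cois_maurer_cartan_def dgla_N_lambda maurer_cartan_def series_proj_eq_iff cong: conj_cong)

lemma red_dgla_map_proj:
  assumes h: "cois_dgla k h" and \<Phi>: "cois_dgla_morphism k g h \<Phi>" and x: "x \<in> carrier (N i)"
  shows "red_dgla_map h \<Phi> i (proj i x) = red_proj h i (snd \<Phi> i x)"
proof -
  interpret h: cois_dgla k h by (rule h)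
  have \<phi>: "module_map k (N i) (h.N i) (snd \<Phi> i)" "snd \<Phi> i ` dgla_0 g i \<subseteq> dgla_0 h i"
    using \<Phi> by (auto simp: cois_dgla_morphism_def dgla_morphism_def)
  have "(\<Union>y\<in>proj i x. h.proj i (snd \<Phi> i y)) = h.proj i (snd \<Phi> i x)"
    using \<phi> x null_subset by (intro UN_proj) (auto simp: module_map_def h.proj_absorb image_subset_iff Pi_iff)
  then show ?thesis by (simp add: red_dgla_map_def red_proj_def)
qed

end

section \<open>Reduction as a functor and the projection as a natural transformation\<close>

definition N_dgla ::
  "(('r, 'a, 'b) cois_dgla, ('a, 'b) cois_dgla_map, ('r, 'b) dgla, int \<Rightarrow> 'b \<Rightarrow> 'b) functor_data" where
  "N_dgla = \<lparr>ob = dgla_N, mor = (\<lambda>g h. snd)\<rparr>"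

lemma dgla_morphism_id: "dgla_morphism k h h (\<lambda>i x. x)"
  by (auto simp: dgla_morphism_def module_map_def)

lemma dgla_morphism_comp:
  "dgla_morphism k h h' \<phi> \<Longrightarrow> dgla_morphism k h' h'' \<psi> \<Longrightarrow> dgla_morphism k h h'' (\<lambda>i. \<psi> i \<circ> \<phi> i)"
  unfolding dgla_morphism_def module_map_def by (simp add: Pi_iff)

lemma cois_dgla_category_identity:
  "g \<in> objects (cois_dgla_category k) \<Longrightarrow> identity (cois_dgla_category k) g \<in> arrows (cois_dgla_category k) g g"
  by (auto simp: cois_dgla_category_def cois_dgla_morphism_def dgla_morphism_id)

lemma cois_dgla_category_compose:
  "\<Phi> \<in> arrows (cois_dgla_category k) g h \<Longrightarrow> \<Psi> \<in> arrows (cois_dgla_category k) h h' \<Longrightarrow>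
     compose_arrows (cois_dgla_category k) \<Psi> \<Phi> \<in> arrows (cois_dgla_category k) g h'"
proof -
  assume \<Phi>: "\<Phi> \<in> arrows (cois_dgla_category k) g h" and \<Psi>: "\<Psi> \<in> arrows (cois_dgla_category k) h h'"
  then have "dgla_morphism k (dgla_N g) (dgla_N h) (snd \<Phi>)"
    by (simp add: cois_dgla_category_def cois_dgla_morphism_def)
  then have "snd \<Phi> i x \<in> carrier (component (dgla_N h) i)" if "x \<in> carrier (component (dgla_N g) i)" for i x
    using that by (auto simp: dgla_morphism_def module_map_def)
  then show ?thesis
    using \<Phi> \<Psi> by (auto simp: cois_dgla_category_def cois_dgla_morphism_def dgla_morphism_comp image_subset_iff)
qed

lemma functor_N_dgla: "functor_to_dglas k (cois_dgla_category k) N_dgla"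
  by (auto simp: functor_to_dglas_def cois_dgla_category_def N_dgla_def cois_dgla_morphism_def intro: cois_dgla.N)

lemma red_dgla_map_morphism:
  assumes g: "cois_dgla k g" and h: "cois_dgla k h" and \<Phi>: "cois_dgla_morphism k g h \<Phi>"
  shows "dgla_morphism k (red_dgla g) (red_dgla h) (red_dgla_map h \<Phi>)"
proof -
  interpret g: cois_dgla k g by (rule g)
  interpret h: cois_dgla k h by (rule h)
  have \<phi>: "dgla_morphism k (dgla_N g) (dgla_N h) (snd \<Phi>)" using \<Phi> by (simp add: cois_dgla_morphism_def)
  then have closed: "snd \<Phi> i x \<in> carrier (h.N i)" if "x \<in> carrier (g.N i)" for i x
    using that by (auto simp: dgla_morphism_def module_map_def)
  show ?thesis
    using \<phi>
    by (auto simp: dgla_morphism_def module_map_def g.red_carrier h.red_carrier g.red_add h.red_add g.red_smult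
        h.red_smult g.red_bracket h.red_bracket g.red_differential h.red_differential
        g.red_dgla_map_proj[OF h \<Phi>] closed g.N.bracket_closed g.N.differential_closed
        g.N.component_closed)
qed

lemma functor_Red_dgla:
  fixes k :: "('r, 'm) ring_scheme"
  shows "functor_to_dglas k (cois_dgla_category k)
    (Red_dgla :: (('r, 'a, 'b) cois_dgla, ('a, 'b) cois_dgla_map, _, _) functor_data)"
proof -
  let ?C = "cois_dgla_category k :: (('r, 'a, 'b) cois_dgla, ('a, 'b) cois_dgla_map) category"
  have obj: "g \<in> objects ?C \<longleftrightarrow> cois_dgla k g" and arr: "\<Phi> \<in> arrows ?C g h \<longleftrightarrow> cois_dgla_morphism k g h \<Phi>"
    for g h \<Phi> by (simp_all add: cois_dgla_category_def)
  show ?thesis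
    unfolding functor_to_dglas_def
  proof (intro conjI ballI allI)
    fix g assume "g \<in> objects ?C"
    then interpret g: cois_dgla k g by (simp add: obj)
    show "dgla k (ob Red_dgla g)" by (simp add: Red_dgla_def g.dgla_red)
    show "mor Red_dgla g g (identity ?C g) i X = X" if X: "X \<in> carrier (component (ob Red_dgla g) i)" for i X
    proof -
      obtain x where x: "x \<in> carrier (g.N i)" "X = g.proj i x" using X by (auto simp: Red_dgla_def g.red_carrier)
      have "cois_dgla_morphism k g g (identity ?C g)"
        using cois_dgla_category_identity[of g k] g.cois_dgla_axioms by (simp add: obj arr)
      then show ?thesis
        using g.red_dgla_map_proj[OF g.cois_dgla_axioms _ x(1)] by (simp add: Red_dgla_def x(2) cois_dgla_category_def)
    qed
    fix h assume "h \<in> objects ?C"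
    then interpret h: cois_dgla k h by (simp add: obj)
    show "dgla_morphism k (ob Red_dgla g) (ob Red_dgla h) (mor Red_dgla g h \<Phi>)" if "\<Phi> \<in> arrows ?C g h" for \<Phi>
      using that red_dgla_map_morphism[OF g.cois_dgla_axioms h.cois_dgla_axioms] by (simp add: Red_dgla_def arr)
    fix h' \<Phi> \<Psi> i X assume "h' \<in> objects ?C" and \<Phi>: "\<Phi> \<in> arrows ?C g h" and \<Psi>: "\<Psi> \<in> arrows ?C h h'"
      and X: "X \<in> carrier (component (ob Red_dgla g) i)"
    then interpret h': cois_dgla k h' by (simp add: obj)
    obtain x where x: "x \<in> carrier (g.N i)" "X = g.proj i x" using X by (auto simp: Red_dgla_def g.red_carrier)
    have "snd \<Phi> i x \<in> carrier (h.N i)"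
      using \<Phi> x(1) by (auto simp: arr cois_dgla_morphism_def dgla_morphism_def module_map_def)
    then show "mor Red_dgla g h' (compose_arrows ?C \<Psi> \<Phi>) i X = mor Red_dgla h h' \<Psi> i (mor Red_dgla g h \<Phi> i X)"
      using g.red_dgla_map_proj[OF h.cois_dgla_axioms _ x(1)] g.red_dgla_map_proj[OF h'.cois_dgla_axioms _ x(1)]
        h.red_dgla_map_proj[OF h'.cois_dgla_axioms] cois_dgla_category_compose[OF \<Phi> \<Psi>] \<Phi> \<Psi>
      by (simp add: Red_dgla_def x(2) arr) (simp add: cois_dgla_category_def)
  qed
qed

theorem dgla_natural_red_proj: "dgla_natural_transformation k (cois_dgla_category k) N_dgla Red_dgla red_proj"
  unfolding dgla_natural_transformation_def
  by (intro conjI functor_N_dgla functor_Red_dgla)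
    (simp_all add: cois_dgla_category_def N_dgla_def Red_dgla_def cois_dgla.proj_morphism cois_dgla.red_dgla_map_proj)

text \<open>Related representatives have equal projections, hence equal reduced classes. Conversely,
  if the reduced classes agree, a gauge element of the reduction moves the projection of \<xi> to
  that of \<zeta>; a lift of it moves \<xi> within its orbit to a representative with the projection
  of \<zeta>. In particular the relation, defined through the existence of representatives, is
  transitive.\<close>

lemma (in cois_dgla) set_rel_deformations:
  assumes "cring k" "\<rho> \<in> ring_hom rat_ring k"
  shows "set_rel (cois_deformations \<rho> g) =
    {(X, Y). X \<in> deformations \<rho> (dgla_N g) \<and> Y \<in> deformations \<rho> (dgla_N g) \<and>
      deformation_map \<rho> (red_dgla g) proj X = deformation_map \<rho> (red_dgla g) proj Y}"
proof -
  interpret P: rat_dgla_hom k "dgla_N g" "red_dgla g" \<rho> proj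
    by (rule rat_dgla_homI[OF assms N dgla_red proj_morphism])
  have "(\<exists>\<xi>\<in>X. \<exists>\<zeta>\<in>Y. (\<xi>, \<zeta>) \<in> set_rel (cois_maurer_cartan \<rho> (lambda_cois_dgla g))) \<longleftrightarrow>
      deformation_map \<rho> (red_dgla g) proj X = deformation_map \<rho> (red_dgla g) proj Y"
    if X: "X \<in> deformations \<rho> (dgla_N g)" and Y: "Y \<in> deformations \<rho> (dgla_N g)" for X Y
  proof
    assume "\<exists>\<xi>\<in>X. \<exists>\<zeta>\<in>Y. (\<xi>, \<zeta>) \<in> set_rel (cois_maurer_cartan \<rho> (lambda_cois_dgla g))"
    then obtain \<xi> \<zeta> where *: "\<xi> \<in> X" "\<zeta> \<in> Y" "series_map proj 1 \<xi> = series_map proj 1 \<zeta>"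
      unfolding set_rel_maurer_cartan_lambda by blast
    then show "deformation_map \<rho> (red_dgla g) proj X = deformation_map \<rho> (red_dgla g) proj Y"
      using P.H.deformations_mem[OF X *(1)] P.H.deformations_mem[OF Y *(2)] P.deformation_map_orbit by metis
  next
    assume eq: "deformation_map \<rho> (red_dgla g) proj X = deformation_map \<rho> (red_dgla g) proj Y"
    obtain \<xi> where \<xi>: "\<xi> \<in> maurer_cartan \<rho> (lambda_dgla (dgla_N g))" "X = gauge_orbit \<rho> (dgla_N g) \<xi>"
      using X by (rule P.H.deformationsE)
    obtain \<zeta> where \<zeta>: "\<zeta> \<in> maurer_cartan \<rho> (lambda_dgla (dgla_N g))" "Y = gauge_orbit \<rho> (dgla_N g) \<zeta>"
      using Y by (rule P.H.deformationsE)
    have "series_map proj 1 \<zeta> \<in> gauge_orbit \<rho> (red_dgla g) (series_map proj 1 \<xi>)"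
      using eq P.H'.gauge_orbit_refl[OF P.maurer_cartan_lambda_map[OF \<zeta>(1)]]
      by (simp add: \<xi>(2) \<zeta>(2) P.deformation_map_orbit \<xi>(1) \<zeta>(1))
    then obtain \<gamma>' where \<gamma>': "\<gamma>' \<in> carrier (component (lambda_dgla (red_dgla g)) 0)"
      "series_map proj 1 \<zeta> = gauge_action \<rho> (red_dgla g) \<gamma>' (series_map proj 1 \<xi>)"
      unfolding orbit_def by auto
    obtain \<gamma> where \<gamma>: "\<gamma> \<in> carrier (component (lambda_dgla (dgla_N g)) 0)" "series_map proj 0 \<gamma> = \<gamma>'"
      using \<gamma>'(1) by (rule series_proj_surj)
    let ?\<xi> = "gauge_action \<rho> (dgla_N g) \<gamma> \<xi>"
    have mem: "?\<xi> \<in> X" unfolding \<xi>(2) orbit_def using \<gamma>(1) by auto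
    moreover have "\<zeta> \<in> Y" using P.H.gauge_orbit_refl[OF \<zeta>(1)] \<zeta>(2) by simp
    moreover have "series_map proj 1 ?\<xi> = series_map proj 1 \<zeta>"
      using P.series_map_gauge_action[OF \<gamma>(1) P.H.maurer_cartan_carrier[OF \<xi>(1)]] \<gamma>'(2) \<gamma>(2) by simp
    ultimately show "\<exists>\<xi>\<in>X. \<exists>\<zeta>\<in>Y. (\<xi>, \<zeta>) \<in> set_rel (cois_maurer_cartan \<rho> (lambda_cois_dgla g))"
      unfolding set_rel_maurer_cartan_lambda using P.H.deformations_mem(1)[OF X mem] \<zeta>(1) by blast
  qed
  then show ?thesis unfolding cois_deformations_def by auto
qed

text \<open>The unit of the reduced gauge group is the zero series, and the zero of each quotient
  component is the null submodule itself.\<close>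

lemma (in cois_dgla) gauge_kernel:
  assumes "cring k" "\<rho> \<in> ring_hom rat_ring k"
  shows "dgla_0 (lambda_cois_dgla g) 0 =
    kernel (gauge_group \<rho> (dgla_N g)) (gauge_group \<rho> (red_dgla g)) (series_map proj 0)"
proof -
  interpret P: rat_dgla_hom k "dgla_N g" "red_dgla g" \<rho> proj
    by (rule rat_dgla_homI[OF assms N dgla_red proj_morphism])
  show ?thesis
    unfolding kernel_def P.H.gauge_group_simps P.H'.gauge_group_simps lambda_null
      lambda_dgla_simps series_map_def fun_eq_iff red_zero proj_zero
    using proj_null_iff null_subset by blast
qed

theorem theorem3p14:
  fixes k :: "('r, 'm) ring_scheme" and \<rho> :: "rat \<Rightarrow> 'r"
    and C :: "(('r, 'a, 'b) cois_dgla, ('a, 'b) cois_dgla_map) category"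
  assumes "cring k" and "\<rho> \<in> ring_hom rat_ring k" and "inj \<rho>"
    and "C = cois_dgla_category k"
  shows "(\<exists>\<eta>. set_natural_transformation C (Red_set \<circ>\<^sub>F cois_MC \<rho>) (MC \<rho> \<circ>\<^sub>F Red_dgla) \<eta> \<and>
            (\<forall>g\<in>objects C. inj_on (\<eta> g) (ob (Red_set \<circ>\<^sub>F cois_MC \<rho>) g))) \<and>
         (\<exists>\<eta>. group_natural_transformation C (Red_group \<circ>\<^sub>F cois_Gauge \<rho>) (Gauge \<rho> \<circ>\<^sub>F Red_dgla) \<eta> \<and>
            (\<forall>g\<in>objects C.
               \<eta> g \<in> iso (ob (Red_group \<circ>\<^sub>F cois_Gauge \<rho>) g) (ob (Gauge \<rho> \<circ>\<^sub>F Red_dgla) g))) \<and>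
         (\<exists>\<eta>. set_natural_transformation C (Red_set \<circ>\<^sub>F cois_Def \<rho>) (Def \<rho> \<circ>\<^sub>F Red_dgla) \<eta> \<and>
            (\<forall>g\<in>objects C. inj_on (\<eta> g) (ob (Red_set \<circ>\<^sub>F cois_Def \<rho>) g)))"
proof (intro conjI)
  have nat: "dgla_natural_transformation k C N_dgla Red_dgla red_proj"
    unfolding assms(4) by (rule dgla_natural_red_proj)
  have obj: "cois_dgla k g" if "g \<in> objects C" for g
    using that by (simp add: assms(4) cois_dgla_category_def)
  have id: "identity C g \<in> arrows C g g" if "g \<in> objects C" for g
    using cois_dgla_category_identity[of g k] that by (simp add: assms(4))
  have comp: "compose_arrows C \<Psi> \<Phi> \<in> arrows C g h'"
    if "\<Phi> \<in> arrows C g h" "\<Psi> \<in> arrows C h h'" for g h h' \<Phi> \<Psi>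
    using cois_dgla_category_compose[of \<Phi> k g h \<Psi> h'] that by (simp add: assms(4))
  show "\<exists>\<eta>. set_natural_transformation C (Red_set \<circ>\<^sub>F cois_MC \<rho>) (MC \<rho> \<circ>\<^sub>F Red_dgla) \<eta> \<and>
      (\<forall>g\<in>objects C. inj_on (\<eta> g) (ob (Red_set \<circ>\<^sub>F cois_MC \<rho>) g))"
  proof (rule fibre_quotient[OF natural_MC[OF assms(1,2) nat],
        where R = "\<lambda>g. set_rel (cois_maurer_cartan \<rho> g)"])
    show "set_rel (cois_maurer_cartan \<rho> g) = {(x, y). x \<in> ob (MC \<rho> \<circ>\<^sub>F N_dgla) g \<and> y \<in> ob (MC \<rho> \<circ>\<^sub>F N_dgla) g \<and>
        red_proj g 1 x = red_proj g 1 y}" if "g \<in> objects C" for g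
      using cois_dgla.set_rel_maurer_cartan[OF obj[OF that]] by (simp add: N_dgla_def)
  qed (use id comp in \<open>auto simp: Red_set_def cois_MC_def N_dgla_def cois_maurer_cartan_def\<close>)
  show "\<exists>\<eta>. group_natural_transformation C (Red_group \<circ>\<^sub>F cois_Gauge \<rho>) (Gauge \<rho> \<circ>\<^sub>F Red_dgla) \<eta> \<and>
      (\<forall>g\<in>objects C. \<eta> g \<in> iso (ob (Red_group \<circ>\<^sub>F cois_Gauge \<rho>) g) (ob (Gauge \<rho> \<circ>\<^sub>F Red_dgla) g))"
  proof (rule kernel_quotient[OF natural_Gauge[OF assms(1,2) nat],
        where K = "\<lambda>g. dgla_0 (lambda_cois_dgla g) 0"])
    fix g assume g: "g \<in> objects C"
    interpret g: cois_dgla k g by (rule obj[OF g])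
    interpret P: rat_dgla_hom k "dgla_N g" "red_dgla g" \<rho> g.proj
      by (rule rat_dgla_homI[OF assms(1,2) g.N g.dgla_red g.proj_morphism])
    show "dgla_0 (lambda_cois_dgla g) 0 =
        kernel (ob (Gauge \<rho> \<circ>\<^sub>F N_dgla) g) (ob (Gauge \<rho> \<circ>\<^sub>F Red_dgla) g) (series_map (red_proj g) 0)"
      using g.gauge_kernel[OF assms(1,2)] by (simp add: N_dgla_def Red_dgla_def)
    \<comment> \<open>Here lies the difference between the isomorphism for gauge groups and the mere
      injections for the other two functors: a gauge element satisfies no equation and always lifts,
      whereas a lift of a Maurer-Cartan element solves its equation only modulo the null
      ideal.\<close>
    show "series_map (red_proj g) 0 ` carrier (ob (Gauge \<rho> \<circ>\<^sub>F N_dgla) g) = carrier (ob (Gauge \<rho> \<circ>\<^sub>F Red_dgla) g)"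
      using P.series_map_lambda g.series_proj_surj by (auto simp: N_dgla_def Red_dgla_def) (metis imageI)
  qed (use id comp in \<open>auto simp: Red_group_def cois_Gauge_def N_dgla_def cois_gauge_group_def\<close>)
  show "\<exists>\<eta>. set_natural_transformation C (Red_set \<circ>\<^sub>F cois_Def \<rho>) (Def \<rho> \<circ>\<^sub>F Red_dgla) \<eta> \<and>
      (\<forall>g\<in>objects C. inj_on (\<eta> g) (ob (Red_set \<circ>\<^sub>F cois_Def \<rho>) g))"
  proof (rule fibre_quotient[OF natural_Def[OF assms(1,2) nat],
        where R = "\<lambda>g. set_rel (cois_deformations \<rho> g)"])
    show "set_rel (cois_deformations \<rho> g) = {(x, y). x \<in> ob (Def \<rho> \<circ>\<^sub>F N_dgla) g \<and> y \<in> ob (Def \<rho> \<circ>\<^sub>F N_dgla) g \<and>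
        deformation_map \<rho> (ob Red_dgla g) (red_proj g) x = deformation_map \<rho> (ob Red_dgla g) (red_proj g) y}"
      if "g \<in> objects C" for g
      using cois_dgla.set_rel_deformations[OF obj[OF that] assms(1,2)] by (simp add: N_dgla_def Red_dgla_def)
  qed (use id comp in \<open>auto simp: Red_set_def cois_Def_def N_dgla_def cois_deformations_def\<close>)
qed

end
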